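(* Let $G$ be a finite group and let $p\in\pi(G)$. (1) Assume $G$ is $p$-solvable and let $k\geq 3$ be an integer. Then $h_p(G)\leq k$ if and only if $h_p(G/N^{\infty}_{\mathscr{U}_p}(G))\leq k$. (2) Assume $G$ is solvable and let $k\geq 2$ be an integer. Then $l_p(G)\leq k$ if and only if $l_p(G/N^{\infty}_{\mathscr{U}}(G))\leq k$.
   Context: All groups are finite; $\pi(G)$ is the set of prime divisors of $|G|$. A group is $p$-solvable if each of its chief factors is a $p$-group or a $p'$-group, and $p$-supersolvable if each of its chief factors is either of order $p$ or a $p'$-group. $\mathscr{U}$ (resp. $\mathscr{U}_p$) is the class of supersolvable (resp. $p$-supersolvable) groups. For $\mathscr{F}\in\{\mathscr{U},\mathscr{U}_p\}$ and a group $T$, $T^{\mathscr{F}}$ is the intersection of all normal subgroups $N$ of $T$ with $T/N\in\mathscr{F}$. Put $N_{\mathscr{F}}(G)=\bigcap_{T\le G}N_G(T^{\mathscr{F}})$, over all subgroups $T$ of $G$; set $N^0_{\mathscr{F}}(G)=1$ and $N^{i+1}_{\mathscr{F}}(G)/N^{i}_{\mathscr{F}}(G)=N_{\mathscr{F}}(G/N^{i}_{\mathscr{F}}(G))$; $N^{\infty}_{\mathscr{F}}(G)$ is the terminal term of this ascending series. $F_p(G)=O_{p'p}(G)$ is the $p$-Fitting subgroup (the largest normal $p$-nilpotent subgroup). For $p$-solvable $G$: the $p$-Fitting length $h_p(G)$ is the smallest positive integer $n$ with $F_p^n(G)=G$, where $F_p^0(G)=1$, $F_p^1(G)=F_p(G)$,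 $F_p^{i+1}(G)/F_p^i(G)=F_p(G/F_p^i(G))$; the $p$-length $l_p(G)$ is the number of (nontrivial) $p$-factors $P_i/M_{i-1}$ in the upper $p$-series $1=P_0\unlhd M_0\unlhd P_1\unlhd M_1\unlhd\cdots\unlhd P_n\unlhd M_n=G$, where $M_i/P_i=O_{p'}(G/P_i)$ and $P_i/M_{i-1}=O_p(G/M_{i-1})$. *)

theory Defs
  imports "HOL-Algebra.Algebra" "HOL-Computational_Algebra.Primes"
begin

text \<open>
  A section \<open>H/K\<close> of \<open>G\<close> is rendered as \<open>G\<lparr>carrier := H\<rparr> Mod K\<close>. If \<open>A\<close> is a set of cosets of \<open>N\<close>,
  that is, a subset of the carrier of \<open>G Mod N\<close>, then \<open>\<Union>A\<close> is its full preimage in \<open>G\<close>; an ascending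
  series given by \<open>X (i + 1) / X i = \<Phi> (G / X i)\<close> is therefore defined by
  \<open>X (i + 1) = \<Union>(\<Phi> (G Mod X i))\<close>.
\<close>

definition p_group :: "nat \<Rightarrow> ('a, 'b) monoid_scheme \<Rightarrow> bool"
  where "p_group p G \<longleftrightarrow> group G \<and> (\<exists>n. order G = p ^ n)"

text \<open>Infinite groups have order \<open>0\<close>, which \<open>p\<close> divides, so they are excluded.\<close>

definition p'_group :: "nat \<Rightarrow> ('a, 'b) monoid_scheme \<Rightarrow> bool"
  where "p'_group p G \<longleftrightarrow> group G \<and> \<not> p dvd order G"

definition chief_factor :: "('a, 'b) monoid_scheme \<Rightarrow> 'a set \<Rightarrow> 'a set \<Rightarrow> bool"
  where "chief_factor G H K \<longleftrightarrow>
    H \<lhd> G \<and> K \<lhd> G \<and> K \<subset> H \<and> (\<forall>L. L \<lhd> G \<longrightarrow> K \<subseteq> L \<longrightarrow> L \<subseteq> H \<longrightarrow> L = K \<or> L = H)"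

definition p_solvable :: "nat \<Rightarrow> ('a, 'b) monoid_scheme \<Rightarrow> bool"
  where "p_solvable p G \<longleftrightarrow>
    (\<forall>H K. chief_factor G H K \<longrightarrow>
      p_group p (G\<lparr>carrier := H\<rparr> Mod K) \<or> p'_group p (G\<lparr>carrier := H\<rparr> Mod K))"

definition p_supersolvable :: "nat \<Rightarrow> ('a, 'b) monoid_scheme \<Rightarrow> bool"
  where "p_supersolvable p G \<longleftrightarrow>
    (\<forall>H K. chief_factor G H K \<longrightarrow>
      order (G\<lparr>carrier := H\<rparr> Mod K) = p \<or> p'_group p (G\<lparr>carrier := H\<rparr> Mod K))"

text \<open>
  Supersolvable: there is a series from \<open>1\<close> to \<open>G\<close> with cyclic factors, all of whose terms are normal
  in the whole group (in contrast to \<^const>\<open>solvable_seq\<close>).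
\<close>

inductive supersolvable_seq :: "('a, 'b) monoid_scheme \<Rightarrow> 'a set \<Rightarrow> bool"
  for G where
    unity: "supersolvable_seq G {\<one>\<^bsub>G\<^esub>}"
  | extension: "\<lbrakk> supersolvable_seq G K; K \<subseteq> H; H \<lhd> G; cyclic_group (G\<lparr>carrier := H\<rparr> Mod K) \<rbrakk>
      \<Longrightarrow> supersolvable_seq G H"

definition supersolvable :: "('a, 'b) monoid_scheme \<Rightarrow> bool"
  where "supersolvable G \<longleftrightarrow> supersolvable_seq G (carrier G)"

text \<open>
  A class of groups enters the following definitions as a predicate at one fixed type, namely that
  of the quotients it has to be tested on: quotients of \<open>T\<close> for the residual, and quotients of
  subgroups of \<open>G Mod N\<close> for the ascending series.
\<close>

definition residual :: "('a set monoid \<Rightarrow> bool) \<Rightarrow> ('a, 'b) monoid_scheme \<Rightarrow> 'a set"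
  where "residual \<F> T = \<Inter>{N. N \<lhd> T \<and> \<F> (T Mod N)}"

definition residual_norm :: "('a set monoid \<Rightarrow> bool) \<Rightarrow> ('a, 'b) monoid_scheme \<Rightarrow> 'a set"
  where "residual_norm \<F> G =
    (\<Inter>T \<in> {T. subgroup T G}. normalizer G (residual \<F> (G\<lparr>carrier := T\<rparr>)))"

primrec residual_norm_series ::
    "('a set set monoid \<Rightarrow> bool) \<Rightarrow> ('a, 'b) monoid_scheme \<Rightarrow> nat \<Rightarrow> 'a set"
  where
    "residual_norm_series \<F> G 0 = {\<one>\<^bsub>G\<^esub>}"
  | "residual_norm_series \<F> G (Suc i) = \<Union>(residual_norm \<F> (G Mod residual_norm_series \<F> G i))"

text \<open>The least index below exists for finite \<open>G\<close>, the series being ascending.\<close>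

definition residual_norm_inf ::
    "('a set set monoid \<Rightarrow> bool) \<Rightarrow> ('a, 'b) monoid_scheme \<Rightarrow> 'a set"
  where "residual_norm_inf \<F> G =
    residual_norm_series \<F> G
      (LEAST n. residual_norm_series \<F> G (Suc n) = residual_norm_series \<F> G n)"

text \<open>
  \<open>O\<^sub>p(G)\<close> and \<open>O\<^bsub>p'\<^esub>(G)\<close>, the largest normal \<open>p\<close>- and \<open>p'\<close>-subgroups of the finite group \<open>G\<close>, as the
  subgroups generated by all normal \<open>p\<close>- and \<open>p'\<close>-subgroups.
\<close>

definition p_core :: "nat \<Rightarrow> ('a, 'b) monoid_scheme \<Rightarrow> 'a set"
  where "p_core p G = generate G (\<Union>{N. N \<lhd> G \<and> p_group p (G\<lparr>carrier := N\<rparr>)})"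

definition p'_core :: "nat \<Rightarrow> ('a, 'b) monoid_scheme \<Rightarrow> 'a set"
  where "p'_core p G = generate G (\<Union>{N. N \<lhd> G \<and> p'_group p (G\<lparr>carrier := N\<rparr>)})"

text \<open>\<open>F\<^sub>p(G) = O\<^bsub>p'p\<^esub>(G)\<close>, that is, \<open>F\<^sub>p(G) / O\<^bsub>p'\<^esub>(G) = O\<^sub>p(G / O\<^bsub>p'\<^esub>(G))\<close>.\<close>

definition p_Fitting :: "nat \<Rightarrow> ('a, 'b) monoid_scheme \<Rightarrow> 'a set"
  where "p_Fitting p G = \<Union>(p_core p (G Mod p'_core p G))"

primrec p_Fitting_series :: "nat \<Rightarrow> ('a, 'b) monoid_scheme \<Rightarrow> nat \<Rightarrow> 'a set"
  where
    "p_Fitting_series p G 0 = {\<one>\<^bsub>G\<^esub>}"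
  | "p_Fitting_series p G (Suc i) = \<Union>(p_Fitting p (G Mod p_Fitting_series p G i))"

text \<open>Meaningful for \<open>p\<close>-solvable \<open>G\<close> only; the trivial group has \<open>p\<close>-Fitting length \<open>1\<close>.\<close>

definition p_Fitting_length :: "nat \<Rightarrow> ('a, 'b) monoid_scheme \<Rightarrow> nat"
  where "p_Fitting_length p G = (LEAST n. 0 < n \<and> p_Fitting_series p G n = carrier G)"

text \<open>
  The upper \<open>p\<close>-series \<open>P\<^sub>0 \<le> M\<^sub>0 \<le> P\<^sub>1 \<le> M\<^sub>1 \<le> \<dots>\<close>: \<open>upper_P p G i\<close> is \<open>P\<^sub>i\<close> and \<open>upper_M p G i\<close> is \<open>M\<^sub>i\<close>.
  It is continued indefinitely; once a term equals \<open>G\<close> (which happens for \<open>p\<close>-solvable \<open>G\<close>) all later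
  factors are trivial, so the number of nontrivial factors \<open>P\<^bsub>i+1\<^esub>/M\<^sub>i\<close> is not affected.
\<close>

primrec upper_P :: "nat \<Rightarrow> ('a, 'b) monoid_scheme \<Rightarrow> nat \<Rightarrow> 'a set"
  where
    "upper_P p G 0 = {\<one>\<^bsub>G\<^esub>}"
  | "upper_P p G (Suc i) = \<Union>(p_core p (G Mod \<Union>(p'_core p (G Mod upper_P p G i))))"

definition upper_M :: "nat \<Rightarrow> ('a, 'b) monoid_scheme \<Rightarrow> nat \<Rightarrow> 'a set"
  where "upper_M p G i = \<Union>(p'_core p (G Mod upper_P p G i))"

definition p_length :: "nat \<Rightarrow> ('a, 'b) monoid_scheme \<Rightarrow> nat"
  where "p_length p G = card {i. upper_P p G (Suc i) \<noteq> upper_M p G i}"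

end

theory Submission
  imports Defs "HOL-Number_Theory.Residues"
begin

text \<open>
  Both invariants are read off from the same ascending series. The terms \<open>P\<^sub>i\<close> of the upper \<open>p\<close>-series
  are the iterated \<open>p\<close>-Fitting subgroups, and they grow as fast as possible; so for \<open>p\<close>-solvable \<open>G\<close> the
  condition \<open>h\<^sub>p(G) \<le> k\<close> says that \<open>G\<close> has a normal series with factors of the types
  \<open>p', p, p', p, \<dots>, p', p\<close> (\<open>k\<close> pairs), and \<open>l\<^sub>p(G) \<le> k\<close> says the same with one more \<open>p'\<close> at the end.
  The predicate \<open>pi_series G w N\<close> states that \<open>G/N\<close> has a normal series whose factors have the types
  listed in \<open>w\<close>. For a fixed \<open>w\<close> this is inherited by larger \<open>N\<close>, by intersections
  \<open>N\<^sub>1 \<inter> N\<^sub>2\<close> (\<open>pi_series_mono\<close>, \<open>pi_series_Int\<close>), and it can be transported to and from quotients.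
  The theorem becomes: for such a \<open>w\<close>, the group \<open>G\<close> has a series of type \<open>w\<close> if and only if
  \<open>G/N\<^sup>\<infinity>\<close> has one. Only one direction has content, and by induction along the ascending series it is
  enough to descend from \<open>N = N\<^bsub>\<F>\<^esub>(G)\<close> to \<open>1\<close> (\<open>pi_series_residual_norm\<close>).

  Descend along a chief series through \<open>N\<close>. Let \<open>L/K\<close> be a chief factor of \<open>G\<close> with \<open>L \<le> N\<close> such that
  \<open>G/L\<close> has a series of type \<open>w\<close>. If \<open>L/K\<close> is a \<open>p'\<close>-group, it is absorbed by the first factor. Let it
  be a \<open>p\<close>-group.

  Suppose that \<open>L/K\<close> has a proper supplement, \<open>G = LT\<close> with \<open>K \<le> T < G\<close>. The residual
  \<open>R = T\<^sup>\<F>\<close> is normalised by \<open>T\<close>, and by \<open>L\<close> because \<open>L \<le> N\<close>; hence it is normal in \<open>G\<close>. Then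
  \<open>KR \<inter> L\<close> is \<open>K\<close> or \<open>L\<close>, and it is not \<open>L\<close> because \<open>KR \<le> T\<close>. Now \<open>G/LR\<close> is a quotient of \<open>T/T\<^sup>\<F>\<close>,
  which has type \<open>p', p, p'\<close>, while \<open>LR/KR\<close> is a \<open>p\<close>-group. So \<open>G/KR\<close> has type
  \<open>p', p, p', p, p'\<close>, and \<open>G/K = G/(KR \<inter> L)\<close> inherits type \<open>w\<close> as soon as \<open>w\<close> begins with these five
  letters. That is the case for \<open>h\<^sub>p \<le> k\<close> from \<open>k = 3\<close> on and for \<open>l\<^sub>p \<le> k\<close> from \<open>k = 2\<close> on
  (\<open>pi_series_supplemented\<close>).

  Suppose that there is no proper supplement, so that \<open>L/K\<close> lies in the Frattini subgroup of \<open>G/K\<close>.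
  If \<open>M/L\<close> is the first factor of the series of \<open>G/L\<close>, then the abelian normal Hall subgroup \<open>L/K\<close> of
  \<open>M/K\<close> has a complement \<open>Q/K\<close>, whose conjugates in \<open>G/K\<close> are all conjugate to it under \<open>L/K\<close>
  (\<open>schur_zassenhaus_abelian\<close>). The normaliser of \<open>Q/K\<close> therefore supplements \<open>L/K\<close>, so \<open>Q\<close> is normal
  in \<open>G\<close>, and starting the series with \<open>Q\<close> shows that \<open>G/K\<close> has type \<open>w\<close>
  (\<open>pi_series_Frattini\<close>, \<open>pi_series_unsupplemented\<close>).

  The classes \<open>\<U>\<close> and \<open>\<U>\<^sub>p\<close> enter through three properties: they contain the trivial groups, are closed
  under isomorphism and consist of groups of \<open>p\<close>-length at most one. These form the locale
  \<open>p_length_one_class\<close>. That \<open>T/T\<^sup>\<F>\<close> has type \<open>p', p, p'\<close> follows from closure of series under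
  intersection.
\<close>

hide_const (open) Divisibility.prime

section \<open>Numbers and indices with prescribed prime divisors\<close>

text \<open>
  Writing \<open>p\<close>-numbers and \<open>p'\<close>-numbers as \<open>\<pi>\<close>-numbers for \<open>\<pi> = {p}\<close> and \<open>\<pi> = - {p}\<close> lets one argument
  serve for both kinds of factors.
\<close>

definition pi_number :: "nat set \<Rightarrow> nat \<Rightarrow> bool"
  where "pi_number \<pi> m \<longleftrightarrow> 0 < m \<and> (\<forall>q. prime q \<longrightarrow> q dvd m \<longrightarrow> q \<in> \<pi>)"

lemma pi_number_1 [simp]: "pi_number \<pi> (Suc 0)"
  by (auto simp: pi_number_def)

lemma pi_number_mult [simp]: "pi_number \<pi> (a * b) \<longleftrightarrow> pi_number \<pi> a \<and> pi_number \<pi> b"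
  by (auto simp: pi_number_def prime_dvd_mult_iff)

lemma pi_number_dvd: "a dvd b \<Longrightarrow> pi_number \<pi> b \<Longrightarrow> pi_number \<pi> a"
  by (auto simp: pi_number_def intro!: Nat.gr0I)

lemma pi_number_p'_iff: "prime p \<Longrightarrow> pi_number (- {p}) m \<longleftrightarrow> \<not> p dvd m"
  by (auto simp: pi_number_def intro!: Nat.gr0I)

lemma pi_number_p_iff:
  assumes "prime p"
  shows "pi_number {p} m \<longleftrightarrow> (\<exists>n. m = p ^ n)"
proof
  assume m: "pi_number {p} m"
  then have "m \<noteq> 0" by (simp add: pi_number_def)
  then obtain k where "m = p ^ multiplicity p m * k" "\<not> p dvd k"
    using assms by (metis multiplicity_decompose' not_prime_unit)
  moreover have "k = 1"
    by (metis \<open>\<not> p dvd k\<close> calculation(1) dvd_triv_right m pi_number_def pi_number_dvd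
        prime_factor_nat singletonD)
  ultimately show "\<exists>n. m = p ^ n" by auto
next
  assume "\<exists>n. m = p ^ n"
  with assms show "pi_number {p} m"
    by (metis pi_number_def prime_dvd_power primes_dvd_imp_eq prime_gt_0_nat singletonI zero_less_power)
qed

locale finite_group = group G for G (structure) +
  assumes finite_carrier [simp, intro]: "finite (carrier G)"

text \<open>
  \<open>M/N\<close> is a \<open>\<pi>\<close>-group. The definition speaks only about the index, so that it makes sense for subgroups
  without forming the section.
\<close>

definition pi_factor :: "nat set \<Rightarrow> 'a set \<Rightarrow> 'a set \<Rightarrow> bool"
  where "pi_factor \<pi> N M \<longleftrightarrow> N \<subseteq> M \<and> pi_number \<pi> (card M div card N)"

lemma (in group) inv_mult_cancel:
  assumes "x \<in> carrier G" "y \<in> carrier G"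
  shows "inv x \<otimes> (x \<otimes> y) = y" "x \<otimes> (inv x \<otimes> y) = y"
  using assms by (simp_all add: m_assoc[symmetric])

context finite_group
begin

lemma finite_subgroup: "subgroup H G \<Longrightarrow> finite H"
  using finite_subset subgroup.subset by blast

lemma card_subgroup_pos: "subgroup H G \<Longrightarrow> 0 < card H"
  using finite_subgroup subgroup.one_closed card_gt_0_iff by blast

lemma finite_group_subgroup: "subgroup H G \<Longrightarrow> finite_group (G\<lparr>carrier := H\<rparr>)"
  by (simp add: finite_group_def finite_group_axioms_def subgroup_imp_group finite_subgroup)

lemma finite_group_quotient: "N \<lhd> G \<Longrightarrow> finite_group (G Mod N)"
  by (simp add: finite_group_def finite_group_axioms_def normal.factorgroup_is_group
      carrier_FactGroup)

lemma card_subgroup_dvd: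
  assumes "subgroup N G" "subgroup M G" "N \<subseteq> M"
  shows "card N dvd card M"
proof -
  interpret M: finite_group "G\<lparr>carrier := M\<rparr>" using finite_group_subgroup assms by blast
  have "subgroup N (G\<lparr>carrier := M\<rparr>)" using assms subgroup_incl by blast
  from M.lagrange[OF this] have "card (rcosets\<^bsub>G\<lparr>carrier := M\<rparr>\<^esub> N) * card N = card M"
    by (simp add: order_def)
  then show ?thesis by (metis dvd_triv_right)
qed

lemma card_quotient:
  assumes "N \<lhd> G"
  shows "card (carrier (G Mod N)) * card N = card (carrier G)"
  using lagrange[OF normal_imp_subgroup[OF assms]] by (simp add: FactGroup_def order_def)

lemma order_section:
  assumes "K \<lhd> G" "subgroup H G" "K \<subseteq> H"
  shows "order (G\<lparr>carrier := H\<rparr> Mod K) = card H div card K"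
proof -
  interpret H: finite_group "G\<lparr>carrier := H\<rparr>" using finite_group_subgroup assms by blast
  have "K \<lhd> G\<lparr>carrier := H\<rparr>" using assms normal_restrict_supergroup by blast
  then have "order (G\<lparr>carrier := H\<rparr> Mod K) * card K = card H"
    using H.card_quotient by (simp add: order_def)
  then show ?thesis
    using card_subgroup_pos[OF normal_imp_subgroup[OF assms(1)]]
    by (metis nonzero_mult_div_cancel_right not_gr_zero)
qed

text \<open>
  The second isomorphism theorem, as a count.
\<close>

lemma card_normal_set_mult:
  assumes "N \<lhd> G" "subgroup S G"
  shows "card (N <#> S) * card (N \<inter> S) = card N * card S"
proof -
  interpret second_isomorphism_grp N G S
    using assms by (simp add: second_isomorphism_grp_def second_isomorphism_grp_axioms_def)
  interpret S: finite_group "G\<lparr>carrier := S\<rparr>" using finite_group_subgroup assms by blast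
  interpret NS: finite_group "G\<lparr>carrier := N <#> S\<rparr>"
    using finite_group_subgroup normal_set_mult_subgroup by blast
  have 1: "N \<inter> S \<lhd> G\<lparr>carrier := S\<rparr>" using normal_subgrp_intersection_normal by (simp add: Int_commute)
  have 2: "N \<lhd> G\<lparr>carrier := N <#> S\<rparr>"
    using normal_restrict_supergroup normal_set_mult_subgroup H_contained_in_set_mult assms by blast
  have "card (carrier (G\<lparr>carrier := S\<rparr> Mod (N \<inter> S))) = card (carrier (G\<lparr>carrier := N <#> S\<rparr> Mod N))"
    using normal_intersection_quotient_isom iso_same_card is_isoI by blast
  with S.card_quotient[OF 1] NS.card_quotient[OF 2]
  have s: "card S = card (carrier (G\<lparr>carrier := S\<rparr> Mod (N \<inter> S))) * card (N \<inter> S)"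
    and ns: "card (N <#> S) = card (carrier (G\<lparr>carrier := S\<rparr> Mod (N \<inter> S))) * card N"
    by simp_all
  show ?thesis by (subst s, subst ns) (simp only: mult_ac)
qed

lemma normal_set_mult:
  assumes "M \<lhd> G" "N \<lhd> G"
  shows "M <#> N \<lhd> G"
proof (rule normal_invI)
  interpret second_isomorphism_grp M G N
    using assms by (simp add: second_isomorphism_grp_def second_isomorphism_grp_axioms_def normal_imp_subgroup)
  show "subgroup (M <#> N) G" by (rule normal_set_mult_subgroup)
  fix x h assume x: "x \<in> carrier G" and "h \<in> M <#> N"
  then obtain m n where mn: "m \<in> M" "n \<in> N" "h = m \<otimes> n" by (auto simp: set_mult_def)
  then have c: "m \<in> carrier G" "n \<in> carrier G"
    using assms normal_imp_subgroup subgroup.mem_carrier by metis+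
  have "x \<otimes> h \<otimes> inv x = (x \<otimes> m \<otimes> inv x) \<otimes> (x \<otimes> n \<otimes> inv x)"
    using x c mn by (simp add: m_assoc inv_solve_left)
  moreover have "x \<otimes> m \<otimes> inv x \<in> M" "x \<otimes> n \<otimes> inv x \<in> N"
    using assms mn x normal.inv_op_closed2 by metis+
  ultimately show "x \<otimes> h \<otimes> inv x \<in> M <#> N" by (auto simp: set_mult_def)
qed

lemma set_mult_normal_subgroup: "N \<lhd> G \<Longrightarrow> subgroup S G \<Longrightarrow> subgroup (N <#> S) G"
  by (simp add: second_isomorphism_grp.normal_set_mult_subgroup second_isomorphism_grp_axioms_def second_isomorphism_grp_def)

lemma set_mult_superset:
  assumes "subgroup A G" "subgroup B G"
  shows "A \<subseteq> A <#> B" "B \<subseteq> A <#> B"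
proof -
  show "A \<subseteq> A <#> B"
    using assms subgroup.one_closed[OF assms(2)] subgroup.mem_carrier[OF assms(1)]
    by (force simp: set_mult_def)
  show "B \<subseteq> A <#> B"
    using assms subgroup.one_closed[OF assms(1)] subgroup.mem_carrier[OF assms(2)]
    by (force simp: set_mult_def)
qed

lemma set_mult_least:
  assumes "subgroup C G" "A \<subseteq> C" "B \<subseteq> C"
  shows "A <#> B \<subseteq> C"
  using assms subgroup.m_closed[OF assms(1)] by (auto simp: set_mult_def)

lemma pi_factor_trans:
  assumes "subgroup A G" "subgroup B G" "subgroup C G"
    and "pi_factor \<pi> A B" "pi_factor \<pi> B C"
  shows "pi_factor \<pi> A C"
proof -
  have "A \<subseteq> B" "B \<subseteq> C" using assms(4,5) by (auto simp: pi_factor_def)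
  obtain i where i: "card B = card A * i"
    using card_subgroup_dvd[OF assms(1,2) \<open>A \<subseteq> B\<close>] by auto
  obtain j where j: "card C = card B * j"
    using card_subgroup_dvd[OF assms(2,3) \<open>B \<subseteq> C\<close>] by auto
  show ?thesis
    using assms(4,5) i j card_subgroup_pos[OF assms(1)] card_subgroup_pos[OF assms(2)]
    by (auto simp: pi_factor_def)
qed

lemma pi_factor_refl: "subgroup A G \<Longrightarrow> pi_factor \<pi> A A"
  using card_subgroup_pos[of A] by (simp add: pi_factor_def)

text \<open>
  The section \<open>(A' \<inter> B)/(A \<inter> B)\<close> embeds in \<open>A'/A\<close>: its order is the index of \<open>A\<close> in the subgroup
  \<open>(A' \<inter> B)A\<close> of \<open>A'\<close>.
\<close>

lemma index_Int_dvd: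
  assumes "subgroup A G" "subgroup A' G" "A \<subseteq> A'" "B \<lhd> G"
  shows "card (A' \<inter> B) div card (A \<inter> B) dvd card A' div card A"
proof -
  interpret A': finite_group "G\<lparr>carrier := A'\<rparr>" using finite_group_subgroup assms by blast
  have n: "A' \<inter> B \<lhd> G\<lparr>carrier := A'\<rparr>"
    using normal_Int_subgroup[OF assms(2,4)] by (simp add: Int_commute)
  have s: "subgroup A (G\<lparr>carrier := A'\<rparr>)" using assms subgroup_incl by blast
  let ?P = "(A' \<inter> B) <#> A"
  have P': "subgroup ?P (G\<lparr>carrier := A'\<rparr>)" using A'.set_mult_normal_subgroup[OF n s] by simp
  have P: "subgroup ?P G" "?P \<subseteq> A'"
    using P' assms(2) incl_subgroup subgroup.subset[OF P'] by auto
  have *: "card ?P * card (A \<inter> B) = card (A' \<inter> B) * card A"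
  proof -
    have "A' \<inter> B \<inter> A = A \<inter> B" using assms(3) by blast
    then show ?thesis using A'.card_normal_set_mult[OF n s] by simp
  qed
  have AP: "A \<subseteq> ?P" using A'.set_mult_superset(2)[OF normal_imp_subgroup[OF n] s] by simp
  have B: "subgroup B G" using assms normal_imp_subgroup by blast
  have ab: "subgroup (A \<inter> B) G" "subgroup (A' \<inter> B) G"
    using assms B subgroups_Inter_pair by auto
  obtain i where i: "card ?P = card A * i"
    using card_subgroup_dvd[OF assms(1) P(1) AP] by auto
  obtain j where j: "card (A' \<inter> B) = card (A \<inter> B) * j"
    using card_subgroup_dvd[OF ab] assms(3) by auto
  have "card A * (card (A \<inter> B) * i) = card A * (card (A \<inter> B) * j)"
    using * unfolding i j by (simp only: mult_ac)
  then have "i = j" using card_subgroup_pos[OF assms(1)] card_subgroup_pos[OF ab(1)] by simp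
  moreover obtain q where "card A' = card ?P * q"
    using card_subgroup_dvd[OF P(1) assms(2) P(2)] by (rule dvdE)
  ultimately have "card A' div card A = j * q" "card (A' \<inter> B) div card (A \<inter> B) = j"
    using i j card_subgroup_pos[OF assms(1)] card_subgroup_pos[OF ab(1)] by simp_all
  then show ?thesis by simp
qed

text \<open>
  By the product formula the index of \<open>BA\<close> in \<open>BA'\<close> is the index of \<open>A\<close> in \<open>A'\<close>, divided by that of
  \<open>A \<inter> B\<close> in \<open>A' \<inter> B\<close>.
\<close>

lemma index_set_mult_dvd:
  assumes "subgroup A G" "subgroup A' G" "A \<subseteq> A'" "B \<lhd> G"
  shows "card (B <#> A') div card (B <#> A) dvd card A' div card A"
proof -
  have B: "subgroup B G" using assms normal_imp_subgroup by blast
  have ab: "subgroup (A \<inter> B) G" "subgroup (A' \<inter> B) G" "subgroup (B <#> A) G" "subgroup (B <#> A') G"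
    using assms B subgroups_Inter_pair set_mult_normal_subgroup by auto
  have le: "B <#> A \<subseteq> B <#> A'" using assms(3) by (auto simp: set_mult_def)
  obtain i where i: "card A' = card A * i"
    using card_subgroup_dvd[OF assms(1-3)] by auto
  obtain j where j: "card (A' \<inter> B) = card (A \<inter> B) * j"
    using card_subgroup_dvd[OF ab(1,2)] assms(3) by auto
  obtain k where k: "card (B <#> A') = card (B <#> A) * k"
    using card_subgroup_dvd[OF ab(3,4) le] by auto
  have "card B * (card A * i) = (card (B <#> A) * card (A \<inter> B)) * (k * j)"
    using card_normal_set_mult[OF assms(4,2)]
    by (simp add: i j k Int_commute[of B] mult_ac)
  moreover have "card (B <#> A) * card (A \<inter> B) = card B * card A"
    using card_normal_set_mult[OF assms(4,1)] by (simp add: Int_commute[of B])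
  ultimately have "(card B * card A) * i = (card B * card A) * (k * j)"
    by (simp only: mult.assoc)
  then have "k * j = i" using card_subgroup_pos[OF B] card_subgroup_pos[OF assms(1)] by simp
  with i k show ?thesis
    using card_subgroup_pos[OF assms(1)] card_subgroup_pos[OF ab(3)]
    by (metis dvd_triv_left nonzero_mult_div_cancel_left less_numeral_extra(3))
qed

lemma pi_factor_Int:
  assumes "subgroup A G" "subgroup A' G" "pi_factor \<pi> A A'" "B \<lhd> G"
  shows "pi_factor \<pi> (A \<inter> B) (A' \<inter> B)"
  using assms pi_number_dvd[OF index_Int_dvd[OF assms(1,2) _ assms(4)]]
  by (auto simp: pi_factor_def)

lemma pi_factor_set_mult:
  assumes "subgroup A G" "subgroup A' G" "pi_factor \<pi> A A'" "B \<lhd> G"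
  shows "pi_factor \<pi> (B <#> A) (B <#> A')"
  using assms pi_number_dvd[OF index_set_mult_dvd[OF assms(1,2) _ assms(4)]]
  by (auto simp: pi_factor_def set_mult_def)

end

section \<open>Normal series of a prescribed type\<close>

text \<open>
  \<open>G/N\<close> has a normal series whose factors, from the bottom, are groups for the sets of primes listed in
  \<open>w\<close>. The terms are subgroups of \<open>G\<close>, so that series for different \<open>N\<close> live in the same group and can
  be intersected and multiplied. Trivial factors are allowed.
\<close>

primrec pi_series :: "('a, 'b) monoid_scheme \<Rightarrow> nat set list \<Rightarrow> 'a set \<Rightarrow> bool"
  where
    "pi_series G [] N \<longleftrightarrow> N = carrier G"
  | "pi_series G (\<pi> # w) N \<longleftrightarrow> (\<exists>M. M \<lhd> G \<and> pi_factor \<pi> N M \<and> pi_series G w M)"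

context finite_group
begin

lemma pi_series_carrier: "pi_series G w (carrier G)"
  by (induction w) (use normal_self pi_factor_refl subgroup_self in auto)

lemma pi_series_append: "pi_series G w N \<Longrightarrow> pi_series G (w @ v) N"
proof (induction w arbitrary: N)
  case Nil
  then show ?case using pi_series_carrier by simp
qed auto

text \<open>
  Multiplying all terms by \<open>N'\<close> gives a series that starts at \<open>N'\<close>.
\<close>

lemma pi_series_mono:
  assumes "N \<lhd> G" "N' \<lhd> G" "N \<subseteq> N'" "pi_series G w N"
  shows "pi_series G w N'"
  using assms
proof (induction w arbitrary: N N')
  case Nil
  then show ?case using subgroup.subset[OF normal_imp_subgroup[OF Nil(2)]] by auto
next
  case (Cons \<pi> w)
  then obtain M where M: "M \<lhd> G" "pi_factor \<pi> N M" "pi_series G w M" by auto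
  let ?M = "N' <#> M"
  have n: "?M \<lhd> G" using normal_set_mult M Cons by blast
  have sub: "subgroup N G" "subgroup N' G" "subgroup M G"
    using M Cons normal_imp_subgroup by auto
  have "pi_factor \<pi> (N' <#> N) ?M" using pi_factor_set_mult[OF sub(1,3) M(2) Cons(3)] .
  moreover have "N' <#> N = N'"
    using set_mult_superset(1)[OF sub(2,1)] set_mult_least[OF sub(2)] Cons(4) by blast
  moreover have "pi_series G w ?M"
    using Cons.IH[OF M(1) n _ M(3)] set_mult_superset[OF sub(2,3)] by blast
  ultimately show ?case using n by auto
qed

text \<open>
  The terms \<open>A\<^sub>i \<inter> B\<^sub>i\<close> of two series of the same type again form one, since
  \<open>(A\<^bsub>i+1\<^esub> \<inter> B\<^bsub>i+1\<^esub>)/(A\<^sub>i \<inter> B\<^sub>i)\<close> embeds in the product of \<open>A\<^bsub>i+1\<^esub>/A\<^sub>i\<close> and \<open>B\<^bsub>i+1\<^esub>/B\<^sub>i\<close>.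
  This replaces the statement that the groups with a series of a given type form a formation.
\<close>

lemma pi_series_Int:
  assumes "A \<lhd> G" "B \<lhd> G" "pi_series G w A" "pi_series G w B"
  shows "pi_series G w (A \<inter> B)"
  using assms
proof (induction w arbitrary: A B)
  case (Cons \<pi> w)
  then obtain A' B' where A': "A' \<lhd> G" "pi_factor \<pi> A A'" "pi_series G w A'"
    and B': "B' \<lhd> G" "pi_factor \<pi> B B'" "pi_series G w B'" by auto
  have sub: "subgroup A G" "subgroup B G" "subgroup A' G" "subgroup B' G"
    using A' B' Cons normal_imp_subgroup by auto
  have "pi_factor \<pi> (A \<inter> B) (A' \<inter> B)" using pi_factor_Int sub A' Cons by blast
  moreover have "pi_factor \<pi> (A' \<inter> B) (A' \<inter> B')"
    using pi_factor_Int[OF sub(2,4) B'(2) A'(1)] by (simp add: Int_commute)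
  ultimately have "pi_factor \<pi> (A \<inter> B) (A' \<inter> B')"
    using pi_factor_trans subgroups_Inter_pair sub by meson
  then show ?case using A' B' Cons.IH normal_subgroup_intersect by fastforce
qed auto

lemma pi_series_INT:
  assumes "finite \<A>" "\<And>A. A \<in> \<A> \<Longrightarrow> A \<lhd> G \<and> pi_series G w A" "\<A> \<noteq> {}"
  shows "\<Inter>\<A> \<lhd> G \<and> pi_series G w (\<Inter>\<A>)"
  using assms(1,3,2)
proof (induction rule: finite_ne_induct)
  case (insert A \<A>)
  then show ?case using pi_series_Int[of A "\<Inter>\<A>" w] normal_subgroup_intersect by auto
qed auto

text \<open>
  If \<open>G = LT\<close>, then \<open>G/LS\<close> is a quotient of \<open>T/S\<close>; multiplying a normal series of \<open>T\<close> by \<open>L\<close> makes its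
  terms normal in \<open>G\<close>.
\<close>

lemma pi_series_supplement:
  assumes "subgroup T G" "L \<lhd> G" "L <#> T = carrier G"
    and "S \<lhd> G\<lparr>carrier := T\<rparr>" "pi_series (G\<lparr>carrier := T\<rparr>) w S"
  shows "L <#> S \<lhd> G" "pi_series G w (L <#> S)"
proof -
  have norm: "L <#> S \<lhd> G" if S: "S \<lhd> G\<lparr>carrier := T\<rparr>" for S
  proof (rule normal_invI)
    interpret T: finite_group "G\<lparr>carrier := T\<rparr>" using finite_group_subgroup assms by blast
    have sS: "subgroup S G" using S assms incl_subgroup normal_imp_subgroup by blast
    show LS: "subgroup (L <#> S) G" using set_mult_normal_subgroup assms sS by blast
    fix x h assume x: "x \<in> carrier G" and h: "h \<in> L <#> S"
    obtain l s where ls: "l \<in> L" "s \<in> S" "h = l \<otimes> s" using h by (auto simp: set_mult_def)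
    obtain m t where mt: "m \<in> L" "t \<in> T" "x = m \<otimes> t"
      using x[folded assms(3)] by (auto simp: set_mult_def)
    have c: "l \<in> carrier G" "m \<in> carrier G" "s \<in> carrier G" "t \<in> carrier G"
      using ls mt sS assms subgroup.mem_carrier normal_imp_subgroup by metis+
    have "t \<otimes> s \<otimes> inv t \<in> S"
      using T.normal_invE(2)[OF S, of t s] ls mt m_inv_consistent[OF assms(1), of t] by simp
    then have 1: "t \<otimes> s \<otimes> inv t \<in> L <#> S" "m \<in> L <#> S"
      using set_mult_superset[OF normal_imp_subgroup[OF assms(2)] sS] mt by blast+
    have 2: "t \<otimes> l \<otimes> inv t \<in> L <#> S"
      using set_mult_superset(1)[OF normal_imp_subgroup[OF assms(2)] sS]
        normal.inv_op_closed2[OF assms(2) c(4) ls(1)] by blast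
    have "x \<otimes> h \<otimes> inv x = m \<otimes> ((t \<otimes> l \<otimes> inv t) \<otimes> (t \<otimes> s \<otimes> inv t)) \<otimes> inv m"
      unfolding ls(3) mt(3) using c by (simp add: m_assoc inv_mult_group inv_mult_cancel)
    also have "\<dots> \<in> L <#> S"
      using 1 2 LS by (simp add: subgroup.m_closed subgroup.m_inv_closed)
    finally show "x \<otimes> h \<otimes> inv x \<in> L <#> S" .
  qed
  show "L <#> S \<lhd> G" using norm assms by blast
  show "pi_series G w (L <#> S)" using assms(4,5)
  proof (induction w arbitrary: S)
    case Nil
    then show ?case using assms by simp
  next
    case (Cons \<pi> w)
    then obtain M where M: "M \<lhd> G\<lparr>carrier := T\<rparr>" "pi_factor \<pi> S M"
        "pi_series (G\<lparr>carrier := T\<rparr>) w M" by auto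
    have "subgroup S G" "subgroup M G"
      using M Cons assms incl_subgroup normal_imp_subgroup by blast+
    then have "pi_factor \<pi> (L <#> S) (L <#> M)" using pi_factor_set_mult M(2) assms(2) by blast
    then show ?case using M norm Cons.IH by auto
  qed
qed

section \<open>Passage to quotients\<close>

text \<open>
  For a set \<open>A\<close> of cosets \<open>\<Union>A\<close> is its preimage. The lemmas that follow form the correspondence theorem:
  \<open>A \<mapsto> \<Union>A\<close> is an inclusion preserving bijection from the (normal) subgroups of \<open>G/Y\<close> onto those of \<open>G\<close>
  that contain \<open>Y\<close>, and it preserves indices.
\<close>

lemma Union_cosets:
  assumes "Y \<lhd> G" "subgroup M G" "Y \<subseteq> M"
  shows "\<Union>((\<lambda>x. Y #> x) ` M) = M"
proof -
  have "\<Union>((\<lambda>x. Y #> x) ` M) = Y <#> M" by (auto simp: r_coset_def set_mult_def)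
  then show ?thesis
    using set_mult_superset(2)[OF normal_imp_subgroup[OF assms(1)] assms(2)]
      set_mult_least[OF assms(2,3) order_refl] by simp
qed

lemma normal_cosets:
  assumes "Y \<lhd> G" "M \<lhd> G" "Y \<subseteq> M"
  shows "(\<lambda>x. Y #> x) ` M \<lhd> G Mod Y"
proof -
  have "rcosets\<^bsub>G\<lparr>carrier := M\<rparr>\<^esub> Y = (\<lambda>x. Y #> x) ` M"
    by (auto simp: RCOSETS_def)
  then show ?thesis using normality_factorization[OF assms(1,3,2)] by simp
qed

lemma cosets_Union:
  assumes "Y \<lhd> G" "subgroup A (G Mod Y)"
  shows "(\<lambda>x. Y #> x) ` (\<Union>A) = A"
proof -
  have "rcosets\<^bsub>G\<lparr>carrier := \<Union>A\<rparr>\<^esub> Y = (\<lambda>x. Y #> x) ` (\<Union>A)"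
    by (auto simp: RCOSETS_def)
  then show ?thesis using normal.factgroup_subgroup_union_factor[OF assms] by simp
qed

lemma subgroup_Union: "Y \<lhd> G \<Longrightarrow> subgroup A (G Mod Y) \<Longrightarrow> subgroup (\<Union>A) G"
  by (rule normal.factgroup_subgroup_union_subgroup)

lemma normal_Union: "Y \<lhd> G \<Longrightarrow> A \<lhd> G Mod Y \<Longrightarrow> \<Union>A \<lhd> G"
  by (rule normal.factgroup_subgroup_union_normal)

lemma Union_superset: "subgroup A (G Mod Y) \<Longrightarrow> Y \<subseteq> \<Union>A"
  using subgroup.one_closed[of A "G Mod Y"] by auto

lemma Union_subset_iff:
  assumes "Y \<lhd> G" "subgroup A (G Mod Y)" "subgroup B (G Mod Y)"
  shows "\<Union>A \<subseteq> \<Union>B \<longleftrightarrow> A \<subseteq> B"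
proof
  assume "\<Union>A \<subseteq> \<Union>B"
  then have "(\<lambda>x. Y #> x) ` (\<Union>A) \<subseteq> (\<lambda>x. Y #> x) ` (\<Union>B)" by (rule image_mono)
  then show "A \<subseteq> B" by (simp add: cosets_Union assms)
qed auto

lemma Union_eq_iff:
  assumes "Y \<lhd> G" "subgroup A (G Mod Y)" "subgroup B (G Mod Y)"
  shows "\<Union>A = \<Union>B \<longleftrightarrow> A = B"
  using Union_subset_iff[OF assms] Union_subset_iff[OF assms(1,3,2)] by blast

lemma Union_carrier:
  assumes "Y \<lhd> G"
  shows "\<Union>(carrier (G Mod Y)) = carrier G"
  using Union_cosets[OF assms subgroup_self] subgroup.subset[OF normal_imp_subgroup[OF assms]]
  by (simp add: carrier_FactGroup)

lemma card_Union:
  assumes "Y \<lhd> G" "subgroup A (G Mod Y)"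
  shows "card (\<Union>A) = card A * card Y"
proof -
  have s: "subgroup (\<Union>A) G" using subgroup_Union assms .
  interpret A: finite_group "G\<lparr>carrier := \<Union>A\<rparr>" using finite_group_subgroup s .
  have "subgroup Y (G\<lparr>carrier := \<Union>A\<rparr>)"
    using Union_superset[OF assms(2)] normal_imp_subgroup[OF assms(1)] s by (simp add: subgroup_incl)
  from A.lagrange[OF this] show ?thesis
    using normal.factgroup_subgroup_union_factor[OF assms] by (simp add: order_def)
qed

lemma pi_factor_Union:
  assumes "Y \<lhd> G" "subgroup A (G Mod Y)" "subgroup B (G Mod Y)"
  shows "pi_factor \<pi> (\<Union>A) (\<Union>B) \<longleftrightarrow> pi_factor \<pi> A B"
  using card_subgroup_pos[OF normal_imp_subgroup[OF assms(1)]]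
  by (simp add: pi_factor_def Union_subset_iff[OF assms] card_Union[OF assms(1)] assms)

lemma quotient_normalE:
  assumes "Y \<lhd> G" "M \<lhd> G" "Y \<subseteq> M"
  obtains A where "A \<lhd> G Mod Y" "M = \<Union>A"
  using normal_cosets[OF assms] Union_cosets[OF assms(1) normal_imp_subgroup[OF assms(2)] assms(3)]
  by metis

lemma pi_series_quotient:
  assumes "Y \<lhd> G" "A \<lhd> G Mod Y"
  shows "pi_series (G Mod Y) w A \<longleftrightarrow> pi_series G w (\<Union>A)"
  using assms(2)
proof (induction w arbitrary: A)
  case Nil
  have "subgroup (carrier (G Mod Y)) (G Mod Y)"
    using finite_group_quotient[OF assms(1)] finite_group_def group.subgroup_self by blast
  from Union_eq_iff[OF assms(1) normal_imp_subgroup[OF Nil] this] show ?case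
    by (simp add: Union_carrier[OF assms(1)])
next
  case (Cons \<pi> w)
  show ?case
  proof
    assume "pi_series (G Mod Y) (\<pi> # w) A"
    then obtain B where B: "B \<lhd> G Mod Y" "pi_factor \<pi> A B" "pi_series (G Mod Y) w B" by auto
    then show "pi_series G (\<pi> # w) (\<Union>A)"
      using normal_Union[OF assms(1) B(1)] Cons.IH[OF B(1)]
        pi_factor_Union[OF assms(1) normal_imp_subgroup[OF Cons.prems] normal_imp_subgroup[OF B(1)]]
      by auto
  next
    assume "pi_series G (\<pi> # w) (\<Union>A)"
    then obtain M where M: "M \<lhd> G" "pi_factor \<pi> (\<Union>A) M" "pi_series G w M" by auto
    have "Y \<subseteq> M"
      using M(2) Union_superset[OF normal_imp_subgroup[OF Cons.prems]] by (auto simp: pi_factor_def)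
    then obtain B where B: "B \<lhd> G Mod Y" "M = \<Union>B"
      using quotient_normalE[OF assms(1) M(1)] by blast
    then show "pi_series (G Mod Y) (\<pi> # w) A"
      using M Cons.IH[OF B(1)]
        pi_factor_Union[OF assms(1) normal_imp_subgroup[OF Cons.prems] normal_imp_subgroup[OF B(1)]]
      by auto
  qed
qed

lemma pi_series_quotient_one:
  assumes "Y \<lhd> G"
  shows "pi_series (G Mod Y) w {\<one>\<^bsub>G Mod Y\<^esub>} \<longleftrightarrow> pi_series G w Y"
proof -
  interpret Q: finite_group "G Mod Y" using finite_group_quotient assms .
  show ?thesis using pi_series_quotient[OF assms Q.one_is_normal] by simp
qed

lemma chief_factor_quotient:
  assumes "Y \<lhd> G" "H \<lhd> G Mod Y" "K \<lhd> G Mod Y"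
  shows "chief_factor (G Mod Y) H K \<longleftrightarrow> chief_factor G (\<Union>H) (\<Union>K)"
proof -
  note s = normal_imp_subgroup[OF assms(2)] normal_imp_subgroup[OF assms(3)]
  have "(\<forall>L. L \<lhd> G Mod Y \<longrightarrow> K \<subseteq> L \<longrightarrow> L \<subseteq> H \<longrightarrow> L = K \<or> L = H) \<longleftrightarrow>
    (\<forall>L. L \<lhd> G \<longrightarrow> \<Union>K \<subseteq> L \<longrightarrow> L \<subseteq> \<Union>H \<longrightarrow> L = \<Union>K \<or> L = \<Union>H)" (is "?l \<longleftrightarrow> ?r")
  proof
    assume l: ?l
    show ?r
    proof (intro allI impI)
      fix L assume L: "L \<lhd> G" "\<Union>K \<subseteq> L" "L \<subseteq> \<Union>H"
      then have "Y \<subseteq> L" using Union_superset[OF s(2)] by auto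
      then obtain A where A: "A \<lhd> G Mod Y" "L = \<Union>A"
        using quotient_normalE[OF assms(1) L(1)] by blast
      note sA = normal_imp_subgroup[OF A(1)]
      show "L = \<Union>K \<or> L = \<Union>H"
        using l[rule_format, OF A(1)] L A(2) Union_subset_iff[OF assms(1) s(2) sA]
          Union_subset_iff[OF assms(1) sA s(1)] by auto
    qed
  next
    assume r: ?r
    show ?l
    proof (intro allI impI)
      fix A assume A: "A \<lhd> G Mod Y" "K \<subseteq> A" "A \<subseteq> H"
      note sA = normal_imp_subgroup[OF A(1)]
      have "\<Union>A = \<Union>K \<or> \<Union>A = \<Union>H"
        using r[rule_format, OF normal_Union[OF assms(1) A(1)] Union_mono[OF A(2)] Union_mono[OF A(3)]] .
      then show "A = K \<or> A = H"
        using Union_eq_iff[OF assms(1) sA s(1)] Union_eq_iff[OF assms(1) sA s(2)] by auto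
    qed
  qed
  moreover have "K \<subset> H \<longleftrightarrow> \<Union>K \<subset> \<Union>H"
    by (simp only: less_le_not_le Union_subset_iff[OF assms(1) s] Union_subset_iff[OF assms(1) s(2,1)])
  ultimately show ?thesis
    by (simp only: chief_factor_def assms(2,3) normal_Union[OF assms(1,2)]
        normal_Union[OF assms(1,3)] simp_thms)
qed

section \<open>Chief factors\<close>

text \<open>
  A normal subgroup of least order that lies strictly above \<open>N\<close> and inside \<open>M\<close> is a chief factor over
  \<open>N\<close>.
\<close>

lemma ex_chief_factor:
  assumes "N \<lhd> G" "M \<lhd> G" "N \<subset> M"
  obtains L where "chief_factor G L N" "L \<subseteq> M"
proof -
  let ?P = "\<lambda>L. L \<lhd> G \<and> N \<subset> L \<and> L \<subseteq> M"
  obtain L where L: "?P L" and least: "\<And>L'. ?P L' \<Longrightarrow> card L \<le> card L'"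
    using assms arg_min_nat_lemma[of ?P M card] by blast
  have "chief_factor G L N"
    unfolding chief_factor_def
  proof (intro conjI allI impI)
    fix L' assume L': "L' \<lhd> G" "N \<subseteq> L'" "L' \<subseteq> L"
    show "L' = N \<or> L' = L"
    proof (rule disjCI)
      assume "L' \<noteq> L"
      then have "card L' < card L"
        using L' finite_subgroup[OF normal_imp_subgroup, of L] L by (simp add: psubset_card_mono psubset_eq)
      then have "\<not> ?P L'" using least[of L'] by linarith
      then show "L' = N" using L' L by blast
    qed
  qed (use L assms in auto)
  then show ?thesis using that L by blast
qed

lemma section_group:
  assumes "K \<lhd> G" "H \<lhd> G" "K \<subseteq> H"
  shows "group (G\<lparr>carrier := H\<rparr> Mod K)"
  using normal_restrict_supergroup[OF normal_imp_subgroup[OF assms(2)] assms(1,3)]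
  by (rule normal.factorgroup_is_group)

lemma p_group_section_iff:
  assumes "prime p" "K \<lhd> G" "H \<lhd> G" "K \<subseteq> H"
  shows "p_group p (G\<lparr>carrier := H\<rparr> Mod K) \<longleftrightarrow> pi_factor {p} K H"
    and "p'_group p (G\<lparr>carrier := H\<rparr> Mod K) \<longleftrightarrow> pi_factor (- {p}) K H"
proof -
  have "order (G\<lparr>carrier := H\<rparr> Mod K) = card H div card K"
    by (rule order_section[OF assms(2) normal_imp_subgroup[OF assms(3)] assms(4)])
  then show "p_group p (G\<lparr>carrier := H\<rparr> Mod K) \<longleftrightarrow> pi_factor {p} K H"
    and "p'_group p (G\<lparr>carrier := H\<rparr> Mod K) \<longleftrightarrow> pi_factor (- {p}) K H"
    by (simp_all only: p_group_def p'_group_def pi_factor_def section_group[OF assms(2-4)] assms(4)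
        pi_number_p_iff[OF assms(1)] pi_number_p'_iff[OF assms(1)] simp_thms)
qed

lemma p_solvable_iff:
  assumes "prime p"
  shows "p_solvable p G \<longleftrightarrow>
    (\<forall>H K. chief_factor G H K \<longrightarrow> pi_factor {p} K H \<or> pi_factor (- {p}) K H)"
proof -
  have "p_group p (G\<lparr>carrier := H\<rparr> Mod K) \<longleftrightarrow> pi_factor {p} K H"
    "p'_group p (G\<lparr>carrier := H\<rparr> Mod K) \<longleftrightarrow> pi_factor (- {p}) K H" if "chief_factor G H K" for H K
    using that p_group_section_iff[OF assms, of K H] by (auto simp: chief_factor_def)
  then show ?thesis unfolding p_solvable_def by blast
qed

lemma p_supersolvable_iff:
  assumes "prime p"
  shows "p_supersolvable p G \<longleftrightarrow>
    (\<forall>H K. chief_factor G H K \<longrightarrow> card H div card K = p \<or> pi_factor (- {p}) K H)"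
proof -
  have "order (G\<lparr>carrier := H\<rparr> Mod K) = card H div card K"
    "p'_group p (G\<lparr>carrier := H\<rparr> Mod K) \<longleftrightarrow> pi_factor (- {p}) K H" if "chief_factor G H K" for H K
    using that p_group_section_iff[OF assms, of K H] order_section[OF _ normal_imp_subgroup, of K H]
    by (auto simp: chief_factor_def)
  then show ?thesis unfolding p_supersolvable_def by (metis (no_types, lifting))
qed

lemma p_solvable_quotient:
  assumes "prime p" "p_solvable p G" "Y \<lhd> G"
  shows "p_solvable p (G Mod Y)"
proof -
  interpret Q: finite_group "G Mod Y" using finite_group_quotient assms(3) .
  have "pi_factor {p} K H \<or> pi_factor (- {p}) K H" if "chief_factor (G Mod Y) H K" for H K
  proof -
    have n: "H \<lhd> G Mod Y" "K \<lhd> G Mod Y" using that by (auto simp: chief_factor_def)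
    then have "chief_factor G (\<Union>H) (\<Union>K)" using chief_factor_quotient assms(3) that by blast
    then show ?thesis
      using assms p_solvable_iff pi_factor_Union[OF assms(3)] n normal_imp_subgroup by metis
  qed
  then show ?thesis using Q.p_solvable_iff assms by blast
qed

end

section \<open>Radicals and the upper series\<close>

text \<open>
  \<open>O\<^sub>\<pi>(G)\<close>, which covers both \<open>O\<^sub>p(G)\<close> and \<open>O\<^bsub>p'\<^esub>(G)\<close>.
\<close>

definition pi_core :: "nat set \<Rightarrow> ('a, 'b) monoid_scheme \<Rightarrow> 'a set"
  where "pi_core \<pi> G = generate G (\<Union>{N. N \<lhd> G \<and> pi_number \<pi> (card N)})"

text \<open>
  The preimage in \<open>G\<close> of \<open>O\<^sub>\<pi>(G/Y)\<close>. Both series of the problem arise by iterating it.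
\<close>

definition pi_radical :: "('a, 'b) monoid_scheme \<Rightarrow> nat set \<Rightarrow> 'a set \<Rightarrow> 'a set"
  where "pi_radical G \<pi> Y = \<Union>(pi_core \<pi> (G Mod Y))"

context finite_group
begin

lemma pi_core:
  shows pi_core_normal: "pi_core \<pi> G \<lhd> G"
    and pi_core_pi_number: "pi_number \<pi> (card (pi_core \<pi> G))"
    and pi_core_greatest: "\<And>N. N \<lhd> G \<Longrightarrow> pi_number \<pi> (card N) \<Longrightarrow> N \<subseteq> pi_core \<pi> G"
proof -
  let ?P = "\<lambda>N. N \<lhd> G \<and> pi_number \<pi> (card N)"
  have one: "?P {\<one>}" by (simp add: one_is_normal)
  have bd: "\<And>N. ?P N \<Longrightarrow> card N \<le> card (carrier G)"
    by (simp add: card_mono normal_imp_subgroup subgroup.subset)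
  have "\<exists>M. ?P M \<and> (\<forall>N. ?P N \<longrightarrow> card N \<le> card M)"
    by (rule ex_has_greatest_nat[of ?P "{\<one>}" card "Suc (card (carrier G))"], rule one)
      (use bd in \<open>auto simp: less_Suc_eq_le\<close>)
  then obtain M where M: "?P M" and max: "\<And>N. ?P N \<Longrightarrow> card N \<le> card M" by auto
  have sub: "N \<subseteq> M" if N: "?P N" for N
  proof -
    have s: "subgroup N G" "subgroup M G" using N M normal_imp_subgroup by blast+
    have n: "N <#> M \<lhd> G" using normal_set_mult N M by blast
    have "card (N <#> M) dvd card N * card M"
      using card_normal_set_mult[of N M] N s by (metis dvd_triv_left)
    moreover have "pi_number \<pi> (card N * card M)" using N M by simp
    ultimately have "pi_number \<pi> (card (N <#> M))" by (rule pi_number_dvd)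
    then have "card (N <#> M) \<le> card M" using max n by blast
    then have "M = N <#> M"
      using set_mult_superset(2)[OF s] finite_subgroup[OF normal_imp_subgroup[OF n]]
      by (simp add: card_seteq)
    then show ?thesis using set_mult_superset(1)[OF s] by simp
  qed
  have "\<Union>{N. ?P N} = M" using M sub by auto
  moreover have "generate G M = M"
    using generateI[OF normal_imp_subgroup, of M M] M by auto
  ultimately have eq: "pi_core \<pi> G = M" by (simp add: pi_core_def)
  show "pi_core \<pi> G \<lhd> G" "pi_number \<pi> (card (pi_core \<pi> G))"
    "\<And>N. N \<lhd> G \<Longrightarrow> pi_number \<pi> (card N) \<Longrightarrow> N \<subseteq> pi_core \<pi> G"
    using M sub unfolding eq by auto
qed

lemma pi_radical:
  assumes "Y \<lhd> G"
  shows pi_radical_normal: "pi_radical G \<pi> Y \<lhd> G"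
    and pi_radical_factor: "pi_factor \<pi> Y (pi_radical G \<pi> Y)"
    and pi_radical_greatest: "\<And>M. M \<lhd> G \<Longrightarrow> pi_factor \<pi> Y M \<Longrightarrow> M \<subseteq> pi_radical G \<pi> Y"
proof -
  interpret Q: finite_group "G Mod Y" using finite_group_quotient assms .
  have fac: "pi_factor \<pi> Y (\<Union>A) \<longleftrightarrow> pi_number \<pi> (card A)" if "A \<lhd> G Mod Y" for A
    using pi_factor_Union[OF assms normal_imp_subgroup[OF Q.one_is_normal] normal_imp_subgroup[OF that], of \<pi>]
      subgroup.one_closed[OF normal_imp_subgroup[OF that]]
    by (simp add: pi_factor_def)
  show "pi_radical G \<pi> Y \<lhd> G"
    unfolding pi_radical_def using normal_Union[OF assms Q.pi_core_normal] .
  show "pi_factor \<pi> Y (pi_radical G \<pi> Y)"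
    unfolding pi_radical_def using fac[OF Q.pi_core_normal] Q.pi_core_pi_number by blast
  fix M assume M: "M \<lhd> G" "pi_factor \<pi> Y M"
  then obtain A where A: "A \<lhd> G Mod Y" "M = \<Union>A"
    using quotient_normalE[OF assms M(1)] by (auto simp: pi_factor_def)
  then show "M \<subseteq> pi_radical G \<pi> Y"
    unfolding pi_radical_def using fac[OF A(1)] M Q.pi_core_greatest[OF A(1)] by auto
qed

lemma pi_radical_eqI:
  assumes "Y \<lhd> G" "C \<lhd> G" "pi_factor \<pi> Y C"
    and "\<And>M. M \<lhd> G \<Longrightarrow> pi_factor \<pi> Y M \<Longrightarrow> M \<subseteq> C"
  shows "pi_radical G \<pi> Y = C"
  using assms pi_radical[OF assms(1), where \<pi> = \<pi>] by (meson subset_antisym)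

text \<open>
  Taking the radical over \<open>A\<close> inside \<open>G/Y\<close> is the same as taking it over \<open>\<Union>A\<close> inside \<open>G\<close>. It collapses
  the quotients of quotients in the definition of the \<open>p\<close>-Fitting series.
\<close>

lemma pi_radical_quotient:
  assumes "Y \<lhd> G" "A \<lhd> G Mod Y"
  shows "\<Union>(pi_radical (G Mod Y) \<pi> A) = pi_radical G \<pi> (\<Union>A)"
proof -
  interpret Q: finite_group "G Mod Y" using finite_group_quotient assms(1) .
  note R = Q.pi_radical[OF assms(2), where \<pi> = \<pi>]
  note s = normal_imp_subgroup[OF assms(2)] normal_imp_subgroup[OF R(1)]
  show ?thesis
  proof (rule pi_radical_eqI[symmetric])
    show "\<Union>A \<lhd> G" using normal_Union assms .
    show "\<Union>(pi_radical (G Mod Y) \<pi> A) \<lhd> G" using normal_Union[OF assms(1) R(1)] .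
    show "pi_factor \<pi> (\<Union>A) (\<Union>(pi_radical (G Mod Y) \<pi> A))"
      using pi_factor_Union[OF assms(1) s] R(2) by blast
    fix M assume M: "M \<lhd> G" "pi_factor \<pi> (\<Union>A) M"
    then have "Y \<subseteq> M" using Union_superset[OF s(1)] by (auto simp: pi_factor_def)
    then obtain B where B: "B \<lhd> G Mod Y" "M = \<Union>B"
      using quotient_normalE[OF assms(1) M(1)] by blast
    have "pi_factor \<pi> A B"
      using pi_factor_Union[OF assms(1) s(1) normal_imp_subgroup[OF B(1)]] M B by blast
    then show "M \<subseteq> \<Union>(pi_radical (G Mod Y) \<pi> A)" using R(3)[OF B(1)] B by blast
  qed
qed

lemma fold_pi_radical_normal: "N \<lhd> G \<Longrightarrow> fold (pi_radical G) w N \<lhd> G"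
  by (induction w arbitrary: N) (simp_all add: pi_radical_normal)

text \<open>
  The greedy series, in which every term is as large as possible, reaches \<open>G\<close> if any series of the
  same type does, because a series continues from every larger normal subgroup.
\<close>

lemma pi_series_iff_fold:
  assumes "N \<lhd> G"
  shows "pi_series G w N \<longleftrightarrow> fold (pi_radical G) w N = carrier G"
  using assms
proof (induction w arbitrary: N)
  case (Cons \<pi> w)
  note R = pi_radical[OF Cons.prems, where \<pi> = \<pi>]
  have "pi_series G (\<pi> # w) N \<longleftrightarrow> pi_series G w (pi_radical G \<pi> N)"
  proof
    assume "pi_series G (\<pi> # w) N"
    then obtain M where M: "M \<lhd> G" "pi_factor \<pi> N M" "pi_series G w M" by auto
    then show "pi_series G w (pi_radical G \<pi> N)"
      using pi_series_mono[OF M(1) R(1) R(3)[OF M(1,2)]] by blast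
  next
    assume "pi_series G w (pi_radical G \<pi> N)"
    then show "pi_series G (\<pi> # w) N" using R(1,2) by auto
  qed
  then show ?case using Cons.IH[OF R(1)] by simp
qed simp

lemma p_core_eq: "prime p \<Longrightarrow> p_core p G = pi_core {p} G"
  unfolding p_core_def pi_core_def
  by (rule arg_cong[where f = "\<lambda>S. generate G (\<Union>S)"])
    (auto simp: p_group_def order_def pi_number_p_iff subgroup_imp_group normal_imp_subgroup)

lemma p'_core_eq: "prime p \<Longrightarrow> p'_core p G = pi_core (- {p}) G"
  unfolding p'_core_def pi_core_def
  by (rule arg_cong[where f = "\<lambda>S. generate G (\<Union>S)"])
    (auto simp: p'_group_def order_def pi_number_p'_iff subgroup_imp_group normal_imp_subgroup)

lemma upper_P_Suc:
  assumes "prime p" "upper_P p G i \<lhd> G"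
  shows "upper_M p G i = pi_radical G (- {p}) (upper_P p G i)"
    and "upper_P p G (Suc i) = pi_radical G {p} (pi_radical G (- {p}) (upper_P p G i))"
proof -
  show M: "upper_M p G i = pi_radical G (- {p}) (upper_P p G i)"
    unfolding upper_M_def pi_radical_def
    using finite_group.p'_core_eq[OF finite_group_quotient assms(1)] assms(2) by metis
  have "upper_P p G (Suc i) = \<Union>(p_core p (G Mod upper_M p G i))"
    by (simp add: upper_M_def)
  also have "\<dots> = pi_radical G {p} (upper_M p G i)"
    unfolding pi_radical_def
    using finite_group.p_core_eq[OF finite_group_quotient assms(1)] M
      pi_radical_normal[OF assms(2)] by metis
  finally show "upper_P p G (Suc i) = pi_radical G {p} (pi_radical G (- {p}) (upper_P p G i))"
    using M by simp
qed

end

text \<open>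
  The type \<open>p', p, p', p, \<dots>\<close> with \<open>k\<close> pairs, that of the upper \<open>p\<close>-series up to \<open>P\<^sub>k\<close>.
\<close>

definition upper_word :: "nat \<Rightarrow> nat \<Rightarrow> nat set list"
  where "upper_word p k = concat (replicate k [- {p}, {p}])"

lemma upper_word_0 [simp]: "upper_word p 0 = []"
  by (simp add: upper_word_def)

lemma upper_word_Suc: "upper_word p (Suc k) = upper_word p k @ [- {p}, {p}]"
  unfolding upper_word_def by (induction k) auto

lemma upper_word_add: "upper_word p (j + k) = upper_word p j @ upper_word p k"
  by (simp add: upper_word_def replicate_add)

context finite_group
begin

lemma upper_P_eq_fold:
  assumes "prime p"
  shows "upper_P p G k = fold (pi_radical G) (upper_word p k) {\<one>}"
proof (induction k)
  case (Suc k)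
  have "upper_P p G k \<lhd> G" using Suc fold_pi_radical_normal[OF one_is_normal] by simp
  from upper_P_Suc(2)[OF assms this] show ?case using Suc by (simp add: upper_word_Suc)
qed simp

lemma upper_P_normal: "prime p \<Longrightarrow> upper_P p G k \<lhd> G"
  using fold_pi_radical_normal[OF one_is_normal] by (simp add: upper_P_eq_fold)

lemma upper_P_eq_carrier_iff:
  assumes "prime p"
  shows "upper_P p G k = carrier G \<longleftrightarrow> pi_series G (upper_word p k) {\<one>}"
  using pi_series_iff_fold[OF one_is_normal] upper_P_eq_fold[OF assms] by simp

lemma upper_M_eq_carrier_iff:
  assumes "prime p"
  shows "upper_M p G k = carrier G \<longleftrightarrow> pi_series G (upper_word p k @ [- {p}]) {\<one>}"
  using pi_series_iff_fold[OF one_is_normal, of "upper_word p k @ [- {p}]"]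
    upper_P_eq_fold[OF assms, of k] upper_P_Suc(1)[OF assms upper_P_normal[OF assms]] by simp

text \<open>
  \<open>F\<^sub>p = O\<^bsub>p'p\<^esub>\<close>, so each step of the \<open>p\<close>-Fitting series makes a \<open>p'\<close>-step followed by a \<open>p\<close>-step of the
  upper \<open>p\<close>-series.
\<close>

lemma p_Fitting_series_eq:
  assumes "prime p"
  shows "p_Fitting_series p G k = upper_P p G k"
proof (induction k)
  case (Suc k)
  let ?Y = "upper_P p G k"
  have Y: "?Y \<lhd> G" using upper_P_normal[OF assms] .
  interpret Q: finite_group "G Mod ?Y" using finite_group_quotient[OF Y] .
  let ?A = "pi_core (- {p}) (G Mod ?Y)"
  have A: "?A \<lhd> G Mod ?Y" using Q.pi_core_normal .
  interpret R: finite_group "G Mod ?Y Mod ?A" using Q.finite_group_quotient[OF A] .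
  have "p_Fitting_series p G (Suc k) = \<Union>(p_Fitting p (G Mod ?Y))" using Suc by simp
  also have "p_Fitting p (G Mod ?Y) = pi_radical (G Mod ?Y) {p} ?A"
    unfolding p_Fitting_def pi_radical_def
    using Q.p'_core_eq[OF assms] R.p_core_eq[OF assms] by simp
  also have "\<Union>(pi_radical (G Mod ?Y) {p} ?A) = pi_radical G {p} (pi_radical G (- {p}) ?Y)"
    using pi_radical_quotient[OF Y A] by (simp add: pi_radical_def)
  finally show ?case using upper_P_Suc(2)[OF assms Y] by simp
qed simp

section \<open>Complements of abelian normal Hall subgroups\<close>

text \<open>
  Let \<open>m = |K : L|\<close>. For two transversals \<open>r\<close> and \<open>s\<close> of \<open>L\<close> in \<open>K\<close> put
  \<open>E r s = \<Prod> s(C) r(C)\<^sup>-\<^sup>1\<close>, the product over all cosets \<open>C\<close>, taken in the abelian group \<open>L\<close>. Then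
  \<open>E r s \<cdot> E s t = E r t\<close>, and left multiplication of transversals by \<open>k \<in> K\<close> and conjugation by \<open>g \<in> G\<close>
  both act on \<open>E\<close> by conjugation. Fixing one transversal \<open>r\<close>, the map \<open>D k = E r (kr)\<close> is a crossed
  homomorphism which on \<open>L\<close> is the \<open>m\<close>-th power, since \<open>l \<in> L\<close> fixes all cosets and so contributes \<open>m\<close>
  factors \<open>l\<close>. Conjugation by \<open>g\<close> turns \<open>D\<close> into the crossed homomorphism of another transversal, and this
  differs from \<open>D\<close> by the coboundary of an element \<open>c\<close> of \<open>L\<close>.
\<close>

lemma ex_crossed_hom_extending_power:
  assumes L: "L \<lhd> G" and K: "K \<lhd> G" and LK: "L \<subseteq> K"
    and comm: "\<forall>x\<in>L. \<forall>y\<in>L. x \<otimes> y = y \<otimes> x"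
  shows "\<exists>D. (\<forall>k\<in>K. D k \<in> L) \<and>
    (\<forall>k\<in>K. \<forall>k'\<in>K. D (k \<otimes> k') = D k \<otimes> (k \<otimes> D k' \<otimes> inv k)) \<and>
    (\<forall>l\<in>L. D l = l [^] (card K div card L)) \<and>
    (\<forall>g\<in>carrier G. \<exists>c\<in>L. \<forall>k\<in>K. D (g \<otimes> k \<otimes> inv g) =
      c \<otimes> (g \<otimes> D k \<otimes> inv g) \<otimes> ((g \<otimes> k \<otimes> inv g) \<otimes> inv c \<otimes> inv (g \<otimes> k \<otimes> inv g)))"
proof -
  note sL = normal_imp_subgroup[OF L] and sK = normal_imp_subgroup[OF K]
  note Lc [simp] = subgroup.mem_carrier[OF sL] and Kc [simp] = subgroup.mem_carrier[OF sK]
  interpret LG: comm_group "G\<lparr>carrier := L\<rparr>"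
    using group.group_comm_groupI[OF subgroup_imp_group[OF sL]] comm by simp
  note comm = bspec[OF bspec[OF comm]]
  define \<Omega> where "\<Omega> = (\<lambda>x. L #> x) ` K"
  define S where "S = {r. \<forall>C\<in>\<Omega>. r C \<in> C}"
  define \<tau> where "\<tau> = (\<lambda>g h C. (\<lambda>x. inv g \<otimes> x \<otimes> h) ` C)"
  define act where "act = (\<lambda>g h r C. g \<otimes> r (\<tau> g h C) \<otimes> inv h)"
  \<comment> \<open>Both kinds of action on transversals are instances of \<open>act g h\<close>, which sends \<open>r\<close> to the transversal of the elements \<open>g r(C) h\<^sup>-\<^sup>1\<close>: left multiplication is \<open>act k \<one>\<close>, conjugation is \<open>act g g\<close>. The action of \<open>g\<close> and \<open>h\<close> on cosets is inverse to \<open>\<tau> g h\<close>.\<close>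
  define E where "E = (\<lambda>r s. finprod (G\<lparr>carrier := L\<rparr>) (\<lambda>C. s C \<otimes> inv (r C)) \<Omega>)"
  define ok where "ok = (\<lambda>g h. g \<in> carrier G \<and> h \<in> carrier G \<and> g \<otimes> inv h \<in> K)"
  have okc: "g \<in> carrier G" "h \<in> carrier G" if "ok g h" for g h
    using that by (auto simp: ok_def)
  have okK: "ok k \<one>" if "k \<in> K" for k using that by (simp add: ok_def)
  have okG: "ok g g" if "g \<in> carrier G" for g
    using that by (simp add: ok_def subgroup.one_closed[OF sK])
  have fin: "finite \<Omega>" using finite_subgroup[OF sK] by (simp add: \<Omega>_def)
  have sub: "C \<subseteq> K" if "C \<in> \<Omega>" for C
    using that LK subgroup.m_closed[OF sK] by (auto simp: \<Omega>_def r_coset_def)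
  have subc: "y \<in> carrier G" if "C \<in> \<Omega>" "y \<in> C" for C y
    using Kc[OF subsetD[OF sub[OF that(1)] that(2)]] .
  have quot: "y \<otimes> inv z \<in> L" if C: "C \<in> \<Omega>" "y \<in> C" "z \<in> C" for C y z
  proof -
    obtain x where x: "x \<in> K" "C = L #> x" using C(1) by (auto simp: \<Omega>_def)
    obtain l l' where l: "l \<in> L" "l' \<in> L" "y = l \<otimes> x" "z = l' \<otimes> x"
      using C x by (auto simp: r_coset_def)
    have "y \<otimes> inv z = l \<otimes> inv l'"
      unfolding l(3,4) using x l(1,2) by (simp add: m_assoc inv_mult_group inv_mult_cancel)
    then show ?thesis using l sL by (simp add: subgroup.m_closed subgroup.m_inv_closed)
  qed
  have \<tau>_coset: "\<tau> g h (L #> x) = L #> (inv g \<otimes> x \<otimes> h)"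
    if gh: "g \<in> carrier G" "h \<in> carrier G" "x \<in> carrier G" for g h x
  proof
    show "\<tau> g h (L #> x) \<subseteq> L #> (inv g \<otimes> x \<otimes> h)"
    proof
      fix y assume "y \<in> \<tau> g h (L #> x)"
      then obtain l where l: "l \<in> L" "y = inv g \<otimes> (l \<otimes> x) \<otimes> h" by (auto simp: \<tau>_def r_coset_def)
      have "y = (inv g \<otimes> l \<otimes> g) \<otimes> (inv g \<otimes> x \<otimes> h)"
        unfolding l(2) using l(1) gh by (simp add: m_assoc inv_mult_cancel)
      moreover have "inv g \<otimes> l \<otimes> g \<in> L" using normal.inv_op_closed1[OF L gh(1) l(1)] .
      ultimately show "y \<in> L #> (inv g \<otimes> x \<otimes> h)" by (auto simp: r_coset_def)
    qed
    show "L #> (inv g \<otimes> x \<otimes> h) \<subseteq> \<tau> g h (L #> x)"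
    proof
      fix y assume "y \<in> L #> (inv g \<otimes> x \<otimes> h)"
      then obtain l where l: "l \<in> L" "y = l \<otimes> (inv g \<otimes> x \<otimes> h)" by (auto simp: r_coset_def)
      have "y = inv g \<otimes> ((g \<otimes> l \<otimes> inv g) \<otimes> x) \<otimes> h"
        unfolding l(2) using l(1) gh by (simp add: m_assoc inv_mult_cancel)
      moreover have "g \<otimes> l \<otimes> inv g \<in> L" using normal.inv_op_closed2[OF L gh(1) l(1)] .
      ultimately show "y \<in> \<tau> g h (L #> x)" by (auto simp: \<tau>_def r_coset_def)
    qed
  qed
  have \<tau>_closed: "\<tau> g h C \<in> \<Omega>" if gh: "ok g h" and C: "C \<in> \<Omega>" for g h C
  proof -
    note [simp] = okc[OF gh]
    obtain x where x: "x \<in> K" "C = L #> x" using C by (auto simp: \<Omega>_def)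
    have "inv (g \<otimes> inv h) \<in> K" using gh subgroup.m_inv_closed[OF sK] by (auto simp: ok_def)
    then have "x \<otimes> (h \<otimes> inv g) \<in> K" using x gh subgroup.m_closed[OF sK] by (simp add: inv_mult_group)
    then have "inv g \<otimes> (x \<otimes> (h \<otimes> inv g)) \<otimes> g \<in> K"
      by (rule normal.inv_op_closed1[OF K okc(1)[OF gh]])
    then have "inv g \<otimes> x \<otimes> h \<in> K" using x gh by (simp add: m_assoc)
    then show ?thesis using \<tau>_coset gh x by (simp add: \<Omega>_def)
  qed
  have \<tau>_inj: "inj_on (\<tau> g h) \<Omega>" if gh: "ok g h" for g h
  proof (rule inj_onI)
    note [simp] = okc[OF gh]
    fix C C' assume C: "C \<in> \<Omega>" "C' \<in> \<Omega>" "\<tau> g h C = \<tau> g h C'"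
    have inj: "inj_on (\<lambda>x. inv g \<otimes> x \<otimes> h) (carrier G)" using gh by (auto intro!: inj_onI)
    have "C \<subseteq> carrier G" "C' \<subseteq> carrier G" using subc C by auto
    then show "C = C'" using inj_on_image_eq_iff[OF inj] C(3) by (simp add: \<tau>_def)
  qed
  have \<tau>_surj: "\<tau> g h ` \<Omega> = \<Omega>" if "ok g h" for g h
    using endo_inj_surj[OF fin] \<tau>_inj \<tau>_closed that by blast
  have act_closed: "act g h r \<in> S" if gh: "ok g h" and r: "r \<in> S" for g h r
  proof -
    note [simp] = okc[OF gh]
    have "act g h r C \<in> C" if C: "C \<in> \<Omega>" for C
    proof -
      have "r (\<tau> g h C) \<in> \<tau> g h C" using r \<tau>_closed[OF gh C] by (simp add: S_def)
      then obtain y where y: "y \<in> C" "r (\<tau> g h C) = inv g \<otimes> y \<otimes> h" by (auto simp: \<tau>_def)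
      then have "act g h r C = y"
        using gh subc[OF C] by (simp add: act_def m_assoc inv_mult_cancel)
      with y show ?thesis by simp
    qed
    then show ?thesis by (simp add: S_def)
  qed
  have in_L: "s C \<otimes> inv (r C) \<in> L" if "r \<in> S" "s \<in> S" "C \<in> \<Omega>" for r s C
    using quot that by (auto simp: S_def)
  have Sc: "r C \<in> carrier G" if "r \<in> S" "C \<in> \<Omega>" for r C using that subc by (auto simp: S_def)
  have E_closed: "E r s \<in> L" if "r \<in> S" "s \<in> S" for r s
    using LG.finprod_closed[of "\<lambda>C. s C \<otimes> inv (r C)" \<Omega>] in_L that by (auto simp: E_def)
  have E_trans: "E r s \<otimes> E s t = E r t" if rst: "r \<in> S" "s \<in> S" "t \<in> S" for r s t
  proof -
    have "E r s \<otimes> E s t = finprod (G\<lparr>carrier := L\<rparr>) (\<lambda>C. (s C \<otimes> inv (r C)) \<otimes> (t C \<otimes> inv (s C))) \<Omega>"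
      using LG.finprod_multf[of "\<lambda>C. s C \<otimes> inv (r C)" \<Omega> "\<lambda>C. t C \<otimes> inv (s C)"] in_L rst
      by (simp add: E_def Pi_def)
    also have "\<dots> = E r t"
      unfolding E_def
    proof (rule LG.finprod_cong')
      fix C assume C: "C \<in> \<Omega>"
      have "(s C \<otimes> inv (r C)) \<otimes> (t C \<otimes> inv (s C)) = (t C \<otimes> inv (s C)) \<otimes> (s C \<otimes> inv (r C))"
        using comm in_L rst C by simp
      also have "\<dots> = t C \<otimes> inv (r C)"
        using Sc rst C by (simp add: m_assoc inv_mult_cancel)
      finally show "(s C \<otimes> inv (r C)) \<otimes> (t C \<otimes> inv (s C)) = t C \<otimes> inv (r C)" .
    qed (use in_L rst in auto)
    finally show ?thesis .
  qed
  have E_swap: "E s r = inv (E r s)" if rs: "r \<in> S" "s \<in> S" for r s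
  proof -
    have "E r r \<otimes> E r r = E r r" using E_trans rs by simp
    then have "E r r = \<one>" using E_closed[OF rs(1,1)] by (simp add: l_cancel_one)
    then have "E s r \<otimes> E r s = \<one>" using E_trans[OF rs(2,1,2)] E_trans[OF rs(2,2,2)] E_closed[OF rs(2,2)]
      by (simp add: l_cancel_one)
    then show ?thesis using inv_equality E_closed rs by (metis Lc)
  qed
  have conj_prod: "finprod (G\<lparr>carrier := L\<rparr>) (\<lambda>C. g \<otimes> \<phi> C \<otimes> inv g) A
      = g \<otimes> finprod (G\<lparr>carrier := L\<rparr>) \<phi> A \<otimes> inv g"
    if "finite A" "g \<in> carrier G" "\<phi> \<in> A \<rightarrow> L" for g \<phi> and A :: "'a set set"
    using that
  proof (induction A rule: finite_induct)
    case (insert C A)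
    have cl: "\<phi> C \<in> L" "finprod (G\<lparr>carrier := L\<rparr>) \<phi> A \<in> L"
      using insert.prems LG.finprod_closed[of \<phi> A] by auto
    have "(\<lambda>C. g \<otimes> \<phi> C \<otimes> inv g) \<in> A \<rightarrow> L" "g \<otimes> \<phi> C \<otimes> inv g \<in> L"
      using insert.prems normal.inv_op_closed2[OF L] by auto
    then have "finprod (G\<lparr>carrier := L\<rparr>) (\<lambda>C. g \<otimes> \<phi> C \<otimes> inv g) (insert C A)
      = (g \<otimes> \<phi> C \<otimes> inv g) \<otimes> (g \<otimes> finprod (G\<lparr>carrier := L\<rparr>) \<phi> A \<otimes> inv g)"
      using insert by (simp add: LG.finprod_insert)
    also have "\<dots> = g \<otimes> (\<phi> C \<otimes> finprod (G\<lparr>carrier := L\<rparr>) \<phi> A) \<otimes> inv g"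
      using cl insert.prems by (simp add: m_assoc inv_mult_cancel)
    finally show ?case using insert cl by (simp add: LG.finprod_insert)
  qed simp
  have E_act: "E (act g h r) (act g h s) = g \<otimes> E r s \<otimes> inv g"
    if gh: "ok g h" and rs: "r \<in> S" "s \<in> S" for g h r s
  proof -
    note [simp] = okc[OF gh]
    let ?\<phi> = "\<lambda>C. s C \<otimes> inv (r C)"
    have \<phi>: "?\<phi> \<in> \<Omega> \<rightarrow> L" "(\<lambda>C. ?\<phi> (\<tau> g h C)) \<in> \<Omega> \<rightarrow> L"
      using in_L rs \<tau>_closed[OF gh] by auto
    have "E (act g h r) (act g h s) = finprod (G\<lparr>carrier := L\<rparr>) (\<lambda>C. g \<otimes> ?\<phi> (\<tau> g h C) \<otimes> inv g) \<Omega>"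
      unfolding E_def
    proof (rule LG.finprod_cong')
      fix C assume C: "C \<in> \<Omega>"
      have "r (\<tau> g h C) \<in> carrier G" "s (\<tau> g h C) \<in> carrier G"
        using Sc rs \<tau>_closed[OF gh C] by auto
      then show "act g h s C \<otimes> inv (act g h r C) = g \<otimes> ?\<phi> (\<tau> g h C) \<otimes> inv g"
        using gh by (simp add: act_def m_assoc inv_mult_group inv_mult_cancel)
    qed (use \<phi> normal.inv_op_closed2[OF L okc(1)[OF gh]] in auto)
    also have "\<dots> = g \<otimes> finprod (G\<lparr>carrier := L\<rparr>) (\<lambda>C. ?\<phi> (\<tau> g h C)) \<Omega> \<otimes> inv g"
      using conj_prod[OF fin okc(1)[OF gh] \<phi>(2)] .
    also have "finprod (G\<lparr>carrier := L\<rparr>) (\<lambda>C. ?\<phi> (\<tau> g h C)) \<Omega> = E r s"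
      using LG.finprod_reindex[OF _ \<tau>_inj[OF gh], of ?\<phi>] \<phi>(1) by (simp add: \<tau>_surj[OF gh] E_def)
    finally show ?thesis .
  qed
  have act_comp: "act (g \<otimes> g') (h \<otimes> h') r C = act g h (act g' h' r) C"
    if gh: "ok g h" "ok g' h'" and r: "r \<in> S" and C: "C \<in> \<Omega>" for g h g' h' r C
  proof -
    note [simp] = okc[OF gh(1)] okc[OF gh(2)]
    have "\<tau> (g \<otimes> g') (h \<otimes> h') C = \<tau> g' h' (\<tau> g h C)"
      unfolding \<tau>_def image_image
      using gh subc[OF C] by (intro image_cong) (simp_all add: m_assoc inv_mult_group)
    moreover have "r (\<tau> g' h' (\<tau> g h C)) \<in> carrier G"
      using Sc[OF r] \<tau>_closed gh C by simp
    ultimately show ?thesis using gh by (simp add: act_def m_assoc inv_mult_group)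
  qed
  have E_cong: "E r s = E r' s'"
    if "\<And>C. C \<in> \<Omega> \<Longrightarrow> r C = r' C" "\<And>C. C \<in> \<Omega> \<Longrightarrow> s C = s' C" "r' \<in> S" "s' \<in> S" for r r' s s'
    unfolding E_def by (rule LG.finprod_cong') (use that in_L in auto)
  have "\<exists>r. \<forall>C\<in>\<Omega>. r C \<in> C"
  proof (rule bchoice, rule ballI)
    fix C assume "C \<in> \<Omega>"
    then obtain x where "x \<in> K" "C = L #> x" by (auto simp: \<Omega>_def)
    then show "\<exists>y. y \<in> C" using subgroup.rcosets_non_empty[OF sL, of C] rcosetsI[of L x] subgroup.subset[OF sL] by auto
  qed
  then obtain r where r: "r \<in> S" by (auto simp: S_def)
  define D where "D = (\<lambda>k. E r (act k \<one> r))"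
  have aK: "act k \<one> s \<in> S" if "k \<in> K" "s \<in> S" for k s using act_closed[OF okK] that by simp
  have D_closed: "D k \<in> L" if "k \<in> K" for k
    unfolding D_def using E_closed r aK that by simp
  have D_mult: "D (k \<otimes> k') = D k \<otimes> (k \<otimes> D k' \<otimes> inv k)" if k: "k \<in> K" "k' \<in> K" for k k'
  proof -
    have "D (k \<otimes> k') = E r (act k \<one> (act k' \<one> r))"
      unfolding D_def
      using E_cong[OF refl act_comp[OF okK[OF k(1)] okK[OF k(2)] r] r aK[OF k(1) aK[OF k(2) r]]]
      by simp
    also have "\<dots> = E r (act k \<one> r) \<otimes> E (act k \<one> r) (act k \<one> (act k' \<one> r))"
      using E_trans[OF r aK[OF k(1) r] aK[OF k(1) aK[OF k(2) r]]] by simp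
    also have "E (act k \<one> r) (act k \<one> (act k' \<one> r)) = k \<otimes> D k' \<otimes> inv k"
      unfolding D_def using E_act[OF okK[OF k(1)] r aK[OF k(2) r]] .
    finally show ?thesis by (simp add: D_def)
  qed
  have D_power: "D l = l [^] (card K div card L)" if l: "l \<in> L" for l
  proof -
    have lK: "l \<in> K" using l LK by blast
    have "D l = finprod (G\<lparr>carrier := L\<rparr>) (\<lambda>C. l) \<Omega>"
      unfolding D_def E_def
    proof (rule LG.finprod_cong')
      fix C assume C: "C \<in> \<Omega>"
      then obtain x where x: "x \<in> K" "C = L #> x" by (auto simp: \<Omega>_def)
      have "\<tau> l \<one> C = L #> (inv l \<otimes> x \<otimes> \<one>)" unfolding x(2) using l x by (intro \<tau>_coset) auto
      also have "\<dots> = (L #> inv l) #> x" using l x subgroup.subset[OF sL] by (simp add: coset_mult_assoc)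
      also have "\<dots> = C"
        using x l subgroup.rcos_const[OF sL is_group, of "inv l"] subgroup.m_inv_closed[OF sL] by simp
      finally have "\<tau> l \<one> C = C" .
      then show "act l \<one> r C \<otimes> inv (r C) = l"
        using l Sc[OF r C] by (simp add: act_def m_assoc)
    qed (use l in auto)
    also have "\<dots> = l [^] card \<Omega>"
      using LG.finprod_const[of l \<Omega>] l by (simp add: nat_pow_consistent[symmetric])
    also have "card \<Omega> = card K div card L"
    proof -
      have "\<Omega> = rcosets\<^bsub>G\<lparr>carrier := K\<rparr>\<^esub> L" by (auto simp: \<Omega>_def RCOSETS_def)
      then have "card \<Omega> * card L = card K"
        using group.lagrange[OF subgroup_imp_group[OF sK] subgroup_incl[OF sL sK LK]]
        by (simp add: order_def)
      then show ?thesis using card_subgroup_pos[OF sL] by (metis nonzero_mult_div_cancel_right less_numeral_extra(3))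
    qed
    finally show ?thesis .
  qed
  have D_conj: "\<exists>c\<in>L. \<forall>k\<in>K. D (g \<otimes> k \<otimes> inv g) =
      c \<otimes> (g \<otimes> D k \<otimes> inv g) \<otimes> ((g \<otimes> k \<otimes> inv g) \<otimes> inv c \<otimes> inv (g \<otimes> k \<otimes> inv g))"
    if g: "g \<in> carrier G" for g
  proof (intro bexI ballI)
    note gS = act_closed[OF okG[OF g]]
    let ?c = "E r (act g g r)"
    show "?c \<in> L" using E_closed[OF r gS[OF r]] .
    fix k assume k: "k \<in> K"
    let ?x = "g \<otimes> k \<otimes> inv g"
    have x: "?x \<in> K" using normal.inv_op_closed2[OF K g k] .
    have 1: "E (act g g r) (act g g (act k \<one> r)) = g \<otimes> D k \<otimes> inv g"
      unfolding D_def using E_act[OF okG[OF g] r aK[OF k r]] .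
    have 2: "E (act g g r) (act g g (act k \<one> r)) = E (act g g r) (act ?x \<one> (act g g r))"
    proof (rule E_cong[OF refl])
      fix C assume C: "C \<in> \<Omega>"
      have "act g g (act k \<one> r) C = act (g \<otimes> k) (g \<otimes> \<one>) r C"
        using act_comp[OF okG[OF g] okK[OF k] r C] by simp
      also have "\<dots> = act (?x \<otimes> g) (\<one> \<otimes> g) r C" using g k by (simp add: m_assoc)
      also have "\<dots> = act ?x \<one> (act g g r) C"
        using act_comp[OF okK[OF x] okG[OF g] r C] .
      finally show "act g g (act k \<one> r) C = act ?x \<one> (act g g r) C" .
    qed (use gS[OF r] aK[OF x gS[OF r]] in auto)
    have 3: "E (act ?x \<one> (act g g r)) (act ?x \<one> r) = ?x \<otimes> inv ?c \<otimes> inv ?x"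
      using E_act[OF okK[OF x] gS[OF r] r] E_swap[OF r gS[OF r]] by simp
    have "D ?x = E r (act ?x \<one> (act g g r)) \<otimes> E (act ?x \<one> (act g g r)) (act ?x \<one> r)"
      unfolding D_def using E_trans[OF r aK[OF x gS[OF r]] aK[OF x r]] by simp
    also have "E r (act ?x \<one> (act g g r)) = ?c \<otimes> (g \<otimes> D k \<otimes> inv g)"
      using E_trans[OF r gS[OF r] aK[OF x gS[OF r]]] 1 2 by simp
    finally show "D ?x = ?c \<otimes> (g \<otimes> D k \<otimes> inv g) \<otimes> (?x \<otimes> inv ?c \<otimes> inv ?x)" using 3 by simp
  qed
  show ?thesis using D_closed D_mult D_power D_conj by (intro exI[of _ D] conjI ballI) simp_all
qed

lemma ex_root_of_coprime_degree:
  assumes L: "subgroup L G" and "coprime (card L) m" and l: "l \<in> L"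
  shows "\<exists>k\<in>L. k [^] m = l"
proof (cases "card L = 1")
  case True
  then have "L = {\<one>}" using subgroup.one_closed[OF L] by (auto simp: card_1_singleton_iff)
  then show ?thesis using l by auto
next
  case False
  interpret LG: group "G\<lparr>carrier := L\<rparr>" using subgroup_imp_group[OF L] .
  have lc: "l \<in> carrier G" using l L subgroup.mem_carrier by metis
  obtain x y where xy: "m * x = card L * y + 1"
    using coprime_bezout_strong[of m "card L"] assms(2) False by (auto simp: coprime_commute)
  have "l [^] card L = \<one>"
    using LG.pow_order_eq_1[of l] l by (simp add: order_def nat_pow_consistent[symmetric])
  then have "l [^] (m * x) = l"
    using lc by (simp add: xy nat_pow_mult[symmetric] nat_pow_pow[symmetric])
  then have "(l [^] x) [^] m = l" using lc by (simp add: nat_pow_pow mult.commute)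
  moreover have "l [^] x \<in> L" using LG.nat_pow_closed[of l x] l by (simp add: nat_pow_consistent[symmetric])
  ultimately show ?thesis by blast
qed

text \<open>
  The kernel \<open>Q\<close> of the crossed homomorphism \<open>D\<close> is the complement. As \<open>m = |K : L|\<close> is prime to \<open>|L|\<close>,
  taking \<open>m\<close>-th powers is bijective on \<open>L\<close>; so every \<open>k \<in> K\<close> can be moved into \<open>Q\<close> by a unique factor from
  \<open>L\<close>. The coboundary by which conjugation with \<open>g\<close> changes \<open>D\<close> can be undone by conjugation with an
  element of \<open>L\<close>, so the conjugate of \<open>Q\<close> under \<open>g\<close> is conjugate to \<open>Q\<close> under \<open>L\<close>. The last clause is
  stated for all of \<open>G\<close>, and not just for \<open>K\<close>, to allow a Frattini argument.
\<close>

lemma schur_zassenhaus_abelian: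
  assumes L: "L \<lhd> G" and K: "K \<lhd> G" and LK: "L \<subseteq> K"
    and comm: "\<forall>x\<in>L. \<forall>y\<in>L. x \<otimes> y = y \<otimes> x"
    and cop: "coprime (card L) (card K div card L)"
  obtains Q where "subgroup Q G" "Q \<subseteq> K" "L \<inter> Q = {\<one>}" "L <#> Q = K"
    and "\<forall>g\<in>carrier G. \<exists>l\<in>L. \<forall>q\<in>Q. (l \<otimes> g) \<otimes> q \<otimes> inv (l \<otimes> g) \<in> Q"
proof -
  note sL = normal_imp_subgroup[OF L] and sK = normal_imp_subgroup[OF K]
  note Lc [simp] = subgroup.mem_carrier[OF sL] and Kc [simp] = subgroup.mem_carrier[OF sK]
  note Lm [simp] = subgroup.m_closed[OF sL] and Km [simp] = subgroup.m_closed[OF sK]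
  note Li [simp] = subgroup.m_inv_closed[OF sL] and Ki [simp] = subgroup.m_inv_closed[OF sK]
  note L1 [simp] = subgroup.one_closed[OF sL] and K1 [simp] = subgroup.one_closed[OF sK]
  let ?m = "card K div card L"
  obtain D where D0: "\<forall>k\<in>K. D k \<in> L"
    and mult0: "\<forall>k\<in>K. \<forall>k'\<in>K. D (k \<otimes> k') = D k \<otimes> (k \<otimes> D k' \<otimes> inv k)"
    and pow0: "\<forall>l\<in>L. D l = l [^] ?m"
    and conj: "\<forall>g\<in>carrier G. \<exists>c\<in>L. \<forall>k\<in>K. D (g \<otimes> k \<otimes> inv g) =
      c \<otimes> (g \<otimes> D k \<otimes> inv g) \<otimes> ((g \<otimes> k \<otimes> inv g) \<otimes> inv c \<otimes> inv (g \<otimes> k \<otimes> inv g))"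
    using ex_crossed_hom_extending_power[OF L K LK comm] by (elim exE conjE)
  note comm = bspec[OF bspec[OF comm]]
  note D = bspec[OF D0] and mult = bspec[OF bspec[OF mult0]] and pow = bspec[OF pow0]
  note root = ex_root_of_coprime_degree[OF sL cop]
  have Dc [simp]: "D k \<in> carrier G" if "k \<in> K" for k using D[OF that] by simp
  have conjL: "k \<otimes> x \<otimes> inv k \<in> L" if "k \<in> carrier G" "x \<in> L" for k x
    using normal.inv_op_closed2[OF L that] .
  let ?Q = "{k \<in> K. D k = \<one>}"
  have D1: "D \<one> = \<one>" using pow[OF L1] by simp
  have Dl: "D (l \<otimes> k) = l [^] ?m \<otimes> D k" if "l \<in> L" "k \<in> K" for l k
  proof -
    have "l \<otimes> D k \<otimes> inv l = D k"
      using comm[OF that(1) D[OF that(2)]] that by (simp add: m_assoc)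
    then show ?thesis using mult[of l k] pow that LK by auto
  qed
  have Q: "subgroup ?Q G"
  proof (rule subgroupI)
    show "?Q \<subseteq> carrier G" by auto
    show "?Q \<noteq> {}" using D1 K1 by blast
    fix k assume k: "k \<in> ?Q"
    have "D (inv k \<otimes> k) = D (inv k) \<otimes> (inv k \<otimes> D k \<otimes> inv (inv k))"
      using mult[of "inv k" k] k by simp
    then show "inv k \<in> ?Q" using k D1 by simp
    fix k' assume k': "k' \<in> ?Q"
    show "k \<otimes> k' \<in> ?Q" using mult[of k k'] k k' by simp
  qed
  have int: "L \<inter> ?Q = {\<one>}"
  proof -
    have "x = \<one>" if x: "x \<in> L" "x [^] ?m = \<one>" for x
    proof -
      interpret LG: group "G\<lparr>carrier := L\<rparr>" using subgroup_imp_group[OF sL] .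
      have "x [^] card L = \<one>"
        using LG.pow_order_eq_1[of x] x by (simp add: order_def nat_pow_consistent[symmetric])
      then have "ord x dvd card L" "ord x dvd ?m" using pow_eq_id x by auto
      then have "ord x = 1" using cop by (metis coprime_common_divisor_nat nat_dvd_1_iff_1 coprime_def)
      then show "x = \<one>" using x ord_eq_1 by simp
    qed
    then show ?thesis using pow D1 by auto
  qed
  have prod: "L <#> ?Q = K"
  proof
    show "L <#> ?Q \<subseteq> K" by (rule set_mult_least[OF sK LK]) auto
    show "K \<subseteq> L <#> ?Q"
    proof
      fix k assume k: "k \<in> K"
      obtain l where l: "l \<in> L" "l [^] ?m = inv (D k)" using root[of "inv (D k)"] D[OF k] by auto
      have "l \<otimes> k \<in> ?Q" using Dl[OF l(1) k] l k LK by auto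
      moreover have "k = inv l \<otimes> (l \<otimes> k)" using l k by (simp add: inv_mult_cancel)
      moreover have "inv l \<in> L" using l by simp
      ultimately show "k \<in> L <#> ?Q" unfolding set_mult_def by blast
    qed
  qed
  have norm: "\<exists>l\<in>L. \<forall>q\<in>?Q. (l \<otimes> g) \<otimes> q \<otimes> inv (l \<otimes> g) \<in> ?Q" if g: "g \<in> carrier G" for g
  proof -
    obtain c where c: "c \<in> L" and Dg: "\<And>k. k \<in> K \<Longrightarrow> D (g \<otimes> k \<otimes> inv g) =
      c \<otimes> (g \<otimes> D k \<otimes> inv g) \<otimes> ((g \<otimes> k \<otimes> inv g) \<otimes> inv c \<otimes> inv (g \<otimes> k \<otimes> inv g))"
      using bspec[OF conj g] by blast
    \<comment> \<open>Solving \<open>l\<^sup>m c = 1\<close> makes the coboundary of \<open>l\<close> cancel that of \<open>c\<close>.\<close>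
    obtain l where l: "l \<in> L" "l [^] ?m = inv c" using root[of "inv c"] c by auto
    show ?thesis
    proof (intro bexI[of _ l] ballI)
      fix q assume q: "q \<in> ?Q"
      let ?x = "g \<otimes> q \<otimes> inv g"
      have x: "?x \<in> K" using normal.inv_op_closed2[OF K g] q by blast
      have lK: "l \<in> K" "inv l \<in> K" using l LK by auto
      have Dx: "D ?x = c \<otimes> (?x \<otimes> inv c \<otimes> inv ?x)" using Dg[of q] q g c by simp
      have li: "(inv l) [^] ?m = c" using nat_pow_inv[of l ?m] l c by simp
      have "D (l \<otimes> (?x \<otimes> inv l)) = inv c \<otimes> (D ?x \<otimes> (?x \<otimes> D (inv l) \<otimes> inv ?x))"
        using Dl[of l "?x \<otimes> inv l"] mult[OF x lK(2)] l x lK by simp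
      also have "\<dots> = inv c \<otimes> ((c \<otimes> (?x \<otimes> inv c \<otimes> inv ?x)) \<otimes> (?x \<otimes> c \<otimes> inv ?x))"
        using pow[of "inv l"] l li Dx by simp
      also have "\<dots> = \<one>"
      proof -
        have "inv c \<otimes> ((c \<otimes> (x \<otimes> inv c \<otimes> inv x)) \<otimes> (x \<otimes> c \<otimes> inv x)) = \<one>"
          if "x \<in> carrier G" for x
          using that c by (simp add: m_assoc inv_mult_cancel)
        then show ?thesis using Kc[OF x] by blast
      qed
      finally have "D (l \<otimes> (?x \<otimes> inv l)) = \<one>" .
      moreover have "l \<otimes> (?x \<otimes> inv l) = (l \<otimes> g) \<otimes> q \<otimes> inv (l \<otimes> g)"
        using l g q by (simp add: m_assoc inv_mult_group)
      moreover have "l \<otimes> (?x \<otimes> inv l) \<in> K" using lK x by simp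
      ultimately show "(l \<otimes> g) \<otimes> q \<otimes> inv (l \<otimes> g) \<in> ?Q" by simp
    qed (rule l)
  qed
  show ?thesis using that[OF Q _ int prod] norm by blast
qed

end

section \<open>Minimal normal subgroups of solvable and p-solvable groups\<close>

lemma pi_number_p_dvd: "prime p \<Longrightarrow> pi_number {p} m \<Longrightarrow> m \<noteq> 1 \<Longrightarrow> p dvd m"
  by (metis dvd_power neq0_conv pi_number_p_iff power_0)

context finite_group
begin

lemma ex_subgroup_prime_card:
  assumes "subgroup N G" "prime q" "q dvd card N"
  obtains H where "subgroup H G" "H \<subseteq> N" "card H = q"
proof -
  interpret N: finite_group "G\<lparr>carrier := N\<rparr>" using finite_group_subgroup assms by blast
  obtain m where "card N = q ^ 1 * m" using assms(3) by auto
  then obtain H where H: "subgroup H (G\<lparr>carrier := N\<rparr>)" "card H = q"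
    using sylow_thm[of q "G\<lparr>carrier := N\<rparr>" 1 m] assms(2) N.is_group finite_subgroup[OF assms(1)]
    by (auto simp: order_def)
  then show ?thesis using that[of H] incl_subgroup[OF assms(1)] subgroup.subset[OF H(1)] by simp
qed

lemma pow_card_eq_1:
  assumes "subgroup H G" "x \<in> H"
  shows "x [^] card H = \<one>"
proof -
  interpret H: group "G\<lparr>carrier := H\<rparr>" using subgroup_imp_group assms(1) .
  show ?thesis
    using H.pow_order_eq_1[of x] assms(2) by (simp add: order_def nat_pow_consistent[symmetric])
qed

lemma cauchy:
  assumes "subgroup N G" "prime q" "q dvd card N"
  obtains x where "x \<in> N" "x \<noteq> \<one>" "x [^] q = \<one>"
proof -
  obtain H where H: "subgroup H G" "H \<subseteq> N" "card H = q"
    using ex_subgroup_prime_card[OF assms] .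
  have "H \<noteq> {\<one>}" using H assms(2) by auto
  then obtain x where "x \<in> H" "x \<noteq> \<one>" using subgroup.one_closed[OF H(1)] by blast
  then show ?thesis using that[of x] pow_card_eq_1[OF H(1)] H by auto
qed

lemma chief_factor_oneD:
  assumes "chief_factor G N {\<one>}"
  shows "N \<lhd> G" "N \<noteq> {\<one>}" "\<And>L. L \<lhd> G \<Longrightarrow> L \<subseteq> N \<Longrightarrow> L \<noteq> {\<one>} \<Longrightarrow> L = N"
proof -
  show "N \<lhd> G" "N \<noteq> {\<one>}" using assms by (auto simp: chief_factor_def)
  fix L assume L: "L \<lhd> G" "L \<subseteq> N" "L \<noteq> {\<one>}"
  then have "{\<one>} \<subseteq> L" using subgroup.one_closed[OF normal_imp_subgroup] by blast
  then show "L = N" using assms L unfolding chief_factor_def by blast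
qed

lemma pi_factor_one: "subgroup N G \<Longrightarrow> pi_factor \<pi> {\<one>} N \<longleftrightarrow> pi_number \<pi> (card N)"
  using subgroup.one_closed[of N G] by (simp add: pi_factor_def)

text \<open>
  Reduces statements about chief factors to minimal normal subgroups.
\<close>

lemma chief_factor_as_quotient:
  assumes "chief_factor G L K"
  obtains A where "A \<lhd> G Mod K" "L = \<Union>A" "chief_factor (G Mod K) A {\<one>\<^bsub>G Mod K\<^esub>}"
    and "\<And>\<pi>. pi_factor \<pi> K L \<longleftrightarrow> pi_number \<pi> (card A)"
proof -
  have LK: "L \<lhd> G" "K \<lhd> G" "K \<subseteq> L" using assms by (auto simp: chief_factor_def)
  interpret Q: finite_group "G Mod K" using finite_group_quotient[OF LK(2)] .
  obtain A where A: "A \<lhd> G Mod K" "L = \<Union>A" using quotient_normalE[OF LK(2,1,3)] .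
  have "chief_factor (G Mod K) A {\<one>\<^bsub>G Mod K\<^esub>}"
    using chief_factor_quotient[OF LK(2) A(1) Q.one_is_normal] assms A(2) by simp
  moreover have "pi_factor \<pi> K L \<longleftrightarrow> pi_number \<pi> (card A)" for \<pi>
    using pi_factor_Union[OF LK(2) normal_imp_subgroup[OF Q.one_is_normal] normal_imp_subgroup[OF A(1)]]
      Q.pi_factor_one[OF normal_imp_subgroup[OF A(1)]] A(2) by simp
  ultimately show ?thesis using that A by blast
qed

text \<open>
  If \<open>p\<close> divides \<open>|N|\<close>, the elements \<open>x\<close> with \<open>x\<^sup>p = 1\<close> form a nontrivial normal subgroup, hence all of
  \<open>N\<close>; by Cauchy's theorem no other prime divides \<open>|N|\<close>.
\<close>

lemma abelian_minimal_normal_p_or_p':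
  assumes N: "chief_factor G N {\<one>}" and comm: "\<forall>x\<in>N. \<forall>y\<in>N. x \<otimes> y = y \<otimes> x" and p: "prime p"
  shows "pi_number {p} (card N) \<or> pi_number (- {p}) (card N)"
proof (cases "p dvd card N")
  case False
  then show ?thesis using pi_number_p'_iff p by blast
next
  case True
  note nN = chief_factor_oneD(1)[OF N]
  note sN = normal_imp_subgroup[OF nN]
  note [simp] = subgroup.mem_carrier[OF sN] subgroup.m_closed[OF sN] subgroup.m_inv_closed[OF sN]
    subgroup.one_closed[OF sN]
  let ?T = "{x \<in> N. x [^] p = \<one>}"
  have "?T \<lhd> G"
  proof (rule normal_invI)
    show "subgroup ?T G"
    proof (rule subgroupI)
      show "?T \<subseteq> carrier G" by auto
      have "\<one> \<in> ?T" by simp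
      then show "?T \<noteq> {}" by blast
      fix x assume x: "x \<in> ?T"
      then show "inv x \<in> ?T" by (simp add: nat_pow_inv)
      fix y assume y: "y \<in> ?T"
      have "x \<otimes> y = y \<otimes> x" using comm x y by auto
      then show "x \<otimes> y \<in> ?T" using x y by (simp add: pow_mult_distrib)
    qed
    fix g x assume g: "g \<in> carrier G" and x: "x \<in> ?T"
    have "(g \<otimes> x \<otimes> inv g) [^] n = g \<otimes> x [^] n \<otimes> inv g" for n :: nat
    proof (induction n)
      case (Suc n)
      then show ?case using g x by (simp add: m_assoc inv_mult_cancel)
    qed (use g in simp)
    then show "g \<otimes> x \<otimes> inv g \<in> ?T" using g x normal.inv_op_closed2[OF nN g] by simp
  qed
  moreover obtain y where "y \<in> N" "y \<noteq> \<one>" "y [^] p = \<one>" using cauchy[OF sN p True] .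
  then have "?T \<noteq> {\<one>}" by blast
  ultimately have T: "?T = N" using chief_factor_oneD(3)[OF N] by blast
  have "q = p" if q: "prime q" "q dvd card N" for q
  proof -
    obtain x where x: "x \<in> N" "x \<noteq> \<one>" "x [^] q = \<one>" using cauchy[OF sN q] .
    moreover have "x [^] p = \<one>" using x T by blast
    ultimately have "ord x dvd q" "ord x dvd p" "ord x \<noteq> 1" using pow_eq_id ord_eq_1 by auto
    then show ?thesis using q p by (metis prime_nat_iff)
  qed
  then show ?thesis using card_subgroup_pos[OF sN] by (auto simp: pi_number_def)
qed

text \<open>
  The class equation: the conjugacy classes of noncentral elements have sizes divisible by \<open>p\<close>.
\<close>

lemma p_group_nontrivial_center:
  assumes sN: "subgroup N G" and p: "prime p" "pi_number {p} (card N)" and "N \<noteq> {\<one>}"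
  obtains z where "z \<in> N" "z \<noteq> \<one>" "\<forall>x\<in>N. x \<otimes> z = z \<otimes> x"
proof (rule ccontr)
  assume "\<not> thesis"
  with that have triv: "z = \<one>" if "z \<in> N" "\<forall>x\<in>N. x \<otimes> z = z \<otimes> x" for z using \<open>\<not> thesis\<close> that by blast
  note [simp] = subgroup.mem_carrier[OF sN] subgroup.m_closed[OF sN] subgroup.m_inv_closed[OF sN]
    subgroup.one_closed[OF sN] m_inv_consistent[OF sN]
  let ?P = "G\<lparr>carrier := N\<rparr>"
  interpret P: finite_group ?P using finite_group_subgroup sN .
  define \<phi> where "\<phi> = (\<lambda>g. \<lambda>h\<in>N. g \<otimes>\<^bsub>?P\<^esub> h \<otimes>\<^bsub>?P\<^esub> inv\<^bsub>?P\<^esub> g)"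
  interpret A: group_action ?P N \<phi> using P.action_by_conjugation by (simp add: \<phi>_def)
  let ?O = "orbits ?P N \<phi>"
  have part: "partition N ?O" by (rule A.orbit_partition)
  have sub: "\<And>b. b \<in> ?O \<Longrightarrow> b \<subseteq> N" using partition.incl[OF part] .
  have un: "\<Union>?O = N" using partition.unique_class[OF part] sub by blast
  have disj: "pairwise disjnt ?O"
    unfolding pairwise_def disjnt_def using partition.unique_class[OF part] sub by blast
  have orb1: "orbit ?P \<phi> \<one> = {\<one>}"
  proof -
    have "\<phi> g \<one> = \<one>" if "g \<in> N" for g using that by (simp add: \<phi>_def)
    then show ?thesis
      using subgroup.one_closed[OF sN] by (auto simp: orbit_def intro!: exI[of _ \<one>])
  qed
  then have one: "{\<one>} \<in> ?O" using subgroup.one_closed[OF sN] by (force simp: orbits_def)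
  have dvd: "p dvd card b" if b: "b \<in> ?O - {{\<one>}}" for b
  proof -
    obtain x where x: "x \<in> N" "b = orbit ?P \<phi> x" using b by (auto simp: orbits_def)
    have "card b * card (stabilizer ?P \<phi> x) = card N"
      using A.orbit_stabilizer_theorem[OF x(1)] x(2) by (simp add: order_def)
    then have pn: "pi_number {p} (card b)" using p(2) pi_number_dvd dvd_triv_left by metis
    have "card b \<noteq> 1"
    proof
      assume "card b = 1"
      then obtain y where y: "b = {y}" by (auto simp: card_1_singleton_iff)
      then have bx: "b = {x}" using A.orbit_refl[OF x(1)] x(2) by auto
      have "g \<otimes> x = x \<otimes> g" if g: "g \<in> N" for g
      proof -
        have "\<phi> g x \<in> b" using g unfolding x(2) orbit_def by auto
        then have "g \<otimes> x \<otimes> inv g = x" using bx g x by (simp add: \<phi>_def)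
        then show ?thesis using g x by (metis inv_solve_right subgroup.mem_carrier[OF sN] m_closed)
      qed
      then have "x = \<one>" using triv[OF x(1)] by blast
      then show False using b bx by blast
    qed
    then show ?thesis using pi_number_p_dvd p(1) pn by blast
  qed
  have finO: "finite ?O" using un finite_subgroup[OF sN] by (metis finite_UnionD)
  have "card N = (\<Sum>b\<in>?O. card b)"
    using card_Union_disjoint[OF disj] sub finite_subgroup[OF sN] un by (metis finite_subset)
  also have "\<dots> = 1 + (\<Sum>b\<in>?O - {{\<one>}}. card b)"
    using sum.remove[OF finO one, of card] by simp
  finally have "card N = 1 + (\<Sum>b\<in>?O - {{\<one>}}. card b)" .
  moreover have "p dvd (\<Sum>b\<in>?O - {{\<one>}}. card b)" using dvd by (rule dvd_sum)
  moreover have "card N \<noteq> 1"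
    using assms(4) subgroup.one_closed[OF sN] by (metis card_1_singletonE singletonD)
  then have "p dvd card N" using pi_number_p_dvd p by blast
  ultimately have "p dvd 1" by (metis dvd_add_left_iff)
  then show False using p(1) by simp
qed

lemma minimal_normal_p_group_abelian:
  assumes N: "chief_factor G N {\<one>}" and p: "prime p" "pi_number {p} (card N)"
  shows "\<forall>x\<in>N. \<forall>y\<in>N. x \<otimes> y = y \<otimes> x"
proof -
  note nN = chief_factor_oneD(1)[OF N]
  note sN = normal_imp_subgroup[OF nN]
  note [simp] = subgroup.mem_carrier[OF sN] subgroup.m_closed[OF sN] subgroup.m_inv_closed[OF sN]
    subgroup.one_closed[OF sN]
  let ?Z = "{z \<in> N. \<forall>x\<in>N. x \<otimes> z = z \<otimes> x}"
  have "?Z \<lhd> G"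
  proof (rule normal_invI)
    show "subgroup ?Z G"
    proof (rule subgroupI)
      show "?Z \<subseteq> carrier G" by auto
      have "\<one> \<in> ?Z" by simp
      then show "?Z \<noteq> {}" by blast
      fix z assume z: "z \<in> ?Z"
      have "x \<otimes> inv z = inv z \<otimes> x" if x: "x \<in> N" for x
      proof -
        have c: "x \<in> carrier G" "z \<in> carrier G" using x z by auto
        have "x \<otimes> inv z = inv z \<otimes> (z \<otimes> x) \<otimes> inv z" using c by (simp add: m_assoc inv_mult_cancel)
        also have "z \<otimes> x = x \<otimes> z" using x z by auto
        finally show ?thesis using c by (simp add: m_assoc)
      qed
      then show "inv z \<in> ?Z" using z by simp
      fix z' assume z': "z' \<in> ?Z"
      have "x \<otimes> (z \<otimes> z') = (z \<otimes> z') \<otimes> x" if x: "x \<in> N" for x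
      proof -
        have c: "x \<in> carrier G" "z \<in> carrier G" "z' \<in> carrier G" using x z z' by auto
        have "x \<otimes> (z \<otimes> z') = (x \<otimes> z) \<otimes> z'" using c by (simp add: m_assoc)
        also have "x \<otimes> z = z \<otimes> x" using x z by auto
        also have "(z \<otimes> x) \<otimes> z' = z \<otimes> (x \<otimes> z')" using c by (simp add: m_assoc)
        also have "x \<otimes> z' = z' \<otimes> x" using x z' by auto
        finally show ?thesis using c by (simp add: m_assoc)
      qed
      moreover have "z \<in> N" "z' \<in> N" using z z' by blast+
      ultimately show "z \<otimes> z' \<in> ?Z" using subgroup.m_closed[OF sN] by blast
    qed
    fix g z assume g: "g \<in> carrier G" and z: "z \<in> ?Z"
    have "x \<otimes> (g \<otimes> z \<otimes> inv g) = (g \<otimes> z \<otimes> inv g) \<otimes> x" if x: "x \<in> N" for x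
    proof -
      have c: "x \<in> carrier G" "z \<in> carrier G" using x z by auto
      have "inv g \<otimes> x \<otimes> g \<in> N" using normal.inv_op_closed1[OF nN g x] .
      then have y: "(inv g \<otimes> x \<otimes> g) \<otimes> z = z \<otimes> (inv g \<otimes> x \<otimes> g)" using z by blast
      have "x \<otimes> (g \<otimes> z \<otimes> inv g) = g \<otimes> ((inv g \<otimes> x \<otimes> g) \<otimes> z) \<otimes> inv g"
        using g c by (simp add: m_assoc inv_mult_cancel)
      also have "\<dots> = (g \<otimes> z \<otimes> inv g) \<otimes> x"
        unfolding y using g c by (simp add: m_assoc inv_mult_cancel)
      finally show ?thesis .
    qed
    then show "g \<otimes> z \<otimes> inv g \<in> ?Z" using z normal.inv_op_closed2[OF nN g] by blast
  qed
  moreover obtain z where "z \<in> N" "z \<noteq> \<one>" "\<forall>x\<in>N. x \<otimes> z = z \<otimes> x"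
    using p_group_nontrivial_center[OF sN p chief_factor_oneD(2)[OF N]] .
  then have "?Z \<noteq> {\<one>}" by blast
  ultimately have "?Z = N" using chief_factor_oneD(3)[OF N] by blast
  then show ?thesis by blast
qed

text \<open>
  The derived subgroup of \<open>N\<close> is normal in \<open>G\<close>, so it is trivial or all of \<open>N\<close>; in the latter case \<open>N\<close>
  would lie in every term of the derived series of \<open>G\<close>.
\<close>

lemma solvable_minimal_normal_abelian:
  assumes "solvable G" and N: "chief_factor G N {\<one>}"
  shows "\<forall>x\<in>N. \<forall>y\<in>N. x \<otimes> y = y \<otimes> x"
proof -
  note nN = chief_factor_oneD(1)[OF N]
  note sN = normal_imp_subgroup[OF nN]
  note Nc = subgroup.mem_carrier[OF sN]
  have "derived G N \<noteq> N"
  proof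
    assume der: "derived G N = N"
    obtain n where n: "(derived G ^^ n) (carrier G) = {\<one>}"
      using assms(1) solvable_iff_trivial_derived_seq by blast
    have "(derived G ^^ n) N = N" by (induction n) (simp_all add: der)
    then have "N \<subseteq> {\<one>}" using mono_exp_of_derived[OF subgroup.subset[OF sN], of n] n by simp
    then show False using chief_factor_oneD(2)[OF N] subgroup.one_closed[OF sN] by blast
  qed
  then have der: "derived G N = {\<one>}"
    using chief_factor_oneD(3)[OF N derived_is_normal[OF nN] derived_incl[OF order_refl sN]] by blast
  show ?thesis
  proof (intro ballI)
    fix x y assume xy: "x \<in> N" "y \<in> N"
    have "x \<otimes> y \<otimes> inv x \<otimes> inv y \<in> derived G N"
      unfolding derived_def by (rule generate.incl) (use xy in blast)
    then have "x \<otimes> y \<otimes> inv x \<otimes> inv y = \<one>" using der by simp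
    then have "(x \<otimes> y \<otimes> inv x \<otimes> inv y) \<otimes> (y \<otimes> x) = y \<otimes> x" using Nc xy by simp
    then show "x \<otimes> y = y \<otimes> x" using Nc[OF xy(1)] Nc[OF xy(2)] by (simp add: m_assoc inv_mult_cancel)
  qed
qed

lemma solvable_quotient:
  assumes "solvable G" "N \<lhd> G"
  shows "solvable (G Mod N)"
proof -
  interpret group_hom G "G Mod N" "\<lambda>x. N #> x"
    using assms(2) normal.factorgroup_is_group normal.r_coset_hom_Mod
    by (auto simp: group_hom_def group_hom_axioms_def)
  show ?thesis
    using solvable_imp_solvable_img[of "carrier G"] assms(1)
    by (simp add: solvable_def carrier_FactGroup)
qed

lemma solvable_imp_p_solvable:
  assumes "prime p" "solvable G"
  shows "p_solvable p G"
  unfolding p_solvable_iff[OF assms(1)]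
proof (intro allI impI)
  fix H K assume HK: "chief_factor G H K"
  then have K: "K \<lhd> G" by (simp add: chief_factor_def)
  interpret Q: finite_group "G Mod K" using finite_group_quotient[OF K] .
  obtain A where A: "chief_factor (G Mod K) A {\<one>\<^bsub>G Mod K\<^esub>}"
    and fac: "\<And>\<pi>. pi_factor \<pi> K H \<longleftrightarrow> pi_number \<pi> (card A)"
    using chief_factor_as_quotient[OF HK] by metis
  show "pi_factor {p} K H \<or> pi_factor (- {p}) K H"
    using Q.abelian_minimal_normal_p_or_p'[OF A
        Q.solvable_minimal_normal_abelian[OF solvable_quotient[OF assms(2) K] A] assms(1)] fac by simp
qed

section \<open>Length conditions as existence of a series\<close>

text \<open>
  Each chief factor is a \<open>p\<close>-group or a \<open>p'\<close>-group and takes up at most one pair of the word.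
\<close>

lemma ex_upper_word_series:
  assumes "prime p" "p_solvable p G" "N \<lhd> G"
  shows "\<exists>n. pi_series G (upper_word p n) N"
  using assms(3)
proof (induction "card (carrier G) - card N" arbitrary: N rule: less_induct)
  case less
  note sN = normal_imp_subgroup[OF less.prems]
  show ?case
  proof (cases "N = carrier G")
    case True
    then have "pi_series G (upper_word p 0) N" by simp
    then show ?thesis by blast
  next
    case False
    then have "N \<subset> carrier G" using subgroup.subset[OF sN] by blast
    then obtain L where L: "chief_factor G L N" using ex_chief_factor[OF less.prems normal_self] by blast
    then have LN: "L \<lhd> G" "N \<subset> L" by (auto simp: chief_factor_def)
    note sL = normal_imp_subgroup[OF LN(1)]
    have "card N < card L" using LN finite_subgroup[OF sL] psubset_card_mono by blast
    moreover have "card L \<le> card (carrier G)" using subgroup.subset[OF sL] card_mono by blast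
    ultimately obtain n where n: "pi_series G (upper_word p n) L"
      using less.hyps[OF _ LN(1)] by (meson diff_less_mono2 less_le_trans)
    \<comment> \<open>One of the two steps is trivial: \<open>M = N\<close> if \<open>L/N\<close> is a \<open>p\<close>-group, \<open>M = L\<close> if it is a \<open>p\'\<close>-group.\<close>
    have "\<exists>M. M \<lhd> G \<and> pi_factor (- {p}) N M \<and> pi_factor {p} M L"
      using assms(1,2) L p_solvable_iff pi_factor_refl[OF sL] pi_factor_refl[OF sN] less.prems LN(1) by blast
    then have "pi_series G ([- {p}, {p}] @ upper_word p n) N" using n LN(1) by auto
    then have "pi_series G (upper_word p (Suc n)) N" by (simp add: upper_word_def)
    then show ?thesis by blast
  qed
qed

lemma pi_series_upper_word_mono:
  assumes "j \<le> k" "pi_series G (upper_word p j) N"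
  shows "pi_series G (upper_word p k) N"
  using pi_series_append[OF assms(2), of "upper_word p (k - j)"] assms(1)
  by (simp flip: upper_word_add)

text \<open>
  For \<open>k = 0\<close> the left side never holds, the \<open>p\<close>-Fitting length being positive, while the right side
  holds for the trivial group.
\<close>

lemma p_Fitting_length_le_iff:
  assumes "prime p" "p_solvable p G" "0 < k"
  shows "p_Fitting_length p G \<le> k \<longleftrightarrow> pi_series G (upper_word p k) {\<one>}"
proof -
  have *: "p_Fitting_series p G n = carrier G \<longleftrightarrow> pi_series G (upper_word p n) {\<one>}" for n
    using p_Fitting_series_eq upper_P_eq_carrier_iff assms(1) by simp
  let ?P = "\<lambda>n. 0 < n \<and> pi_series G (upper_word p n) {\<one>}"
  obtain n where "pi_series G (upper_word p n) {\<one>}"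
    using ex_upper_word_series[OF assms(1,2) one_is_normal] by blast
  then have "?P (Suc n)" using pi_series_upper_word_mono[of n "Suc n"] by simp
  then have "?P (LEAST n. ?P n)" by (rule LeastI)
  then show ?thesis
    unfolding p_Fitting_length_def *
    using pi_series_upper_word_mono[of "LEAST n. ?P n" k] Least_le[of ?P k] assms(3) by blast
qed

text \<open>
  The factor \<open>P\<^bsub>i+1\<^esub>/M\<^sub>i\<close> is trivial only if \<open>M\<^sub>i = G\<close>: otherwise a chief factor of \<open>G\<close> over \<open>M\<^sub>i\<close> is
  either a \<open>p\<close>-group, which lies in \<open>P\<^bsub>i+1\<^esub>\<close>, or a \<open>p'\<close>-group, which contradicts the maximality of
  \<open>M\<^sub>i\<close> over \<open>P\<^sub>i\<close>. So the nontrivial factors are those with \<open>i\<close> less than the first index at which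
  \<open>M\<^sub>i = G\<close>.
\<close>

lemma p_length_le_iff:
  assumes p: "prime p" "p_solvable p G"
  shows "p_length p G \<le> k \<longleftrightarrow> pi_series G (upper_word p k @ [- {p}]) {\<one>}"
proof -
  let ?full = "\<lambda>i. upper_M p G i = carrier G"
  have fullD: "upper_P p G (Suc i) = carrier G" if "?full i" for i
  proof -
    have nP: "upper_P p G i \<lhd> G" using upper_P_normal p(1) .
    have "pi_factor {p} (carrier G) (pi_radical G {p} (carrier G))"
      using pi_radical_factor[OF normal_self] .
    moreover have "pi_radical G {p} (carrier G) \<subseteq> carrier G"
      using subgroup.subset[OF normal_imp_subgroup[OF pi_radical_normal[OF normal_self]]] .
    ultimately show ?thesis using upper_P_Suc[OF p(1) nP] that by (auto simp: pi_factor_def)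
  qed
  have jump: "upper_P p G (Suc i) \<noteq> upper_M p G i \<longleftrightarrow> \<not> ?full i" for i
  proof
    assume "upper_P p G (Suc i) \<noteq> upper_M p G i"
    then show "\<not> ?full i" using fullD by metis
  next
    assume nf: "\<not> ?full i"
    have nP: "upper_P p G i \<lhd> G" using upper_P_normal p(1) .
    define M where "M = upper_M p G i"
    have M: "M = pi_radical G (- {p}) (upper_P p G i)" "upper_P p G (Suc i) = pi_radical G {p} M"
      using upper_P_Suc[OF p(1) nP] by (simp_all add: M_def)
    have nM: "M \<lhd> G" using pi_radical_normal[OF nP] M by simp
    have "M \<subset> carrier G" using nf subgroup.subset[OF normal_imp_subgroup[OF nM]] by (auto simp: M_def)
    then obtain L where L: "chief_factor G L M" using ex_chief_factor[OF nM normal_self] by blast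
    then have LM: "L \<lhd> G" "M \<subset> L" by (auto simp: chief_factor_def)
    have "\<not> pi_factor (- {p}) M L"
    proof
      assume "pi_factor (- {p}) M L"
      moreover have "pi_factor (- {p}) (upper_P p G i) M" using pi_radical_factor[OF nP] M by simp
      ultimately have "pi_factor (- {p}) (upper_P p G i) L"
        using pi_factor_trans[OF normal_imp_subgroup[OF nP] normal_imp_subgroup[OF nM] normal_imp_subgroup[OF LM(1)]] by blast
      then have "L \<subseteq> M" using pi_radical_greatest[OF nP LM(1)] M by simp
      then show False using LM by blast
    qed
    then have "pi_factor {p} M L" using p L p_solvable_iff by blast
    then have "L \<subseteq> upper_P p G (Suc i)" using pi_radical_greatest[OF nM LM(1)] M by simp
    then show "upper_P p G (Suc i) \<noteq> upper_M p G i" using LM by (auto simp: M_def)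
  qed
  have full_iff: "?full i \<longleftrightarrow> pi_series G (upper_word p i @ [- {p}]) {\<one>}" for i
    using upper_M_eq_carrier_iff[OF p(1)] .
  have full_Suc: "?full (Suc i)" if "?full i" for i
  proof -
    have "pi_series G ((upper_word p i @ [- {p}]) @ [{p}, - {p}]) {\<one>}"
      using that pi_series_append full_iff by blast
    then show ?thesis unfolding full_iff by (simp add: upper_word_Suc)
  qed
  have full_mono: "?full k" if "?full j" "j \<le> k" for j k
    using that(2) by (induction k rule: dec_induct) (use that(1) full_Suc in auto)
  obtain n where "pi_series G (upper_word p n) {\<one>}"
    using ex_upper_word_series[OF p one_is_normal] by blast
  then have ex: "?full n" unfolding full_iff by (rule pi_series_append)
  define m where "m = (LEAST n. ?full n)"
  have "?full m" unfolding m_def using ex by (rule LeastI)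
  then have iff: "?full j \<longleftrightarrow> m \<le> j" for j
    using full_mono[of m j] Least_le[of ?full j] by (auto simp: m_def)
  then have "{i. upper_P p G (Suc i) \<noteq> upper_M p G i} = {..<m}" using jump by auto
  then have "p_length p G = m" by (simp add: p_length_def)
  then show ?thesis using iff full_iff by simp
qed

end

section \<open>Removing a bottom p-factor without proper supplements\<close>

lemma coprime_pi_numbers:
  assumes "pi_number \<pi> a" "pi_number (- \<pi>) b"
  shows "coprime a b"
proof (rule ccontr)
  assume "\<not> coprime a b"
  then obtain q where "prime q" "q dvd gcd a b"
    using prime_factor_nat coprime_iff_gcd_eq_1 by blast
  then show False using assms by (auto simp: pi_number_def)
qed

lemma (in group) mem_normalizer_iff:
  assumes "finite H" "H \<subseteq> carrier G"
  shows "g \<in> normalizer G H \<longleftrightarrow> g \<in> carrier G \<and> (\<forall>h\<in>H. g \<otimes> h \<otimes> inv g \<in> H)"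
proof -
  have *: "g <# H #> inv g = (\<lambda>h. g \<otimes> h \<otimes> inv g) ` H" for g
    by (auto simp: l_coset_def r_coset_def)
  have "(\<lambda>h. g \<otimes> h \<otimes> inv g) ` H = H \<longleftrightarrow> (\<forall>h\<in>H. g \<otimes> h \<otimes> inv g \<in> H)" if "g \<in> carrier G" for g
  proof -
    have "inj_on (\<lambda>h. g \<otimes> h \<otimes> inv g) H"
      using conjugation_is_inj[OF that] assms(2) by (auto intro!: inj_onI)
    then have "(\<lambda>h. g \<otimes> h \<otimes> inv g) ` H = H" if "(\<lambda>h. g \<otimes> h \<otimes> inv g) ` H \<subseteq> H"
      using endo_inj_surj[OF assms(1) that] by simp
    then show ?thesis unfolding image_subset_iff by blast
  qed
  then show ?thesis using assms(2) by (auto simp: normalizer_def stabilizer_def *)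
qed

context finite_group
begin

lemma conj_hom: "g \<in> carrier G \<Longrightarrow> group_hom G G (\<lambda>x. g \<otimes> x \<otimes> inv g)"
  unfolding group_hom_def group_hom_axioms_def hom_def
  using is_group by (auto simp: m_assoc inv_mult_cancel)

lemma pi_series_extend_down:
  assumes "subgroup N G" "L \<lhd> G" "pi_factor \<pi> N L" "pi_series G (\<pi> # w) L"
  shows "pi_series G (\<pi> # w) N"
proof -
  obtain M where M: "M \<lhd> G" "pi_factor \<pi> L M" "pi_series G w M" using assms(4) by auto
  have "pi_factor \<pi> N M"
    using pi_factor_trans[OF assms(1) normal_imp_subgroup[OF assms(2)] normal_imp_subgroup[OF M(1)]
        assms(3) M(2)] .
  then show ?thesis using M by auto
qed

text \<open>
  The form in which the theorem on complements is applied: the last clause says that the normaliser of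
  the complement supplements \<open>L\<close>.
\<close>

lemma abelian_Hall_complement:
  assumes L: "L \<lhd> G" and M: "M \<lhd> G" and comm: "\<forall>x\<in>L. \<forall>y\<in>L. x \<otimes> y = y \<otimes> x"
    and pL: "pi_number \<pi> (card L)" and pM: "pi_factor (- \<pi>) L M"
  obtains Q where "subgroup Q G" "Q \<subseteq> M" "pi_number (- \<pi>) (card Q)" "pi_factor \<pi> Q M"
    and "\<forall>g\<in>carrier G. \<exists>l\<in>L. l \<otimes> g \<in> normalizer G Q"
proof -
  note sL = normal_imp_subgroup[OF L]
  have LM: "L \<subseteq> M" and idx: "pi_number (- \<pi>) (card M div card L)" using pM by (auto simp: pi_factor_def)
  obtain Q where Q: "subgroup Q G" "Q \<subseteq> M" "L \<inter> Q = {\<one>}" "L <#> Q = M"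
    and conj: "\<forall>g\<in>carrier G. \<exists>l\<in>L. \<forall>q\<in>Q. (l \<otimes> g) \<otimes> q \<otimes> inv (l \<otimes> g) \<in> Q"
    using schur_zassenhaus_abelian[OF L M LM comm coprime_pi_numbers[OF pL idx]] .
  have "card M = card L * card Q" using card_normal_set_mult[OF L Q(1)] Q by simp
  then have "card M div card L = card Q" "card M div card Q = card L"
    using card_subgroup_pos[OF sL] card_subgroup_pos[OF Q(1)] by auto
  then have "pi_number (- \<pi>) (card Q)" "pi_factor \<pi> Q M" using idx pL Q(2) by (simp_all add: pi_factor_def)
  moreover have "\<exists>l\<in>L. l \<otimes> g \<in> normalizer G Q" if g: "g \<in> carrier G" for g
  proof -
    obtain l where l: "l \<in> L" "\<forall>q\<in>Q. (l \<otimes> g) \<otimes> q \<otimes> inv (l \<otimes> g) \<in> Q" using conj g by blast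
    moreover have "l \<otimes> g \<in> carrier G" using l(1) g subgroup.mem_carrier[OF sL] by simp
    ultimately show ?thesis
      using mem_normalizer_iff[OF finite_subgroup[OF Q(1)] subgroup.subset[OF Q(1)]] by blast
  qed
  ultimately show ?thesis using that Q by blast
qed

lemma normal_if_normalizer:
  assumes "subgroup Q G" "carrier G \<subseteq> normalizer G Q"
  shows "Q \<lhd> G"
proof (rule normal_invI[OF assms(1)])
  fix g h assume "g \<in> carrier G" "h \<in> Q"
  then show "g \<otimes> h \<otimes> inv g \<in> Q"
    using assms(2) mem_normalizer_iff[OF finite_subgroup[OF assms(1)] subgroup.subset[OF assms(1)], of g]
    by blast
qed

text \<open>
  Let \<open>M\<close> and \<open>M'\<close> be the first two terms above \<open>L\<close>. A complement \<open>Q\<close> of \<open>L\<close> in \<open>M\<close> is normal in \<open>G\<close>, as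
  its normaliser supplements \<open>L\<close>. So \<open>1 \<le> Q \<le> M'\<close> replaces \<open>L \<le> M \<le> M'\<close>: the factor \<open>L\<close>, which is
  isomorphic to \<open>M/Q\<close>, moves up into the second step.
\<close>

lemma pi_series_Frattini:
  assumes L: "L \<lhd> G" and comm: "\<forall>x\<in>L. \<forall>y\<in>L. x \<otimes> y = y \<otimes> x" and pL: "pi_number \<pi> (card L)"
    and Frattini: "\<And>T. subgroup T G \<Longrightarrow> L <#> T = carrier G \<Longrightarrow> T = carrier G"
    and series: "pi_series G (- \<pi> # \<pi> # w) L"
  shows "pi_series G (- \<pi> # \<pi> # w) {\<one>}"
proof -
  note sL = normal_imp_subgroup[OF L]
  obtain M M' where M: "M \<lhd> G" "pi_factor (- \<pi>) L M" and M': "M' \<lhd> G" "pi_factor \<pi> M M'" "pi_series G w M'"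
    using series by auto
  obtain Q where Q: "subgroup Q G" "Q \<subseteq> M" "pi_number (- \<pi>) (card Q)" "pi_factor \<pi> Q M"
    and conj: "\<forall>g\<in>carrier G. \<exists>l\<in>L. l \<otimes> g \<in> normalizer G Q"
    using abelian_Hall_complement[OF L M(1) comm pL M(2)] .
  have sN: "subgroup (normalizer G Q) G" using normalizer_imp_subgroup[OF subgroup.subset[OF Q(1)]] .
  have "carrier G \<subseteq> L <#> normalizer G Q"
  proof
    fix g assume g: "g \<in> carrier G"
    then obtain l where l: "l \<in> L" "l \<otimes> g \<in> normalizer G Q" using conj by blast
    have "g = inv l \<otimes> (l \<otimes> g)" using g subgroup.mem_carrier[OF sL l(1)] by (simp add: inv_mult_cancel)
    then show "g \<in> L <#> normalizer G Q"
      unfolding set_mult_def using l subgroup.m_inv_closed[OF sL l(1)] by blast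
  qed
  moreover have "L <#> normalizer G Q \<subseteq> carrier G"
    using set_mult_least[OF subgroup_self subgroup.subset[OF sL] subgroup.subset[OF sN]] .
  ultimately have "normalizer G Q = carrier G" using Frattini[OF sN] by blast
  then have nQ: "Q \<lhd> G" using normal_if_normalizer[OF Q(1)] by simp
  have "pi_factor \<pi> Q M'"
    using pi_factor_trans[OF Q(1) normal_imp_subgroup[OF M(1)] normal_imp_subgroup[OF M'(1)] Q(4) M'(2)] .
  moreover have "pi_factor (- \<pi>) {\<one>} Q" using pi_factor_one[OF Q(1)] Q(3) by simp
  ultimately show ?thesis using nQ M' by auto
qed

section \<open>Supersolvable and p-supersolvable groups have p-length at most one\<close>

lemma prime_card_subgroup_powers:
  assumes L: "subgroup L G" and p: "prime (card L)" and l: "l \<in> L" "l \<noteq> \<one>" and x: "x \<in> L"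
  obtains i :: nat where "x = l [^] i"
proof -
  have lc: "l \<in> carrier G" using subgroup.mem_carrier[OF L l(1)] .
  have "ord l dvd card L" using pow_card_eq_1[OF L l(1)] pow_eq_id[OF lc] by simp
  moreover have "ord l \<noteq> 1" using ord_eq_1[OF lc] l by simp
  ultimately have o: "ord l = card L" using p by (metis prime_nat_iff)
  have pos: "0 < card L" using card_subgroup_pos[OF L] .
  have "(\<lambda>i. l [^] i) ` {0..ord l - 1} \<subseteq> L"
    using monoid.nat_pow_closed[OF group.is_monoid[OF subgroup_imp_group[OF L]], of l] l
    by (auto simp: nat_pow_consistent[symmetric])
  moreover have "card ((\<lambda>i. l [^] i) ` {0..ord l - 1}) = card L"
    using card_image[OF ord_inj[OF lc]] o pos by simp
  ultimately have "(\<lambda>i. l [^] i) ` {0..ord l - 1} = L"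
    using card_subset_eq[OF finite_subgroup[OF L]] by blast
  then show ?thesis using that x by blast
qed

text \<open>
  Let \<open>p = |L|\<close>. Conjugation by \<open>x\<close> maps a generator \<open>l\<close> of \<open>L\<close> to some \<open>l\<^sup>a\<close>, so conjugation by \<open>x\<^sup>p\<close> maps
  it to the power of \<open>l\<close> with exponent \<open>a\<^sup>p\<close>. This is again \<open>l\<^sup>a\<close>, by Fermat's little theorem.
\<close>

lemma centralizes_if_power_centralizes:
  assumes L: "L \<lhd> G" and p: "prime (card L)" and x: "x \<in> carrier G"
    and power: "\<forall>l\<in>L. x [^] card L \<otimes> l = l \<otimes> x [^] card L" and l: "l \<in> L"
  shows "x \<otimes> l = l \<otimes> x"
proof (cases "l = \<one>")
  case False
  note sL = normal_imp_subgroup[OF L]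
  let ?p = "card L"
  have lc: "l \<in> carrier G" using subgroup.mem_carrier[OF sL l] .
  interpret cx: group_hom G G "\<lambda>y. x \<otimes> y \<otimes> inv x" using conj_hom[OF x] .
  obtain a where a: "x \<otimes> l \<otimes> inv x = l [^] (a::nat)"
    using prime_card_subgroup_powers[OF sL p l False normal.inv_op_closed2[OF L x l]] .
  have iter: "x [^] n \<otimes> l \<otimes> inv (x [^] n) = l [^] (a ^ n)" for n :: nat
  proof (induction n)
    case (Suc n)
    have "x [^] Suc n = x \<otimes> x [^] n" using nat_pow_Suc2[OF x] .
    then have "x [^] Suc n \<otimes> l \<otimes> inv (x [^] Suc n) = x \<otimes> (x [^] n \<otimes> l \<otimes> inv (x [^] n)) \<otimes> inv x"
      using x lc by (simp add: m_assoc inv_mult_group)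
    also have "\<dots> = (x \<otimes> l \<otimes> inv x) [^] (a ^ n)" unfolding Suc using cx.hom_nat_pow[OF lc] .
    also have "\<dots> = l [^] (a ^ Suc n)" unfolding a using lc by (simp add: nat_pow_pow)
    finally show ?case .
  qed (use lc in simp)
  have red: "l [^] n = l [^] (n mod ?p)" for n
  proof -
    have "l [^] n = l [^] (?p * (n div ?p) + n mod ?p)" by simp
    also have "\<dots> = (l [^] ?p) [^] (n div ?p) \<otimes> l [^] (n mod ?p)"
      using lc by (simp only: nat_pow_mult[symmetric] nat_pow_pow)
    finally show ?thesis using pow_card_eq_1[OF sL l] lc by simp
  qed
  have "a ^ ?p mod ?p = a mod ?p"
  proof (cases "?p dvd a")
    case True
    moreover have "?p dvd a ^ ?p"
      using dvd_trans[OF True dvd_power] p prime_gt_0_nat by blast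
    ultimately show ?thesis by simp
  next
    case False
    have "a ^ (?p - 1) mod ?p = 1 mod ?p" using fermat_theorem[OF p False] by (simp add: cong_def)
    then have "(a * a ^ (?p - 1)) mod ?p = (a * 1) mod ?p" by (metis mod_mult_right_eq)
    moreover have "a * a ^ (?p - 1) = a ^ ?p" using p by (metis power_eq_if prime_gt_0_nat not_gr_zero)
    ultimately show ?thesis by simp
  qed
  then have "l [^] (a ^ ?p) = l [^] a" using red[of "a ^ ?p"] red[of a] by simp
  then have "x \<otimes> l \<otimes> inv x = x [^] ?p \<otimes> l \<otimes> inv (x [^] ?p)" using iter a by simp
  also have "\<dots> = l" using power l x lc by (simp add: m_assoc)
  finally have "x \<otimes> l \<otimes> inv x \<otimes> x = l \<otimes> x" by simp
  then show ?thesis using x lc by (simp add: m_assoc)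
qed (use x in simp)

lemma centralizer_normal:
  assumes L: "L \<lhd> G"
  shows "{x \<in> carrier G. \<forall>l\<in>L. x \<otimes> l = l \<otimes> x} \<lhd> G" (is "?C \<lhd> G")
proof (rule normal_invI)
  note Lc = subgroup.mem_carrier[OF normal_imp_subgroup[OF L]]
  show "subgroup ?C G"
  proof (rule subgroupI)
    show "?C \<subseteq> carrier G" by auto
    have "\<one> \<in> ?C" using Lc by simp
    then show "?C \<noteq> {}" by blast
    fix x assume x: "x \<in> ?C"
    have "inv x \<otimes> l = l \<otimes> inv x" if l: "l \<in> L" for l
    proof -
      have c: "x \<in> carrier G" "l \<in> carrier G" using x l Lc by auto
      have "inv x \<otimes> l = inv x \<otimes> (l \<otimes> x) \<otimes> inv x" using c by (simp add: m_assoc)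
      also have "l \<otimes> x = x \<otimes> l" using x l by auto
      finally show ?thesis using c by (simp add: m_assoc inv_mult_cancel)
    qed
    then show "inv x \<in> ?C" using x by blast
    fix y assume y: "y \<in> ?C"
    have "x \<otimes> y \<otimes> l = l \<otimes> (x \<otimes> y)" if l: "l \<in> L" for l
    proof -
      have c: "x \<in> carrier G" "y \<in> carrier G" "l \<in> carrier G" using x y l Lc by auto
      have "x \<otimes> y \<otimes> l = x \<otimes> (y \<otimes> l)" using c by (simp add: m_assoc)
      also have "y \<otimes> l = l \<otimes> y" using y l by auto
      also have "x \<otimes> (l \<otimes> y) = (x \<otimes> l) \<otimes> y" using c by (simp add: m_assoc)
      also have "x \<otimes> l = l \<otimes> x" using x l by auto
      finally show ?thesis using c by (simp add: m_assoc)
    qed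
    then show "x \<otimes> y \<in> ?C" using x y by blast
  qed
  fix g x assume g: "g \<in> carrier G" and x: "x \<in> ?C"
  have "g \<otimes> x \<otimes> inv g \<otimes> l = l \<otimes> (g \<otimes> x \<otimes> inv g)" if l: "l \<in> L" for l
  proof -
    have c: "x \<in> carrier G" "l \<in> carrier G" using x l Lc by auto
    have y: "x \<otimes> (inv g \<otimes> l \<otimes> g) = (inv g \<otimes> l \<otimes> g) \<otimes> x"
      using x normal.inv_op_closed1[OF L g l] by blast
    have "g \<otimes> x \<otimes> inv g \<otimes> l = g \<otimes> (x \<otimes> (inv g \<otimes> l \<otimes> g)) \<otimes> inv g"
      using g c by (simp add: m_assoc inv_mult_cancel)
    also have "\<dots> = l \<otimes> (g \<otimes> x \<otimes> inv g)"
      unfolding y using g c by (simp add: m_assoc inv_mult_cancel)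
    finally show ?thesis .
  qed
  then show "g \<otimes> x \<otimes> inv g \<in> ?C" using g x by blast
qed

text \<open>
  An element \<open>x\<close> for which \<open>x\<^sup>p\<close> centralises \<open>L\<close>, where \<open>p = |L|\<close>, centralises \<open>L\<close> itself; so \<open>G/C\<^sub>G(L)\<close> has
  no element of order \<open>p\<close>, and Cauchy's theorem applies.
\<close>

lemma prime_order_centralizer_index:
  assumes L: "L \<lhd> G" and p: "prime (card L)"
  shows "pi_factor (- {card L}) {x \<in> carrier G. \<forall>l\<in>L. x \<otimes> l = l \<otimes> x} (carrier G)" (is "pi_factor _ ?C _")
proof -
  note nC = centralizer_normal[OF L]
  interpret Q: finite_group "G Mod ?C" using finite_group_quotient[OF nC] .
  have "\<not> card L dvd card (carrier (G Mod ?C))"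
  proof
    assume "card L dvd card (carrier (G Mod ?C))"
    then obtain Y where Y: "Y \<in> carrier (G Mod ?C)" "Y \<noteq> \<one>\<^bsub>G Mod ?C\<^esub>" "Y [^]\<^bsub>G Mod ?C\<^esub> card L = \<one>\<^bsub>G Mod ?C\<^esub>"
      using Q.cauchy[OF Q.subgroup_self p] by blast
    obtain x where x: "x \<in> carrier G" "Y = ?C #> x" using Y(1) by (auto simp: carrier_FactGroup)
    have "?C #> (x [^] card L) = ?C" using Y(3) normal.FactGroup_pow[OF nC x(1)] x(2) by simp
    then have "x [^] card L \<in> ?C"
      using rcos_self[OF nat_pow_closed[OF x(1)] normal_imp_subgroup[OF nC], of "card L"] by simp
    then have "\<forall>l\<in>L. x \<otimes> l = l \<otimes> x" using centralizes_if_power_centralizes[OF L p x(1)] by blast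
    then have "x \<in> ?C" using x by blast
    then have "Y = ?C" using x(2) subgroup.rcos_const[OF normal_imp_subgroup[OF nC] is_group] by blast
    then show False using Y(2) by simp
  qed
  then have "pi_number (- {card L}) (card (carrier (G Mod ?C)))" using pi_number_p'_iff[OF p] by simp
  moreover have "card (carrier G) div card ?C = card (carrier (G Mod ?C))"
    unfolding card_quotient[OF nC, symmetric]
    using card_subgroup_pos[OF normal_imp_subgroup[OF nC]] by simp
  moreover have "?C \<subseteq> carrier G" by blast
  ultimately show ?thesis unfolding pi_factor_def by simp
qed

text \<open>
  Let \<open>M\<close> and \<open>M'\<close> be the two middle terms of the series above \<open>L\<close>, and \<open>C = C\<^sub>G(L)\<close>, a normal subgroup
  of \<open>p'\<close>-index. In \<open>M \<inter> C\<close> the subgroup \<open>L\<close> is central, so its complement \<open>Q\<close> is not moved by \<open>L\<close> and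
  hence is normal in \<open>G\<close>. The new series is \<open>1 \<le> Q \<le> M' \<inter> C \<le> G\<close>.
\<close>

lemma pi_series_prime_order:
  assumes L: "L \<lhd> G" and p: "prime p" "card L = p" and series: "pi_series G [- {p}, {p}, - {p}] L"
  shows "pi_series G [- {p}, {p}, - {p}] {\<one>}"
proof -
  note sL = normal_imp_subgroup[OF L]
  let ?C = "{x \<in> carrier G. \<forall>l\<in>L. x \<otimes> l = l \<otimes> x}"
  note nC = centralizer_normal[OF L]
  note sC = normal_imp_subgroup[OF nC]
  have pL: "prime (card L)" using p by simp
  have comm: "\<forall>x\<in>L. \<forall>y\<in>L. x \<otimes> y = y \<otimes> x"
  proof (intro ballI)
    fix x y assume xy: "x \<in> L" "y \<in> L"
    have c: "x \<in> carrier G" "y \<in> carrier G" using xy subgroup.mem_carrier[OF sL] by auto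
    show "x \<otimes> y = y \<otimes> x"
    proof (cases "x = \<one>")
      case False
      obtain i :: nat where i: "y = x [^] i" using prime_card_subgroup_powers[OF sL pL xy(1) False xy(2)] .
      show ?thesis unfolding i using c nat_pow_comm[of x 1 i] by simp
    qed (use c in simp)
  qed
  obtain M M' where M: "M \<lhd> G" "pi_factor (- {p}) L M" and M': "M' \<lhd> G" "pi_factor {p} M M'"
    "pi_factor (- {p}) M' (carrier G)"
    using series by auto
  note sM = normal_imp_subgroup[OF M(1)] and sM' = normal_imp_subgroup[OF M'(1)]
  have nMC: "M \<inter> ?C \<lhd> G" and nM'C: "M' \<inter> ?C \<lhd> G"
    using normal_subgroup_intersect[OF M(1) nC] normal_subgroup_intersect[OF M'(1) nC] .
  have LC: "L \<inter> ?C = L" using comm subgroup.subset[OF sL] by blast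
  have pM: "pi_factor (- {p}) L (M \<inter> ?C)" using pi_factor_Int[OF sL sM M(2) nC] LC by simp
  have pnL: "pi_number {p} (card L)"
    unfolding pi_number_p_iff[OF p(1)] using p(2) by (intro exI[of _ 1]) simp
  obtain Q where Q: "subgroup Q G" "Q \<subseteq> M \<inter> ?C" "pi_number (- {p}) (card Q)" "pi_factor {p} Q (M \<inter> ?C)"
    and conj: "\<forall>g\<in>carrier G. \<exists>l\<in>L. l \<otimes> g \<in> normalizer G Q"
    using abelian_Hall_complement[OF L nMC comm pnL pM] .
  note norm_iff = mem_normalizer_iff[OF finite_subgroup[OF Q(1)] subgroup.subset[OF Q(1)]]
  have sN: "subgroup (normalizer G Q) G" using normalizer_imp_subgroup[OF subgroup.subset[OF Q(1)]] .
  have "L \<subseteq> normalizer G Q"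
  proof
    fix l assume l: "l \<in> L"
    have lc: "l \<in> carrier G" using subgroup.mem_carrier[OF sL l] .
    have "l \<otimes> q \<otimes> inv l \<in> Q" if q: "q \<in> Q" for q
    proof -
      have qc: "q \<in> carrier G" "q \<otimes> l = l \<otimes> q" using q Q(2) l by auto
      have "l \<otimes> q \<otimes> inv l = q" unfolding qc(2)[symmetric] using qc(1) lc by (simp add: m_assoc)
      then show ?thesis using q by simp
    qed
    then show "l \<in> normalizer G Q" using norm_iff lc by blast
  qed
  have "carrier G \<subseteq> normalizer G Q"
  proof
    fix g assume g: "g \<in> carrier G"
    then obtain l where l: "l \<in> L" "l \<otimes> g \<in> normalizer G Q" using conj by blast
    have "inv l \<otimes> (l \<otimes> g) \<in> normalizer G Q"
      using subgroup.m_closed[OF sN subgroup.m_inv_closed[OF sN] l(2)] \<open>L \<subseteq> normalizer G Q\<close> l(1) by blast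
    then show "g \<in> normalizer G Q" using g subgroup.mem_carrier[OF sL l(1)] by (simp add: inv_mult_cancel)
  qed
  then have nQ: "Q \<lhd> G" using normal_if_normalizer[OF Q(1)] by simp
  have 1: "pi_factor (- {p}) {\<one>} Q" using pi_factor_one[OF Q(1)] Q(3) by simp
  have 2: "pi_factor {p} Q (M' \<inter> ?C)"
    using pi_factor_trans[OF Q(1) normal_imp_subgroup[OF nMC] normal_imp_subgroup[OF nM'C] Q(4)]
      pi_factor_Int[OF sM sM' M'(2) nC] by blast
  have "carrier G \<inter> ?C = ?C" by blast
  then have "pi_factor (- {p}) (M' \<inter> ?C) ?C" using pi_factor_Int[OF sM' subgroup_self M'(3) nC] by metis
  then have 3: "pi_factor (- {p}) (M' \<inter> ?C) (carrier G)"
    using pi_factor_trans[OF normal_imp_subgroup[OF nM'C] sC subgroup_self] prime_order_centralizer_index[OF L pL] p(2) by blast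
  show ?thesis using 1 2 3 nQ nM'C normal_self by auto
qed

lemma pi_series_prime_index:
  assumes "N \<lhd> G" "L \<lhd> G" "N \<subseteq> L" "prime p" "card L div card N = p"
    and "pi_series G [- {p}, {p}, - {p}] L"
  shows "pi_series G [- {p}, {p}, - {p}] N"
proof -
  interpret Q: finite_group "G Mod N" using finite_group_quotient[OF assms(1)] .
  obtain A where A: "A \<lhd> G Mod N" "L = \<Union>A" using quotient_normalE[OF assms(1-3)] .
  have "card A = p"
    using card_Union[OF assms(1) normal_imp_subgroup[OF A(1)]] A(2) assms(5)
      card_subgroup_pos[OF normal_imp_subgroup[OF assms(1)]] by simp
  moreover have "pi_series (G Mod N) [- {p}, {p}, - {p}] A"
    using pi_series_quotient[OF assms(1) A(1)] assms(6) A(2) by blast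
  ultimately show ?thesis
    using Q.pi_series_prime_order[OF A(1) assms(4)] pi_series_quotient_one[OF assms(1)] by blast
qed

lemma p_supersolvable_imp_pi_series:
  assumes "prime p" "p_supersolvable p G" "N \<lhd> G"
  shows "pi_series G [- {p}, {p}, - {p}] N"
  using assms(3)
proof (induction "card (carrier G) - card N" arbitrary: N rule: less_induct)
  case less
  note sN = normal_imp_subgroup[OF less.prems]
  show ?case
  proof (cases "N = carrier G")
    case True
    then show ?thesis using pi_series_carrier by metis
  next
    case False
    then have "N \<subset> carrier G" using subgroup.subset[OF sN] by blast
    then obtain L where L: "chief_factor G L N" using ex_chief_factor[OF less.prems normal_self] by blast
    then have LN: "L \<lhd> G" "N \<subset> L" by (auto simp: chief_factor_def)
    note sL = normal_imp_subgroup[OF LN(1)]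
    have "card N < card L" using LN finite_subgroup[OF sL] psubset_card_mono by blast
    moreover have "card L \<le> card (carrier G)" using subgroup.subset[OF sL] card_mono by blast
    ultimately have IH: "pi_series G [- {p}, {p}, - {p}] L"
      using less.hyps[OF _ LN(1)] by (meson diff_less_mono2 less_le_trans)
    have "card L div card N = p \<or> pi_factor (- {p}) N L"
      using p_supersolvable_iff[OF assms(1)] assms(2) L by blast
    then show ?thesis
      using pi_series_prime_index[OF less.prems LN(1) _ assms(1) _ IH] LN(2)
        pi_series_extend_down[OF sN LN(1) _ IH] by blast
  qed
qed

text \<open>
  An element of \<open>G\<close> acts on the cyclic group \<open>A\<close> by raising all elements to the same power.
\<close>

lemma subgroup_of_cyclic_normal:
  assumes A: "A \<lhd> G" and cyc: "cyclic_group (G\<lparr>carrier := A\<rparr>)" and L: "subgroup L G" "L \<subseteq> A"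
  shows "L \<lhd> G"
proof (rule normal_invI[OF L(1)])
  note sA = normal_imp_subgroup[OF A]
  interpret A: group "G\<lparr>carrier := A\<rparr>" using subgroup_imp_group[OF sA] .
  obtain a where a: "a \<in> A" "A = range (\<lambda>n::int. a [^]\<^bsub>G\<lparr>carrier := A\<rparr>\<^esub> n)"
    using cyc unfolding A.cyclic_group by auto
  have powers: "\<exists>n::int. x = a [^] n" if "x \<in> A" for x
    using that a int_pow_consistent[OF sA a(1)] by (metis rangeE)
  have ac: "a \<in> carrier G" using subgroup.mem_carrier[OF sA a(1)] .
  fix g x assume g: "g \<in> carrier G" and x: "x \<in> L"
  interpret cg: group_hom G G "\<lambda>y. g \<otimes> y \<otimes> inv g" using conj_hom[OF g] .
  obtain n :: int where n: "x = a [^] n" using powers x L(2) by blast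
  obtain k :: int where k: "g \<otimes> a \<otimes> inv g = a [^] k" using powers[OF normal.inv_op_closed2[OF A g a(1)]] by blast
  have "g \<otimes> x \<otimes> inv g = x [^] k"
    unfolding n using cg.hom_int_pow[OF ac, of n] k ac by (simp add: int_pow_pow mult.commute)
  then show "g \<otimes> x \<otimes> inv g \<in> L" using subgroup_int_pow_closed[OF L(1) x] by simp
qed

text \<open>
  All subgroups of \<open>A/N\<close> are normal in \<open>G/N\<close>. So one descends from \<open>A\<close> to \<open>N\<close> in steps of prime index; steps
  of index \<open>p\<close> are covered by the preceding lemmas, the others are absorbed by the bottom
  \<open>p'\<close>-factor.
\<close>

lemma pi_series_cyclic_section:
  assumes p: "prime p" and N: "N \<lhd> G" and A: "A \<lhd> G" "N \<subseteq> A"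
    and cyc: "cyclic_group (G\<lparr>carrier := A\<rparr> Mod N)"
    and series: "pi_series G [- {p}, {p}, - {p}] A"
  shows "pi_series G [- {p}, {p}, - {p}] N"
proof -
  interpret Q: finite_group "G Mod N" using finite_group_quotient[OF N] .
  obtain A' where A': "A' \<lhd> G Mod N" "A = \<Union>A'" using quotient_normalE[OF N A] .
  note sA' = normal_imp_subgroup[OF A'(1)]
  have "(<#>\<^bsub>G\<lparr>carrier := A\<rparr>\<^esub>) = (<#>)" by (intro ext) simp
  then have "G\<lparr>carrier := A\<rparr> Mod N = (G Mod N)\<lparr>carrier := A'\<rparr>"
    using normal.factgroup_subgroup_union_factor[OF N sA'] A'(2) by (simp add: FactGroup_def)
  then have cyc': "cyclic_group ((G Mod N)\<lparr>carrier := A'\<rparr>)" using cyc by simp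
  have "pi_series (G Mod N) [- {p}, {p}, - {p}] B" if "B \<lhd> G Mod N" "B \<subseteq> A'" for B
    using that
  proof (induction "card A' - card B" arbitrary: B rule: less_induct)
    case less
    note sB = normal_imp_subgroup[OF less.prems(1)]
    show ?case
    proof (cases "B = A'")
      case True
      then show ?thesis using pi_series_quotient[OF N A'(1)] series A'(2) by blast
    next
      case False
      interpret R: finite_group "G Mod N Mod B" using Q.finite_group_quotient[OF less.prems(1)] .
      obtain D where D: "D \<lhd> G Mod N Mod B" "A' = \<Union>D"
        using Q.quotient_normalE[OF less.prems(1) A'(1) less.prems(2)] .
      have "card D \<noteq> 1"
        using Q.card_Union[OF less.prems(1) normal_imp_subgroup[OF D(1)]] False less.prems(2) D(2)
          card_subset_eq[OF Q.finite_subgroup[OF sA'] less.prems(2)] by auto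
      then obtain q where q: "prime q" "q dvd card D" using prime_factor_nat by blast
      obtain H where H: "subgroup H (G Mod N Mod B)" "H \<subseteq> D" "card H = q"
        using R.ex_subgroup_prime_card[OF normal_imp_subgroup[OF D(1)] q] .
      let ?L = "\<Union>H"
      have sL: "subgroup ?L (G Mod N)" using Q.subgroup_Union[OF less.prems(1) H(1)] .
      have LA: "?L \<subseteq> A'" using H(2) D(2) by blast
      have nL: "?L \<lhd> G Mod N" using Q.subgroup_of_cyclic_normal[OF A'(1) cyc' sL LA] .
      have BL: "B \<subseteq> ?L" using Q.Union_superset[OF H(1)] .
      have cL: "card ?L = q * card B" using Q.card_Union[OF less.prems(1) H(1)] H(3) by simp
      then have idx: "card ?L div card B = q" using Q.card_subgroup_pos[OF sB] by simp
      have "card B < card ?L" using cL prime_gt_1_nat[OF q(1)] Q.card_subgroup_pos[OF sB] by simp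
      moreover have "card ?L \<le> card A'" using LA Q.finite_subgroup[OF sA'] card_mono by blast
      ultimately have IH: "pi_series (G Mod N) [- {p}, {p}, - {p}] ?L"
        using less.hyps[OF _ nL LA] by (meson diff_less_mono2 less_le_trans)
      show ?thesis
      proof (cases "q = p")
        case True
        then show ?thesis using Q.pi_series_prime_index[OF less.prems(1) nL BL p _ IH] idx by blast
      next
        case False
        have "pi_number (- {p}) q" 
          unfolding pi_number_p'_iff[OF p] using primes_dvd_imp_eq[OF p q(1)] False by blast
        then have "pi_factor (- {p}) B ?L" using idx BL by (simp add: pi_factor_def)
        then show ?thesis using Q.pi_series_extend_down[OF sB nL _ IH] by blast
      qed
    qed
  qed
  from this[OF Q.one_is_normal] have "pi_series (G Mod N) [- {p}, {p}, - {p}] {\<one>\<^bsub>G Mod N\<^esub>}"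
    using subgroup.one_closed[OF sA'] by blast
  then show ?thesis using pi_series_quotient_one[OF N] by blast
qed

lemma supersolvable_seq_normal: "supersolvable_seq G H \<Longrightarrow> H \<lhd> G"
  by (induction rule: supersolvable_seq.induct) (auto intro: one_is_normal)

lemma supersolvable_imp_pi_series:
  assumes "prime p" "supersolvable G"
  shows "pi_series G [- {p}, {p}, - {p}] {\<one>}"
proof -
  have "pi_series G [- {p}, {p}, - {p}] H \<Longrightarrow> pi_series G [- {p}, {p}, - {p}] {\<one>}"
    if "supersolvable_seq G H" for H
    using that
  proof (induction rule: supersolvable_seq.induct)
    case (extension K H)
    then show ?case using pi_series_cyclic_section[OF assms(1) supersolvable_seq_normal] by blast
  qed
  then show ?thesis using assms(2) pi_series_carrier unfolding supersolvable_def by blast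
qed

end

section \<open>Invariance under isomorphism\<close>

lemma iso_restrict:
  assumes "\<phi> \<in> iso A B" "H \<subseteq> carrier A"
  shows "\<phi> \<in> iso (A\<lparr>carrier := H\<rparr>) (B\<lparr>carrier := \<phi> ` H\<rparr>)"
  using assms by (auto simp: iso_iff hom_def Pi_iff subset_iff inj_on_def)

lemma iso_quotient:
  assumes "\<phi> \<in> iso A B" "N \<lhd> A"
  shows "(\<lambda>C. \<phi> ` C) \<in> iso (A Mod N) (B Mod (\<phi> ` N))"
proof -
  have h: "\<phi> \<in> hom A B" "\<phi> ` carrier A = carrier B" "inj_on \<phi> (carrier A)"
    using assms(1) by (auto simp: iso_iff)
  have sN: "subgroup N A" using normal_imp_subgroup[OF assms(2)] .
  have gA: "group A" using normal.axioms(2)[OF assms(2)] .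
  have NA: "N \<subseteq> carrier A" using subgroup.subset[OF sN] .
  have sub: "C \<subseteq> carrier A" if "C \<in> carrier (A Mod N)" for C
    using that NA monoid.r_coset_subset_G[OF group.is_monoid[OF gA]]
    by (auto simp: carrier_FactGroup)
  have coset: "\<phi> ` (N #>\<^bsub>A\<^esub> x) = \<phi> ` N #>\<^bsub>B\<^esub> \<phi> x" if "x \<in> carrier A" for x
    using coset_hom(2)[OF h(1) NA that] .
  have img: "(\<lambda>C. \<phi> ` C) ` carrier (A Mod N) = carrier (B Mod (\<phi> ` N))"
    unfolding carrier_FactGroup h(2)[symmetric] image_image by (intro image_cong refl coset)
  show ?thesis
    unfolding iso_iff
  proof (intro conjI)
    show "(\<lambda>C. \<phi> ` C) \<in> hom (A Mod N) (B Mod (\<phi> ` N))"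
    proof (rule homI)
      fix C assume "C \<in> carrier (A Mod N)"
      then show "\<phi> ` C \<in> carrier (B Mod (\<phi> ` N))" using img by blast
      fix D assume "D \<in> carrier (A Mod N)"
      then show "\<phi> ` (C \<otimes>\<^bsub>A Mod N\<^esub> D) = \<phi> ` C \<otimes>\<^bsub>B Mod (\<phi> ` N)\<^esub> \<phi> ` D"
        using set_mult_hom[OF h(1) sub sub] \<open>C \<in> carrier (A Mod N)\<close> by simp
    qed
    show "inj_on (\<lambda>C. \<phi> ` C) (carrier (A Mod N))"
      using inj_on_image_eq_iff[OF h(3)] sub by (intro inj_onI) blast
  qed (rule img)
qed

lemma chief_factor_iso:
  assumes "finite_group A" "finite_group B" "\<psi> \<in> iso B A" "chief_factor B H K"
  shows "chief_factor A (\<psi> ` H) (\<psi> ` K)"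
proof -
  interpret A: finite_group A using assms(1) .
  interpret B: finite_group B using assms(2) .
  have \<psi>: "\<psi> ` carrier B = carrier A" "inj_on \<psi> (carrier B)" using assms(3) by (auto simp: iso_iff)
  define \<phi> where "\<phi> = inv_into (carrier B) \<psi>"
  have \<phi>: "\<phi> \<in> iso A B" unfolding \<phi>_def using B.iso_set_sym[OF assms(3)] .
  have n: "H \<lhd> B" "K \<lhd> B" "K \<subset> H" using assms(4) by (auto simp: chief_factor_def)
  have sub: "S \<subseteq> carrier B" if "S \<lhd> B" for S using subgroup.subset[OF normal_imp_subgroup[OF that]] .
  have sub': "S \<subseteq> carrier A" if "S \<lhd> A" for S using subgroup.subset[OF normal_imp_subgroup[OF that]] .
  have \<phi>_\<psi>: "\<phi> ` \<psi> ` S = S" if "S \<lhd> B" for S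
    unfolding \<phi>_def using inv_into_image_cancel[OF \<psi>(2) sub[OF that]] .
  have \<psi>_\<phi>: "\<psi> ` \<phi> ` S = S" if "S \<lhd> A" for S
    unfolding \<phi>_def using image_inv_into_cancel[OF \<psi>(1) sub'[OF that]] .
  show ?thesis
    unfolding chief_factor_def
  proof (intro conjI allI impI)
    show nH: "\<psi> ` H \<lhd> A" and nK: "\<psi> ` K \<lhd> A"
      using iso_normal_subgroup[OF assms(3) B.is_group A.is_group] n by auto
    show "\<psi> ` K \<subset> \<psi> ` H" using n(3) \<phi>_\<psi>[OF n(1)] \<phi>_\<psi>[OF n(2)] by (metis image_mono psubset_eq)
    fix L assume L: "L \<lhd> A" "\<psi> ` K \<subseteq> L" "L \<subseteq> \<psi> ` H"
    have "\<phi> ` L \<lhd> B" using iso_normal_subgroup[OF \<phi> A.is_group B.is_group L(1)] .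
    moreover have "K \<subseteq> \<phi> ` L" "\<phi> ` L \<subseteq> H"
      using image_mono[OF L(2), of \<phi>] image_mono[OF L(3), of \<phi>] \<phi>_\<psi>[OF n(1)] \<phi>_\<psi>[OF n(2)] by auto
    ultimately have "\<phi> ` L = K \<or> \<phi> ` L = H" using assms(4) by (auto simp: chief_factor_def)
    then show "L = \<psi> ` K \<or> L = \<psi> ` H" using \<psi>_\<phi>[OF L(1)] by metis
  qed
qed

lemma p_supersolvable_iso:
  assumes "prime p" "finite_group A" "finite_group B" "\<phi> \<in> iso A B" "p_supersolvable p A"
  shows "p_supersolvable p B"
proof -
  interpret A: finite_group A using assms(2) .
  interpret B: finite_group B using assms(3) .
  define \<psi> where "\<psi> = inv_into (carrier A) \<phi>"
  have \<psi>: "\<psi> \<in> iso B A" unfolding \<psi>_def using A.iso_set_sym[OF assms(4)] .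
  then have inj: "inj_on \<psi> (carrier B)" by (auto simp: iso_iff)
  have "card H div card K = p \<or> pi_factor (- {p}) K H" if HK: "chief_factor B H K" for H K
  proof -
    have "K \<subseteq> H" "H \<subseteq> carrier B" "K \<subseteq> carrier B"
      using HK subgroup.subset normal_imp_subgroup by (metis chief_factor_def psubset_eq)+
    then have "card (\<psi> ` H) = card H" "card (\<psi> ` K) = card K" "K \<subseteq> H"
      using card_image inj_on_subset[OF inj] by blast+
    moreover have "card (\<psi> ` H) div card (\<psi> ` K) = p \<or> pi_factor (- {p}) (\<psi> ` K) (\<psi> ` H)"
      using A.p_supersolvable_iff[OF assms(1)] assms(5) chief_factor_iso[OF assms(2,3) \<psi> HK] by blast
    ultimately show ?thesis by (auto simp: pi_factor_def)
  qed
  then show ?thesis using B.p_supersolvable_iff[OF assms(1)] by blast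
qed

lemma supersolvable_seq_iso:
  assumes "group A" "group B" "\<phi> \<in> iso A B" "supersolvable_seq A H"
  shows "supersolvable_seq B (\<phi> ` H)"
  using assms(4)
proof (induction rule: supersolvable_seq.induct)
  case unity
  have "\<phi> \<one>\<^bsub>A\<^esub> = \<one>\<^bsub>B\<^esub>" using assms(1-3) hom_one by (auto simp: iso_iff)
  then show ?case using supersolvable_seq.unity[of B] by simp
next
  case (extension K H)
  have K: "K \<lhd> A"
    using extension.hyps(1)
    by (induction rule: supersolvable_seq.induct) (auto intro: group.one_is_normal[OF assms(1)])
  have H: "subgroup H A" using normal_imp_subgroup[OF extension.hyps(3)] .
  have K': "\<phi> ` K \<lhd> B" and H': "\<phi> ` H \<lhd> B"
    using iso_normal_subgroup[OF assms(3,1,2)] K extension.hyps(3) by auto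
  have KH: "K \<lhd> A\<lparr>carrier := H\<rparr>" using group.normal_restrict_supergroup[OF assms(1) H K extension.hyps(2)] .
  have KH': "\<phi> ` K \<lhd> B\<lparr>carrier := \<phi> ` H\<rparr>"
    using group.normal_restrict_supergroup[OF assms(2) normal_imp_subgroup[OF H'] K'] extension.hyps(2) by blast
  have "(\<lambda>C. \<phi> ` C) \<in> epi (A\<lparr>carrier := H\<rparr> Mod K) (B\<lparr>carrier := \<phi> ` H\<rparr> Mod (\<phi> ` K))"
    using iso_quotient[OF iso_restrict[OF assms(3) subgroup.subset[OF H]] KH] by (simp add: iso_iff_mon_epi)
  then have "cyclic_group (B\<lparr>carrier := \<phi> ` H\<rparr> Mod (\<phi> ` K))"
    using group.cyclic_group_epimorphic_image[OF normal.factorgroup_is_group[OF KH]]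
      extension.hyps(4) normal.factorgroup_is_group[OF KH'] by blast
  then show ?case
    using supersolvable_seq.extension[OF extension.IH image_mono[OF extension.hyps(2)] H'] by blast
qed

text \<open>
  The properties of \<open>\<U>\<close> and \<open>\<U>\<^sub>p\<close> on which the theorem rests. Isomorphism is restricted to one type,
  as the class is a predicate at one type; this is enough because only conjugate subgroups are compared.
\<close>

locale p_length_one_class =
  fixes p :: nat and F :: "'a monoid \<Rightarrow> bool"
  assumes prime_p: "prime p"
    and iso_closed: "\<lbrakk> finite_group A; finite_group B; \<phi> \<in> iso A B; F A \<rbrakk> \<Longrightarrow> F B"
    and trivial_closed: "\<lbrakk> finite_group A; card (carrier A) = 1 \<rbrakk> \<Longrightarrow> F A"
    and p_length_one: "\<lbrakk> finite_group A; F A \<rbrakk> \<Longrightarrow> pi_series A [- {p}, {p}, - {p}] {\<one>\<^bsub>A\<^esub>}"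

lemma p_length_one_class_p_supersolvable:
  assumes "prime p"
  shows "p_length_one_class p (p_supersolvable p)"
proof
  fix A B :: "'a monoid" and \<phi>
  show "prime p" using assms .
  show "finite_group A \<Longrightarrow> finite_group B \<Longrightarrow> \<phi> \<in> iso A B \<Longrightarrow> p_supersolvable p A \<Longrightarrow> p_supersolvable p B"
    using p_supersolvable_iso[OF assms] .
  assume A: "finite_group A"
  then interpret A: finite_group A .
  show "pi_series A [- {p}, {p}, - {p}] {\<one>\<^bsub>A\<^esub>}" if "p_supersolvable p A"
    using A.p_supersolvable_imp_pi_series[OF assms that A.one_is_normal] .
  assume "card (carrier A) = 1"
  then obtain a where "carrier A = {a}" by (auto simp: card_1_singleton_iff)
  then have "S = carrier A" if "S \<lhd> A" for S
    using subgroup.subset[OF normal_imp_subgroup[OF that]] subgroup.one_closed[OF normal_imp_subgroup[OF that]]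
    by auto
  then have "\<not> chief_factor A H K" for H K by (auto simp: chief_factor_def)
  then show "p_supersolvable p A" by (simp add: p_supersolvable_def)
qed

lemma p_length_one_class_supersolvable:
  assumes "prime p"
  shows "p_length_one_class p supersolvable"
proof
  fix A B :: "'a monoid" and \<phi>
  show "prime p" using assms .
  assume A: "finite_group A"
  then interpret A: finite_group A .
  show "supersolvable B" if B: "finite_group B" "\<phi> \<in> iso A B" "supersolvable A"
    using supersolvable_seq_iso[of A B \<phi> "carrier A"] A B
    by (simp add: supersolvable_def finite_group_def iso_iff)
  show "pi_series A [- {p}, {p}, - {p}] {\<one>\<^bsub>A\<^esub>}" if "supersolvable A"
    using A.supersolvable_imp_pi_series[OF assms that] .
  assume "card (carrier A) = 1"
  then have "carrier A = {\<one>\<^bsub>A\<^esub>}" using A.one_closed by (metis card_1_singletonE singletonD)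
  then show "supersolvable A" unfolding supersolvable_def by (simp add: supersolvable_seq.unity)
qed

section \<open>Residuals and the intersection of their normalisers\<close>

locale residual_norm_setting = finite_group G + p_length_one_class p F
  for G :: "('a, 'b) monoid_scheme" (structure) and p :: nat and F :: "'a set monoid \<Rightarrow> bool"
begin

abbreviation res :: "'a set \<Rightarrow> 'a set"
  where "res T \<equiv> residual F (G\<lparr>carrier := T\<rparr>)"

abbreviation conj_set :: "'a \<Rightarrow> 'a set \<Rightarrow> 'a set"
  where "conj_set g S \<equiv> (\<lambda>x. g \<otimes> x \<otimes> inv g) ` S"

text \<open>
  Every \<open>N\<close> that takes part in the intersection defining \<open>T\<^sup>\<F>\<close> has a series of type \<open>p', p, p'\<close> above it, and
  such series can be intersected. The trivial quotient \<open>T/T\<close> shows that the intersection is not over the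
  empty family.
\<close>

lemma residual_normal_series:
  assumes T: "subgroup T G"
  shows "res T \<lhd> G\<lparr>carrier := T\<rparr> \<and> pi_series (G\<lparr>carrier := T\<rparr>) [- {p}, {p}, - {p}] (res T)"
  unfolding residual_def
proof (rule finite_group.pi_series_INT[OF finite_group_subgroup[OF T]])
  interpret T: finite_group "G\<lparr>carrier := T\<rparr>" using finite_group_subgroup[OF T] .
  let ?A = "{N. N \<lhd> G\<lparr>carrier := T\<rparr> \<and> F (G\<lparr>carrier := T\<rparr> Mod N)}"
  have "?A \<subseteq> Pow T" using subgroup.subset[OF normal_imp_subgroup, of _ "G\<lparr>carrier := T\<rparr>"] by auto
  then show "finite ?A" using finite_subgroup[OF T] finite_subset by blast
  have "carrier (G\<lparr>carrier := T\<rparr>) \<in> ?A"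
  proof -
    have n: "carrier (G\<lparr>carrier := T\<rparr>) \<lhd> G\<lparr>carrier := T\<rparr>" using T.normal_self .
    have "card (carrier (G\<lparr>carrier := T\<rparr> Mod carrier (G\<lparr>carrier := T\<rparr>))) = 1"
      using T.card_quotient[OF n] T.card_subgroup_pos[OF T.subgroup_self] by simp
    then show ?thesis using trivial_closed T.finite_group_quotient[OF n] n by blast
  qed
  then show "?A \<noteq> {}" by blast
  fix N assume "N \<in> ?A"
  then have N: "N \<lhd> G\<lparr>carrier := T\<rparr>" "F (G\<lparr>carrier := T\<rparr> Mod N)" by auto
  then show "N \<lhd> G\<lparr>carrier := T\<rparr> \<and> pi_series (G\<lparr>carrier := T\<rparr>) [- {p}, {p}, - {p}] N"
    using p_length_one[OF T.finite_group_quotient[OF N(1)]] T.pi_series_quotient_one[OF N(1)] by blast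
qed

lemma conj_iso: "g \<in> carrier G \<Longrightarrow> (\<lambda>x. g \<otimes> x \<otimes> inv g) \<in> iso G G"
  unfolding iso_iff
proof (intro conjI)
  assume g: "g \<in> carrier G"
  show "(\<lambda>x. g \<otimes> x \<otimes> inv g) \<in> hom G G" using conj_hom[OF g] by (simp add: group_hom_def group_hom_axioms_def)
  show "(\<lambda>x. g \<otimes> x \<otimes> inv g) ` carrier G = carrier G"
  proof
    show "(\<lambda>x. g \<otimes> x \<otimes> inv g) ` carrier G \<subseteq> carrier G" using g by auto
    show "carrier G \<subseteq> (\<lambda>x. g \<otimes> x \<otimes> inv g) ` carrier G"
    proof
      fix y assume y: "y \<in> carrier G"
      then have "y = g \<otimes> (inv g \<otimes> y \<otimes> g) \<otimes> inv g" using conjugation_is_surj[OF g y] by simp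
      then show "y \<in> (\<lambda>x. g \<otimes> x \<otimes> inv g) ` carrier G" using g y by blast
    qed
  qed
  show "inj_on (\<lambda>x. g \<otimes> x \<otimes> inv g) (carrier G)" using conjugation_is_inj[OF g] by (intro inj_onI)
qed

lemma conj_set_subgroup:
  assumes "g \<in> carrier G" "subgroup T G"
  shows "subgroup (conj_set g T) G"
  using group_hom.subgroup_img_is_subgroup[OF conj_hom[OF assms(1)] assms(2)] .

lemma conj_set_inv:
  assumes "g \<in> carrier G" "S \<subseteq> carrier G"
  shows "conj_set g (conj_set (inv g) S) = S"
proof -
  have "g \<otimes> (inv g \<otimes> x \<otimes> inv (inv g)) \<otimes> inv g = x" if "x \<in> S" for x
    using that assms by (simp add: subsetD m_assoc inv_mult_cancel)
  then show ?thesis by (simp add: image_image)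
qed

lemma residual_conj_subset:
  assumes g: "g \<in> carrier G" and T: "subgroup T G"
  shows "res (conj_set g T) \<subseteq> conj_set g (res T)"
proof
  fix x assume x: "x \<in> res (conj_set g T)"
  interpret T: finite_group "G\<lparr>carrier := T\<rparr>" using finite_group_subgroup[OF T] .
  have sT': "subgroup (conj_set g T) G" using conj_set_subgroup[OF g T] .
  interpret T': finite_group "G\<lparr>carrier := conj_set g T\<rparr>" using finite_group_subgroup[OF sT'] .
  let ?c = "\<lambda>x. g \<otimes> x \<otimes> inv g"
  have iso: "?c \<in> iso (G\<lparr>carrier := T\<rparr>) (G\<lparr>carrier := conj_set g T\<rparr>)"
    using iso_restrict[OF conj_iso[OF g] subgroup.subset[OF T]] .
  have mem: "x \<in> conj_set g N" if N: "N \<lhd> G\<lparr>carrier := T\<rparr>" "F (G\<lparr>carrier := T\<rparr> Mod N)" for N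
  proof -
    have N': "conj_set g N \<lhd> G\<lparr>carrier := conj_set g T\<rparr>"
      using iso_normal_subgroup[OF iso T.is_group T'.is_group N(1)] .
    have "F (G\<lparr>carrier := conj_set g T\<rparr> Mod conj_set g N)"
      using iso_closed[OF T.finite_group_quotient[OF N(1)] T'.finite_group_quotient[OF N'] iso_quotient[OF iso N(1)] N(2)] .
    then show ?thesis using x N' unfolding residual_def by blast
  qed
  have sR: "subgroup (res (conj_set g T)) G"
    using residual_normal_series[OF sT'] incl_subgroup[OF sT' normal_imp_subgroup] by blast
  have xc: "x \<in> carrier G" using x subgroup.mem_carrier[OF sR] by blast
  have "inv g \<otimes> x \<otimes> g \<in> N" if N: "N \<lhd> G\<lparr>carrier := T\<rparr>" "F (G\<lparr>carrier := T\<rparr> Mod N)" for N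
  proof -
    obtain y where y: "y \<in> N" "x = g \<otimes> y \<otimes> inv g" using mem[OF N] by blast
    have "y \<in> carrier G" using subgroup.subset[OF T] subgroup.subset[OF normal_imp_subgroup[OF N(1)]] y(1) by auto
    then have "inv g \<otimes> x \<otimes> g = y" unfolding y(2) using g by (simp add: m_assoc inv_mult_cancel)
    then show ?thesis using y(1) by simp
  qed
  then have "inv g \<otimes> x \<otimes> g \<in> res T" unfolding residual_def by blast
  moreover have "x = g \<otimes> (inv g \<otimes> x \<otimes> g) \<otimes> inv g" using g xc by (simp add: m_assoc inv_mult_cancel)
  ultimately show "x \<in> conj_set g (res T)" by blast
qed

lemma residual_subgroup:
  assumes "subgroup T G"
  shows "subgroup (res T) G" "res T \<subseteq> T"
  using residual_normal_series[OF assms] incl_subgroup[OF assms] normal_imp_subgroup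
    subgroup.subset[of "res T" "G\<lparr>carrier := T\<rparr>"] by auto

lemma residual_conj:
  assumes g: "g \<in> carrier G" and T: "subgroup T G"
  shows "res (conj_set g T) = conj_set g (res T)"
proof
  show "res (conj_set g T) \<subseteq> conj_set g (res T)" using residual_conj_subset[OF assms] .
  have ig: "inv g \<in> carrier G" using g by simp
  have T': "subgroup (conj_set g T) G" using conj_set_subgroup[OF g T] .
  have "conj_set (inv g) (conj_set g T) = T"
    using conj_set_inv[OF ig subgroup.subset[OF T]] g by simp
  then have "res T \<subseteq> conj_set (inv g) (res (conj_set g T))"
    using residual_conj_subset[OF ig T'] by simp
  then have "conj_set g (res T) \<subseteq> conj_set g (conj_set (inv g) (res (conj_set g T)))" by (rule image_mono)
  also have "\<dots> = res (conj_set g T)"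
    using conj_set_inv[OF g subgroup.subset[OF residual_subgroup(1)[OF T']]] .
  finally show "conj_set g (res T) \<subseteq> res (conj_set g T)" .
qed

lemma mem_residual_norm_iff:
  "n \<in> residual_norm F G \<longleftrightarrow>
    n \<in> carrier G \<and> (\<forall>T. subgroup T G \<longrightarrow> (\<forall>h\<in>res T. n \<otimes> h \<otimes> inv n \<in> res T))"
proof -
  have "n \<in> normalizer G (res T) \<longleftrightarrow> n \<in> carrier G \<and> (\<forall>h\<in>res T. n \<otimes> h \<otimes> inv n \<in> res T)"
    if "subgroup T G" for T
    using mem_normalizer_iff[OF finite_subgroup subgroup.subset] residual_subgroup(1)[OF that] by blast
  then show ?thesis unfolding residual_norm_def using subgroup_self by auto
qed

text \<open>
  Conjugation permutes the subgroups \<open>T\<close> and carries residuals to residuals.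
\<close>

lemma residual_norm_normal: "residual_norm F G \<lhd> G"
proof (rule normal_invI)
  show "subgroup (residual_norm F G) G"
    unfolding residual_norm_def
  proof (rule subgroups_Inter)
    show "subgroup H G" if "H \<in> (\<lambda>T. normalizer G (res T)) ` {T. subgroup T G}" for H
      using that normalizer_imp_subgroup subgroup.subset residual_subgroup(1) by blast
    show "(\<lambda>T. normalizer G (res T)) ` {T. subgroup T G} \<noteq> {}" using subgroup_self by blast
  qed
  fix g n assume g: "g \<in> carrier G" and n: "n \<in> residual_norm F G"
  have nc: "n \<in> carrier G" using n mem_residual_norm_iff by blast
  have "(g \<otimes> n \<otimes> inv g) \<otimes> h \<otimes> inv (g \<otimes> n \<otimes> inv g) \<in> res T" if T: "subgroup T G" and h: "h \<in> res T" for T h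
  proof -
    have ig: "inv g \<in> carrier G" using g by simp
    have hc: "h \<in> carrier G" using h subgroup.mem_carrier[OF residual_subgroup(1)[OF T]] by blast
    have T': "subgroup (conj_set (inv g) T) G" using conj_set_subgroup[OF ig T] .
    have "inv g \<otimes> h \<otimes> inv (inv g) \<in> res (conj_set (inv g) T)"
      unfolding residual_conj[OF ig T] using h by blast
    then have "n \<otimes> (inv g \<otimes> h \<otimes> inv (inv g)) \<otimes> inv n \<in> res (conj_set (inv g) T)"
      using n T' mem_residual_norm_iff by blast
    then obtain y where y: "y \<in> res T" "n \<otimes> (inv g \<otimes> h \<otimes> inv (inv g)) \<otimes> inv n = inv g \<otimes> y \<otimes> inv (inv g)"
      unfolding residual_conj[OF ig T] by blast
    have yc: "y \<in> carrier G" using y(1) subgroup.mem_carrier[OF residual_subgroup(1)[OF T]] by blast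
    have "(g \<otimes> n \<otimes> inv g) \<otimes> h \<otimes> inv (g \<otimes> n \<otimes> inv g)
      = g \<otimes> (n \<otimes> (inv g \<otimes> h \<otimes> inv (inv g)) \<otimes> inv n) \<otimes> inv g"
      using g nc hc by (simp add: m_assoc inv_mult_group)
    also have "\<dots> = y" unfolding y(2) using g yc by (simp add: m_assoc inv_mult_cancel)
    finally show ?thesis using y(1) by simp
  qed
  then show "g \<otimes> n \<otimes> inv g \<in> residual_norm F G"
    using mem_residual_norm_iff g nc by simp
qed

section \<open>Descending through the intersection of the normalisers\<close>

text \<open>
  Put \<open>R = T\<^sup>\<F>\<close>. The residual is normal in \<open>G = LT\<close>, as \<open>T\<close> normalises it and \<open>L \<le> N\<^bsub>\<F>\<^esub>(G)\<close> does too. It follows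
  that \<open>KR \<inter> L = K\<close>, and that \<open>G/KR\<close> has type \<open>p', p, p', p, p'\<close>: there is a trivial \<open>p'\<close>-factor, then the
  \<open>p\<close>-group \<open>LR/KR\<close>, and then \<open>G/LR\<close>, a quotient of \<open>T/T\<^sup>\<F>\<close>.
\<close>

lemma pi_series_supplemented:
  assumes chief: "chief_factor G L K" and LN: "L \<subseteq> residual_norm F G" and pL: "pi_factor {p} K L"
    and T: "subgroup T G" "K \<subseteq> T" "L <#> T = carrier G" "T \<noteq> carrier G"
    and series: "pi_series G ([- {p}, {p}, - {p}, {p}, - {p}] @ v) L"
  shows "pi_series G ([- {p}, {p}, - {p}, {p}, - {p}] @ v) K"
proof -
  have LK: "L \<lhd> G" "K \<lhd> G" "K \<subseteq> L" using chief by (auto simp: chief_factor_def)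
  note sL = normal_imp_subgroup[OF LK(1)] and sK = normal_imp_subgroup[OF LK(2)]
  let ?R = "res T"
  have R: "?R \<lhd> G\<lparr>carrier := T\<rparr>" "pi_series (G\<lparr>carrier := T\<rparr>) [- {p}, {p}, - {p}] ?R"
    using residual_normal_series[OF T(1)] by auto
  note sR = residual_subgroup(1)[OF T(1)]
  have norm_iff: "g \<in> normalizer G ?R \<longleftrightarrow> g \<in> carrier G \<and> (\<forall>h\<in>?R. g \<otimes> h \<otimes> inv g \<in> ?R)" for g
    using mem_normalizer_iff[OF finite_subgroup[OF sR] subgroup.subset[OF sR]] .
  have sNR: "subgroup (normalizer G ?R) G" using normalizer_imp_subgroup[OF subgroup.subset[OF sR]] .
  have "L \<subseteq> normalizer G ?R"
    unfolding subset_iff norm_iff using LN mem_residual_norm_iff T(1) by blast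
  moreover have "T \<subseteq> normalizer G ?R"
  proof
    fix t assume t: "t \<in> T"
    have "t \<otimes> h \<otimes> inv t \<in> ?R" if "h \<in> ?R" for h
      using group.normal_invE(2)[OF subgroup_imp_group[OF T(1)] R(1), of t h] t that
        m_inv_consistent[OF T(1) t] by simp
    then show "t \<in> normalizer G ?R" using norm_iff t subgroup.mem_carrier[OF T(1)] by blast
  qed
  ultimately have "carrier G \<subseteq> normalizer G ?R"
    unfolding T(3)[symmetric] by (rule set_mult_least[OF sNR])
  then have nR: "?R \<lhd> G" using normal_if_normalizer[OF sR] by simp
  let ?S = "K <#> ?R"
  have nS: "?S \<lhd> G" using normal_set_mult[OF LK(2) nR] .
  note sS = normal_imp_subgroup[OF nS]
  have KS: "K \<subseteq> ?S" and RS: "?R \<subseteq> ?S" using set_mult_superset[OF sK sR] .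
  have ST: "?S \<subseteq> T" using set_mult_least[OF T(1,2) residual_subgroup(2)[OF T(1)]] .
  have "?S \<inter> L = L \<or> ?S \<inter> L = K"
    using chief KS LK(3) normal_subgroup_intersect[OF nS LK(1)] unfolding chief_factor_def by blast
  moreover have "?S \<inter> L \<noteq> L"
  proof
    assume "?S \<inter> L = L"
    then have "L \<subseteq> T" using ST by blast
    then have "carrier G \<subseteq> T" unfolding T(3)[symmetric] using set_mult_least[OF T(1)] by blast
    then show False using T(4) subgroup.subset[OF T(1)] by blast
  qed
  ultimately have SL: "?S \<inter> L = K" by blast
  have "?S <#> K = ?S" "?S <#> L = L <#> ?R"
  proof -
    show "?S <#> K = ?S"
      using set_mult_superset(1)[OF sS sK] set_mult_least[OF sS order_refl KS] by blast
    have sLR: "subgroup (L <#> ?R) G" using set_mult_normal_subgroup[OF LK(1) sR] .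
    have sSL: "subgroup (?S <#> L) G" using set_mult_normal_subgroup[OF nS sL] .
    have LRsup: "L \<subseteq> L <#> ?R" "?R \<subseteq> L <#> ?R" using set_mult_superset[OF sL sR] .
    have SLsup: "?S \<subseteq> ?S <#> L" "L \<subseteq> ?S <#> L" using set_mult_superset[OF sS sL] .
    have "?S \<subseteq> L <#> ?R" using set_mult_least[OF sLR] LK(3) LRsup by blast
    then have "?S <#> L \<subseteq> L <#> ?R" using set_mult_least[OF sLR] LRsup by blast
    moreover have "L <#> ?R \<subseteq> ?S <#> L" using set_mult_least[OF sSL] SLsup RS by blast
    ultimately show "?S <#> L = L <#> ?R" by blast
  qed
  then have fac: "pi_factor {p} ?S (L <#> ?R)" using pi_factor_set_mult[OF sK sL pL nS] by simp
  have LR: "L <#> ?R \<lhd> G" "pi_series G [- {p}, {p}, - {p}] (L <#> ?R)"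
    using pi_series_supplement[OF T(1) LK(1) T(3) R] .
  have "pi_series G [- {p}, {p}, - {p}, {p}, - {p}] ?S"
    using LR fac nS pi_factor_refl[OF sS, of "- {p}"] by auto
  then have "pi_series G ([- {p}, {p}, - {p}, {p}, - {p}] @ v) ?S" by (rule pi_series_append)
  then show ?thesis using pi_series_Int[OF nS LK(1) _ series] SL by simp
qed

text \<open>
  Here \<open>L/K\<close> lies in the Frattini subgroup of \<open>G/K\<close>, so the result without proper supplements applies in
  \<open>G/K\<close>.
\<close>

lemma pi_series_unsupplemented:
  assumes chief: "chief_factor G L K" and pL: "pi_factor {p} K L"
    and no_supp: "\<And>T. subgroup T G \<Longrightarrow> K \<subseteq> T \<Longrightarrow> L <#> T = carrier G \<Longrightarrow> T = carrier G"
    and series: "pi_series G (- {p} # {p} # w) L"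
  shows "pi_series G (- {p} # {p} # w) K"
proof -
  have LK: "L \<lhd> G" "K \<lhd> G" "K \<subseteq> L" using chief by (auto simp: chief_factor_def)
  interpret Q: finite_group "G Mod K" using finite_group_quotient[OF LK(2)] .
  obtain A where A: "A \<lhd> G Mod K" "L = \<Union>A" "chief_factor (G Mod K) A {\<one>\<^bsub>G Mod K\<^esub>}"
    and fac: "\<And>\<pi>. pi_factor \<pi> K L \<longleftrightarrow> pi_number \<pi> (card A)"
    using chief_factor_as_quotient[OF chief] by metis
  have pA: "pi_number {p} (card A)" using fac pL by blast
  have "T' = carrier (G Mod K)"
    if T': "subgroup T' (G Mod K)" "A <#>\<^bsub>G Mod K\<^esub> T' = carrier (G Mod K)" for T'
  proof -
    have sT: "subgroup (\<Union>T') G" and KT: "K \<subseteq> \<Union>T'"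
      using subgroup_Union[OF LK(2) T'(1)] Union_superset[OF T'(1)] .
    have "L <#> \<Union>T' = carrier G"
    proof
      show "L <#> \<Union>T' \<subseteq> carrier G"
        using set_mult_least[OF subgroup_self subgroup.subset[OF normal_imp_subgroup[OF LK(1)]] subgroup.subset[OF sT]] .
      show "carrier G \<subseteq> L <#> \<Union>T'"
      proof
        fix g assume g: "g \<in> carrier G"
        then have "K #> g \<in> A <#>\<^bsub>G Mod K\<^esub> T'" unfolding T'(2) by (auto simp: carrier_FactGroup)
        then obtain a t where at: "a \<in> A" "t \<in> T'" "K #> g = a <#> t" by (auto simp: set_mult_def)
        have "g \<in> a <#> t" using rcos_self[OF g normal_imp_subgroup[OF LK(2)]] at(3) by simp
        then show "g \<in> L <#> \<Union>T'" using at(1,2) A(2) by (auto simp: set_mult_def)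
      qed
    qed
    then have "\<Union>T' = carrier G" using no_supp[OF sT KT] by blast
    then show ?thesis
      using Union_eq_iff[OF LK(2) T'(1) Q.subgroup_self] Union_carrier[OF LK(2)] by simp
  qed
  moreover have "pi_series (G Mod K) (- {p} # {p} # w) A"
    using pi_series_quotient[OF LK(2) A(1)] series A(2) by blast
  ultimately have "pi_series (G Mod K) (- {p} # {p} # w) {\<one>\<^bsub>G Mod K\<^esub>}"
    using Q.pi_series_Frattini[OF A(1) Q.minimal_normal_p_group_abelian[OF A(3) prime_p pA] pA] by blast
  then show ?thesis using pi_series_quotient_one[OF LK(2)] by blast
qed

theorem pi_series_residual_norm:
  assumes solv: "p_solvable p G" and w: "w = [- {p}, {p}, - {p}, {p}, - {p}] @ v"
    and series: "pi_series G w (residual_norm F G)"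
  shows "pi_series G w {\<one>}"
proof -
  let ?N = "residual_norm F G"
  note nN = residual_norm_normal
  note sN = normal_imp_subgroup[OF nN]
  have "pi_series G w K" if "K \<lhd> G" "K \<subseteq> ?N" for K
    using that
  proof (induction "card ?N - card K" arbitrary: K rule: less_induct)
    case less
    note sK = normal_imp_subgroup[OF less.prems(1)]
    show ?case
    proof (cases "K = ?N")
      case True
      then show ?thesis using series by simp
    next
      case False
      then have "K \<subset> ?N" using less.prems(2) by blast
      then obtain L where L: "chief_factor G L K" "L \<subseteq> ?N"
        using ex_chief_factor[OF less.prems(1) nN] by blast
      then have LK: "L \<lhd> G" "K \<subset> L" by (auto simp: chief_factor_def)
      note sL = normal_imp_subgroup[OF LK(1)]
      have "card K < card L" using LK finite_subgroup[OF sL] psubset_card_mono by blast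
      moreover have "card L \<le> card ?N" using L(2) finite_subgroup[OF sN] card_mono by blast
      ultimately have IH: "pi_series G w L"
        using less.hyps[OF _ LK(1) L(2)] by (meson diff_less_mono2 less_le_trans)
      consider "pi_factor (- {p}) K L" | "pi_factor {p} K L"
        using p_solvable_iff[OF prime_p] solv L(1) by blast
      then show ?thesis
      proof cases
        case 1
        have "w = - {p} # [{p}, - {p}, {p}, - {p}] @ v" using w by simp
        then show ?thesis using pi_series_extend_down[OF sK LK(1) 1] IH by blast
      next
        case 2
        show ?thesis
        proof (cases "\<exists>T. subgroup T G \<and> K \<subseteq> T \<and> L <#> T = carrier G \<and> T \<noteq> carrier G")
          case True
          then show ?thesis using pi_series_supplemented[OF L 2] IH w by blast
        next
          case False
          have "w = - {p} # {p} # [- {p}, {p}, - {p}] @ v" using w by simp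
          then show ?thesis using pi_series_unsupplemented[OF L(1) 2] IH False by blast
        qed
      qed
    qed
  qed
  moreover have "{\<one>} \<subseteq> ?N" using subgroup.one_closed[OF sN] by blast
  ultimately show ?thesis using one_is_normal by blast
qed

end

lemma (in finite_group) pi_series_residual_norm_series:
  fixes F :: "'a set set monoid \<Rightarrow> bool"
  assumes "p_length_one_class p F" and solv: "p_solvable p G"
    and w: "w = [- {p}, {p}, - {p}, {p}, - {p}] @ v"
  shows "residual_norm_series F G n \<lhd> G \<and>
    (pi_series G w (residual_norm_series F G n) \<longleftrightarrow> pi_series G w {\<one>})"
proof (induction n)
  case 0
  show ?case using one_is_normal by simp
next
  case (Suc n)
  let ?Y = "residual_norm_series F G n" and ?Z = "residual_norm_series F G (Suc n)"
  have Y: "?Y \<lhd> G" using Suc by blast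
  interpret Q: finite_group "G Mod ?Y" using finite_group_quotient[OF Y] .
  interpret Q: residual_norm_setting "G Mod ?Y" p F
    using assms(1) Q.finite_group_axioms by (simp add: residual_norm_setting_def)
  have Z: "?Z \<lhd> G" using normal_Union[OF Y Q.residual_norm_normal] by simp
  have "pi_series G w ?Y" if "pi_series G w ?Z"
  proof -
    have "pi_series (G Mod ?Y) w (residual_norm F (G Mod ?Y))"
      using that pi_series_quotient[OF Y Q.residual_norm_normal] by simp
    then have "pi_series (G Mod ?Y) w {\<one>\<^bsub>G Mod ?Y\<^esub>}"
      using Q.pi_series_residual_norm[OF p_solvable_quotient[OF Q.prime_p solv Y] w] by blast
    then show ?thesis using pi_series_quotient_one[OF Y] by blast
  qed
  moreover have "{\<one>} \<subseteq> ?Z" using subgroup.one_closed[OF normal_imp_subgroup[OF Z]] by blast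
  ultimately show ?case using Z Suc pi_series_mono[OF one_is_normal Z] by blast
qed

lemma (in finite_group) pi_series_mod_residual_norm_inf:
  fixes F :: "'a set set monoid \<Rightarrow> bool"
  assumes "p_length_one_class p F" "p_solvable p G"
    and "w = [- {p}, {p}, - {p}, {p}, - {p}] @ v"
  shows "residual_norm_inf F G \<lhd> G"
    and "pi_series (G Mod residual_norm_inf F G) w {\<one>\<^bsub>G Mod residual_norm_inf F G\<^esub>} \<longleftrightarrow> pi_series G w {\<one>}"
proof -
  have *: "residual_norm_inf F G \<lhd> G \<and> (pi_series G w (residual_norm_inf F G) \<longleftrightarrow> pi_series G w {\<one>})"
    unfolding residual_norm_inf_def by (rule pi_series_residual_norm_series[OF assms])
  then show "residual_norm_inf F G \<lhd> G" by blast
  then show "pi_series (G Mod residual_norm_inf F G) w {\<one>\<^bsub>G Mod residual_norm_inf F G\<^esub>} \<longleftrightarrow> pi_series G w {\<one>}"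
    using * pi_series_quotient_one by blast
qed

section \<open>The two length bounds\<close>

text \<open>
  In this and the next lemma the bound on \<open>k\<close> is the least one for which the word begins with
  \<open>p', p, p', p, p'\<close>. This is the origin of the bounds in the theorem.
\<close>

lemma upper_word_ge_2:
  assumes "2 \<le> k"
  shows "\<exists>v. upper_word p k @ [- {p}] = [- {p}, {p}, - {p}, {p}, - {p}] @ v"
proof -
  obtain j where "k = Suc (Suc j)" using assms by (metis Suc_le_D numeral_2_eq_2 Suc_le_mono)
  then show ?thesis by (cases j) (auto simp: upper_word_def)
qed

lemma upper_word_ge_3:
  assumes "3 \<le> k"
  shows "\<exists>v. upper_word p k = [- {p}, {p}, - {p}, {p}, - {p}] @ v"
proof -
  obtain j where "k = 3 + j" using assms le_Suc_ex by blast
  then show ?thesis by (simp add: upper_word_def numeral_3_eq_3)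
qed

theorem theorem5p4:
  fixes G :: "('a, 'b) monoid_scheme" and p :: nat
  assumes "group G" and "finite (carrier G)" and "p \<in> prime_factors (order G)"
  shows
    "(p_solvable p G \<longrightarrow>
       (\<forall>k\<ge>3. p_Fitting_length p G \<le> k \<longleftrightarrow>
              p_Fitting_length p (G Mod residual_norm_inf (p_supersolvable p) G) \<le> k)) \<and>
     (solvable G \<longrightarrow>
       (\<forall>k\<ge>2. p_length p G \<le> k \<longleftrightarrow>
              p_length p (G Mod residual_norm_inf supersolvable G) \<le> k))"
proof -
  interpret finite_group G using assms(1,2) by (simp add: finite_group_def finite_group_axioms_def)
  have p: "prime p" using assms(3) by (rule in_prime_factors_imp_prime)
  show ?thesis
  proof (intro conjI impI allI)
    fix k :: nat assume solv: "p_solvable p G" and k: "3 \<le> k"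
    obtain v where v: "upper_word p k = [- {p}, {p}, - {p}, {p}, - {p}] @ v"
      using upper_word_ge_3[OF k] by blast
    note N = pi_series_mod_residual_norm_inf[OF p_length_one_class_p_supersolvable[OF p] solv v]
    interpret Q: finite_group "G Mod residual_norm_inf (p_supersolvable p) G"
      using finite_group_quotient[OF N(1)] .
    show "p_Fitting_length p G \<le> k \<longleftrightarrow>
        p_Fitting_length p (G Mod residual_norm_inf (p_supersolvable p) G) \<le> k"
      using p_Fitting_length_le_iff[OF p solv, of k] N(2) k
        Q.p_Fitting_length_le_iff[OF p p_solvable_quotient[OF p solv N(1)], of k] by simp
  next
    fix k :: nat assume "solvable G" and k: "2 \<le> k"
    then have solv: "p_solvable p G" using solvable_imp_p_solvable[OF p] by blast
    obtain v where v: "upper_word p k @ [- {p}] = [- {p}, {p}, - {p}, {p}, - {p}] @ v"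
      using upper_word_ge_2[OF k] by blast
    note N = pi_series_mod_residual_norm_inf[OF p_length_one_class_supersolvable[OF p] solv v]
    interpret Q: finite_group "G Mod residual_norm_inf supersolvable G"
      using finite_group_quotient[OF N(1)] .
    show "p_length p G \<le> k \<longleftrightarrow> p_length p (G Mod residual_norm_inf supersolvable G) \<le> k"
      using p_length_le_iff[OF p solv, of k] N(2)
        Q.p_length_le_iff[OF p p_solvable_quotient[OF p solv N(1)], of k] by simp
  qed
qed

end
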